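(* Let $p=p_n\to\infty$. Suppose under the true measure $\mathbb{P}_{0,G_0}$ the observations $Y_1,\dots,Y_n$ are i.i.d. $N_{p_n}(0,\bar\Omega_n^{-1})$, where $\bar\Omega_n\in P_{G_{0n}}$ for a decomposable graph $G_{0n}=(V_{0n},E_{0n})$ on $\{1,\dots,p_n\}$ whose vertices are ordered according to a perfect vertex elimination scheme, and (Assumption D) there is a constant $k_\sigma\in(0,1]$ independent of $n$ with $k_\sigma\le\lambda_{\min}(\bar\Omega_n)\le\lambda_{\max}(\bar\Omega_n)\le1/k_\sigma$; (Assumption F) $(p_n+|E_{0n}|)\log p_n=o(n)$. Consider the working model $Y_i$ i.i.d. $N_p(0,\Omega^{-1})$ with the hierarchical $G$-Wishart prior $\Omega\mid G\sim W_G(\beta,\Psi_{3n})$ on $P_G$, $G\sim\pi(G)$ on the set $\mathcal{D}$ of decomposable graphs on $\{1,\dots,p\}$, where $\beta>0$ and $\Psi_{3n}$ is positive definite with largest eigenvalue at most $a<\infty$ for all $n$, and assume (Assumption J) $\pi_n(G_{0n}\mid Y_1,\dots,Y_n)\to1$ in $\mathbb{P}_{0,G_0}$-probability. Then for a sufficiently large constant $M$, $$\Pi_{4n}\Bigl(\|\Omega-\bar\Omega_n\|_F>M\sqrt{\tfrac{(p_n+|E_{0n}|)\log p_n}{n}}\ \Bigm|\ Y_1,\dots,Y_n\Bigr)\to0$$ in $\mathbb{P}_{0,G_0}$-probability as $n\to\infty$.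
   Context: $\|\cdot\|_F$ is the Frobenius norm; $|E_{0n}|$ is the number of edges of $G_{0n}$. An undirected graph is decomposable if it has no induced cycle of length $\ge4$. $M_G$ is the set of symmetric $p\times p$ matrices $A$ with $A_{ij}=0$ whenever $i\ne j$ and $(i,j)\notin E$; $P_G$ its positive definite elements. $W_G(\beta,\Psi)$ has density on $P_G$ proportional to $\det(\Omega)^{\beta/2}\exp(-\operatorname{tr}(\Psi\Omega)/2)$. $\pi_n(\cdot\mid Y_1,\dots,Y_n)$ is the posterior of $G$ and $\Pi_{4n}(\cdot\mid Y_1,\dots,Y_n)$ the marginal posterior of $\Omega$. *)

theory Defs
  imports "HOL-Probability.Probability" "HOL-Library.Landau_Symbols"
          "Jordan_Normal_Form.Char_Poly" "Jordan_Normal_Form.Determinant"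
begin

text \<open>Vertices of a graph on p vertices are 0,...,p-1 (the paper's 1,...,p shifted).
 An undirected simple graph is given by its edge set of unordered pairs,
 each stored once as (i,j) with i < j < p.\<close>

definition graph_pairs :: "nat \<Rightarrow> (nat \<times> nat) set" where
  "graph_pairs p = {(i,j). i < j \<and> j < p}"

definition is_graph :: "nat \<Rightarrow> (nat \<times> nat) set \<Rightarrow> bool" where
  "is_graph p E \<longleftrightarrow> E \<subseteq> graph_pairs p"

definition adj :: "(nat \<times> nat) set \<Rightarrow> nat \<Rightarrow> nat \<Rightarrow> bool" where
  "adj E i j \<longleftrightarrow> i \<noteq> j \<and> (min i j, max i j) \<in> E"

definition induced_cycle :: "nat \<Rightarrow> (nat \<times> nat) set \<Rightarrow> nat list \<Rightarrow> bool" where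
  "induced_cycle p E vs \<longleftrightarrow> distinct vs \<and> set vs \<subseteq> {..<p} \<and>
     (\<forall>a < length vs. \<forall>b < length vs.
        adj E (vs ! a) (vs ! b) \<longleftrightarrow>
          (b = (a + 1) mod length vs \<or> a = (b + 1) mod length vs))"

definition decomposable :: "nat \<Rightarrow> (nat \<times> nat) set \<Rightarrow> bool" where
  "decomposable p E \<longleftrightarrow> is_graph p E \<and>
     \<not> (\<exists>vs. length vs \<ge> 4 \<and> induced_cycle p E vs)"

definition decomp_graphs :: "nat \<Rightarrow> (nat \<times> nat) set set" where
  "decomp_graphs p = {E. decomposable p E}"

definition perfect_elim_order :: "nat \<Rightarrow> (nat \<times> nat) set \<Rightarrow> bool" where
  "perfect_elim_order p E \<longleftrightarrow> (\<forall>i < p. \<forall>j < p. \<forall>k < p.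
      i < j \<and> i < k \<and> j \<noteq> k \<and> adj E i j \<and> adj E i k \<longrightarrow> adj E j k)"

definition symmetric_mat :: "real mat \<Rightarrow> bool" where
  "symmetric_mat A \<longleftrightarrow> transpose_mat A = A"

definition pos_def :: "nat \<Rightarrow> real mat \<Rightarrow> bool" where
  "pos_def p A \<longleftrightarrow> A \<in> carrier_mat p p \<and> symmetric_mat A \<and>
     (\<forall>x \<in> carrier_vec p. x \<noteq> 0\<^sub>v p \<longrightarrow> x \<bullet> (A *\<^sub>v x) > 0)"

definition in_MG :: "nat \<Rightarrow> (nat \<times> nat) set \<Rightarrow> real mat \<Rightarrow> bool" where
  "in_MG p E A \<longleftrightarrow> A \<in> carrier_mat p p \<and> symmetric_mat A \<and>
     (\<forall>i < p. \<forall>j < p. i \<noteq> j \<and> \<not> adj E i j \<longrightarrow> A $$ (i,j) = 0)"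

definition in_PG :: "nat \<Rightarrow> (nat \<times> nat) set \<Rightarrow> real mat \<Rightarrow> bool" where
  "in_PG p E A \<longleftrightarrow> in_MG p E A \<and> pos_def p A"

definition trace_mat :: "nat \<Rightarrow> real mat \<Rightarrow> real" where
  "trace_mat p A = (\<Sum>i<p. A $$ (i,i))"

definition frob_norm :: "nat \<Rightarrow> real mat \<Rightarrow> real" where
  "frob_norm p A = sqrt (\<Sum>i<p. \<Sum>j<p. (A $$ (i,j))\<^sup>2)"

text \<open>Free coordinates of M_G (diagonal and edges, upper triangle) and the matrix
 in M_G they determine; Lebesgue measure on M_G is Lebesgue measure in these coordinates.\<close>
definition free_coords :: "nat \<Rightarrow> (nat \<times> nat) set \<Rightarrow> (nat \<times> nat) set" where
  "free_coords p E = {(i,i) | i. i < p} \<union> E"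

definition coord_mat :: "nat \<Rightarrow> (nat \<times> nat) set \<Rightarrow> (nat \<times> nat \<Rightarrow> real) \<Rightarrow> real mat" where
  "coord_mat p E w = mat p p (\<lambda>(i,j).
      if (min i j, max i j) \<in> free_coords p E then w (min i j, max i j) else 0)"

definition leb_MG :: "nat \<Rightarrow> (nat \<times> nat) set \<Rightarrow> (nat \<times> nat \<Rightarrow> real) measure" where
  "leb_MG p E = PiM (free_coords p E) (\<lambda>_. lborel)"

definition gauss_dens :: "nat \<Rightarrow> real mat \<Rightarrow> (nat \<Rightarrow> real) \<Rightarrow> real" where
  "gauss_dens p \<Omega> x = (2 * pi) powr (- real p / 2) * sqrt (det \<Omega>) *
      exp (- (\<Sum>i<p. \<Sum>j<p. x i * \<Omega> $$ (i,j) * x j) / 2)"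

definition gaussian :: "nat \<Rightarrow> real mat \<Rightarrow> (nat \<Rightarrow> real) measure" where
  "gaussian p \<Omega> = density (PiM {..<p} (\<lambda>_. lborel)) (\<lambda>x. ennreal (gauss_dens p \<Omega> x))"

definition sample_law :: "nat \<Rightarrow> nat \<Rightarrow> real mat \<Rightarrow> (nat \<Rightarrow> nat \<Rightarrow> real) measure" where
  "sample_law n p \<Omega> = PiM {..<n} (\<lambda>_. gaussian p \<Omega>)"

definition likelihood :: "nat \<Rightarrow> nat \<Rightarrow> real mat \<Rightarrow> (nat \<Rightarrow> nat \<Rightarrow> real) \<Rightarrow> real" where
  "likelihood n p \<Omega> Y = (\<Prod>i<n. gauss_dens p \<Omega> (Y i))"

definition gwish_kernel :: "nat \<Rightarrow> real \<Rightarrow> real mat \<Rightarrow> real mat \<Rightarrow> real" where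
  "gwish_kernel p \<beta> \<Psi> \<Omega> = det \<Omega> powr (\<beta> / 2) * exp (- trace_mat p (\<Psi> * \<Omega>) / 2)"

definition gwish_const :: "nat \<Rightarrow> (nat \<times> nat) set \<Rightarrow> real \<Rightarrow> real mat \<Rightarrow> ennreal" where
  "gwish_const p E \<beta> \<Psi> = (\<integral>\<^sup>+ w. indicator {w. in_PG p E (coord_mat p E w)} w *
       ennreal (gwish_kernel p \<beta> \<Psi> (coord_mat p E w)) \<partial>leb_MG p E)"

definition marg_part :: "nat \<Rightarrow> nat \<Rightarrow> (nat \<times> nat) set \<Rightarrow> real \<Rightarrow> real mat \<Rightarrow>
    (real mat \<Rightarrow> bool) \<Rightarrow> (nat \<Rightarrow> nat \<Rightarrow> real) \<Rightarrow> ennreal" where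
  "marg_part n p E \<beta> \<Psi> A Y = (\<integral>\<^sup>+ w.
       indicator {w. in_PG p E (coord_mat p E w) \<and> A (coord_mat p E w)} w *
       ennreal (gwish_kernel p \<beta> \<Psi> (coord_mat p E w)) *
       ennreal (likelihood n p (coord_mat p E w) Y) \<partial>leb_MG p E) / gwish_const p E \<beta> \<Psi>"

definition post_graph :: "nat \<Rightarrow> nat \<Rightarrow> real \<Rightarrow> real mat \<Rightarrow> ((nat \<times> nat) set \<Rightarrow> real) \<Rightarrow>
    (nat \<Rightarrow> nat \<Rightarrow> real) \<Rightarrow> (nat \<times> nat) set \<Rightarrow> real" where
  "post_graph n p \<beta> \<Psi> \<pi> Y G = enn2real
     (ennreal (\<pi> G) * marg_part n p G \<beta> \<Psi> (\<lambda>_. True) Y /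
      (\<Sum>G' \<in> decomp_graphs p. ennreal (\<pi> G') * marg_part n p G' \<beta> \<Psi> (\<lambda>_. True) Y))"

definition post_prec :: "nat \<Rightarrow> nat \<Rightarrow> real \<Rightarrow> real mat \<Rightarrow> ((nat \<times> nat) set \<Rightarrow> real) \<Rightarrow>
    (nat \<Rightarrow> nat \<Rightarrow> real) \<Rightarrow> (real mat \<Rightarrow> bool) \<Rightarrow> real" where
  "post_prec n p \<beta> \<Psi> \<pi> Y A = enn2real
     ((\<Sum>G \<in> decomp_graphs p. ennreal (\<pi> G) * marg_part n p G \<beta> \<Psi> A Y) /
      (\<Sum>G \<in> decomp_graphs p. ennreal (\<pi> G) * marg_part n p G \<beta> \<Psi> (\<lambda>_. True) Y))"

text \<open>Outer probability (coincides with the probability for measurable events).\<close>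
definition outer_prob :: "'a measure \<Rightarrow> 'a set \<Rightarrow> real" where
  "outer_prob M A = Inf {measure M B | B. B \<in> sets M \<and> A \<inter> space M \<subseteq> B}"

end

theory Submission
  imports Defs
begin

text \<open>Given the true graph, the logarithm of the posterior kernel is a concave function g on the
  linear space M_G of dimension s = p + card E. The dilation Omega \<mapsto> 2 Omega - Omega0 has
  Jacobian 2 ^ s, so the posterior odds of the tail at distance R are at most 2 ^ s times the supremum
  over the tail of exp (g Omega - g Mid), where Mid is the midpoint of Omega and Omega0. By concavity
  this increment of g is at most its increment from Omega0 to the point at distance R / 2 on the same
  ray. There the Cholesky factor gives the quadratic bound
  ln det Omega - ln det Omega0 - tr (inv Omega0 (Omega - Omega0)) <= - c * norm (Omega - Omega0) ^ 2,
  while Chebyshev's inequality controls the sample covariance on the support of M_G, so that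
  the increment is at most - 2 s ln p once M is large. Assumption J reduces the full posterior to
  this case. No lower bound on the normalising integral is needed.\<close>

section \<open>Whitening by Cholesky factors\<close>

text \<open>The quadratic bound on ln det is local: far out, ln det falls below its tangent only
  linearly in the distance. Hence the drop is measured on a small sphere and carried outwards by
  concavity, and R must tend to 0 (\<open>assmF\<close>) so that R / 2 lies in the quadratic range.
  Comparing with the midpoint rather than with Omega0 bounds the tail by an integral that is itself
  part of the evidence. The drop 2 s ln p beats the Jacobian 2 ^ s and still leaves a factor 1 / p.
  Directions in M_G see only the diagonal and edge entries of the sample covariance, at most 2 s of
  them. Their total squared error (of sums over the sample) has mean of order s n against a
  threshold s n ln p, so second moments suffice and no exponential inequality enters. Matrices are
  handled as functions on indices of which only the leading p x p block is read. Deleting the last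
  index then costs nothing, and the Cholesky factor, the measurability of the positive definite cone
  and the triangular change of variables all become inductions on p.\<close>

definition qform :: "nat \<Rightarrow> (nat \<Rightarrow> nat \<Rightarrow> real) \<Rightarrow> (nat \<Rightarrow> real) \<Rightarrow> real" where
  "qform p M x = (\<Sum>i<p. \<Sum>j<p. x i * M i j * x j)"

definition sym_pd :: "nat \<Rightarrow> (nat \<Rightarrow> nat \<Rightarrow> real) \<Rightarrow> bool" where
  "sym_pd p M \<longleftrightarrow> (\<forall>i<p. \<forall>j<p. M i j = M j i) \<and> (\<forall>x. (\<exists>i<p. x i \<noteq> 0) \<longrightarrow> 0 < qform p M x)"

definition schur :: "nat \<Rightarrow> (nat \<Rightarrow> nat \<Rightarrow> real) \<Rightarrow> nat \<Rightarrow> nat \<Rightarrow> real" where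
  "schur p M i j = M i j - M i p * M j p / M p p"

text \<open>Completing the square in the last coordinate; what remains is the form of the Schur
  complement.\<close>

lemma qform_Suc:
  assumes sym: "\<And>i j. i < Suc p \<Longrightarrow> j < Suc p \<Longrightarrow> M i j = M j i" and c: "M p p \<noteq> 0"
  shows "qform (Suc p) M x =
    M p p * (x p + (\<Sum>i<p. M i p * x i) / M p p)\<^sup>2 + qform p (schur p M) x"
proof -
  define b where "b = (\<Sum>i<p. M i p * x i)"
  have "(\<Sum>i<p. \<Sum>j<p. x i * (M i p * M j p / M p p) * x j) = b * b / M p p"
    unfolding b_def sum_product sum_divide_distrib
    by (intro sum.cong refl) (simp add: field_simps)
  then have 1: "qform p (schur p M) x = qform p M x - b * b / M p p"
    unfolding qform_def schur_def by (simp add: algebra_simps sum_subtractf)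
  have "(\<Sum>j<p. x p * M p j * x j) = x p * b" "(\<Sum>i<p. x i * M i p * x p) = x p * b"
    unfolding b_def sum_distrib_left using sym by (auto intro!: sum.cong simp: mult_ac)
  then have "qform (Suc p) M x = qform p M x + 2 * x p * b + M p p * (x p)\<^sup>2"
    unfolding qform_def by (simp add: sum.distrib power2_eq_square)
  moreover have "M p p * (x p + b / M p p)\<^sup>2 = M p p * (x p)\<^sup>2 + 2 * x p * b + b * b / M p p"
    using c by (simp add: field_simps power2_eq_square)
  ultimately show ?thesis using 1 unfolding b_def[symmetric] by linarith
qed

lemma qform_unit:
  assumes "i < p" shows "qform p M (\<lambda>k. if k = i then a else 0) = a\<^sup>2 * M i i"
proof -
  have "qform p M (\<lambda>k. if k = i then a else 0) = (\<Sum>k<p. if k = i then a * M i i * a else 0)"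
    unfolding qform_def using assms
    by (intro sum.cong refl) (simp add: if_distrib[where f="\<lambda>x. _ * x"] sum.delta cong: if_cong)
  with assms show ?thesis by (simp add: power2_eq_square)
qed

lemma sym_pd_diag: "sym_pd p M \<Longrightarrow> i < p \<Longrightarrow> 0 < M i i"
  using qform_unit[of i p M 1] unfolding sym_pd_def
  by (auto dest!: conjunct2 spec[of _ "\<lambda>k. if k = i then 1 else 0"])

text \<open>Minimising the form over the last coordinate leaves the form of the Schur complement.
  The equivalence drives both the Cholesky recursion and the measurability of the positive definite
  cone.\<close>

lemma sym_pd_Suc:
  "sym_pd (Suc p) M \<longleftrightarrow>
    (\<forall>i<Suc p. \<forall>j<Suc p. M i j = M j i) \<and> 0 < M p p \<and> sym_pd p (schur p M)"
proof (intro iffI conjI; (elim conjE)?)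
  assume M: "sym_pd (Suc p) M"
  then show sym: "\<forall>i<Suc p. \<forall>j<Suc p. M i j = M j i" by (simp add: sym_pd_def)
  show c: "0 < M p p" using sym_pd_diag[OF M] by simp
  show "sym_pd p (schur p M)"
    unfolding sym_pd_def
  proof (intro conjI allI impI)
    fix x :: "nat \<Rightarrow> real" assume ne: "\<exists>i<p. x i \<noteq> 0"
    \<comment> \<open>The last entry is the minimiser, so the square in \<open>qform_Suc\<close>
      vanishes.\<close>
    define y where "y = x(p := - (\<Sum>i<p. M i p * x i) / M p p)"
    from ne obtain i where "i < p" "x i \<noteq> 0" by blast
    then have "i < Suc p" "y i \<noteq> 0" by (auto simp: y_def)
    then have "0 < qform (Suc p) M y"
      using M unfolding sym_pd_def by blast
    also have "qform (Suc p) M y = qform p (schur p M) y"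
      using sym c by (subst qform_Suc) (auto simp: y_def)
    also have "\<dots> = qform p (schur p M) x" by (simp add: qform_def y_def)
    finally show "0 < qform p (schur p M) x" .
  qed (use sym in \<open>auto simp: schur_def\<close>)
next
  assume sym: "\<forall>i<Suc p. \<forall>j<Suc p. M i j = M j i" and c: "0 < M p p"
    and S: "sym_pd p (schur p M)"
  show "sym_pd (Suc p) M"
    unfolding sym_pd_def
  proof (intro conjI allI impI)
    fix x :: "nat \<Rightarrow> real" assume ne: "\<exists>i<Suc p. x i \<noteq> 0"
    have eq: "qform (Suc p) M x =
      M p p * (x p + (\<Sum>i<p. M i p * x i) / M p p)\<^sup>2 + qform p (schur p M) x"
      using sym c by (intro qform_Suc) auto
    show "0 < qform (Suc p) M x"
    proof (cases "\<exists>i<p. x i \<noteq> 0")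
      case True
      then have "0 < qform p (schur p M) x" using S by (simp add: sym_pd_def)
      with c show ?thesis unfolding eq by (simp add: add_nonneg_pos)
    next
      case False
      then have "x p \<noteq> 0" using ne less_Suc_eq by auto
      with False c show ?thesis unfolding eq by (simp add: qform_def)
    qed
  qed (use sym in auto)
qed

lemma sym_pd_cong: "(\<And>i j. i < p \<Longrightarrow> j < p \<Longrightarrow> M i j = N i j) \<Longrightarrow> sym_pd p M = sym_pd p N"
  unfolding sym_pd_def qform_def by (simp cong: sum.cong_simp)

text \<open>\<open>sym_pd\<close> quantifies over uncountably many vectors; unfolding
  \<open>sym_pd_Suc\<close> p times leaves finitely many conditions that are measurable in the
  entries.\<close>

lemma pred_sym_pd:
  assumes "\<And>i j. i < p \<Longrightarrow> j < p \<Longrightarrow> (\<lambda>w. M w i j) \<in> borel_measurable N"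
  shows "Measurable.pred N (\<lambda>w. sym_pd p (M w))"
  using assms
proof (induction p arbitrary: M)
  case 0
  then show ?case by (simp add: sym_pd_def)
next
  case (Suc p)
  note [measurable] = Suc.prems
  have [measurable]: "Measurable.pred N (\<lambda>w. sym_pd p (schur p (M w)))"
    by (rule Suc.IH) (simp add: schur_def)
  have "Measurable.pred N (\<lambda>w. \<forall>i\<in>{..<Suc p}. \<forall>j\<in>{..<Suc p}. M w i j = M w j i)"
    by measurable
  then have [measurable]: "Measurable.pred N (\<lambda>w. \<forall>i<Suc p. \<forall>j<Suc p. M w i j = M w j i)"
    by (simp only: Ball_def lessThan_iff)
  show ?case unfolding sym_pd_Suc by measurable
qed

text \<open>The factor U of M = U U^T is found together with the transposed inverse A of U, which
  whitens M: A^T M A = 1.\<close>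

definition whitening :: "nat \<Rightarrow> (nat \<Rightarrow> nat \<Rightarrow> real) \<Rightarrow> (nat \<Rightarrow> nat \<Rightarrow> real) \<Rightarrow> (nat \<Rightarrow> nat \<Rightarrow> real) \<Rightarrow> bool" where
  "whitening p M U A \<longleftrightarrow>
     (\<forall>i<p. \<forall>j<p. j < i \<longrightarrow> U i j = 0) \<and> (\<forall>i<p. \<forall>j<p. i < j \<longrightarrow> A i j = 0) \<and>
     (\<forall>i<p. 0 < U i i) \<and> (\<forall>i<p. 0 < A i i) \<and>
     (\<forall>i<p. \<forall>j<p. M i j = (\<Sum>k<p. U i k * U j k)) \<and>
     (\<forall>i<p. \<forall>j<p. (\<Sum>k<p. U k i * A k j) = (if i = j then 1 else 0)) \<and>
     (\<forall>i<p. \<forall>j<p. (\<Sum>k<p. A i k * U j k) = (if i = j then 1 else 0))"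

lemma whiteningI:
  assumes
    "\<And>i j. i < p \<Longrightarrow> j < p \<Longrightarrow> j < i \<Longrightarrow> U i j = 0"
    "\<And>i j. i < p \<Longrightarrow> j < p \<Longrightarrow> i < j \<Longrightarrow> A i j = 0"
    "\<And>i. i < p \<Longrightarrow> 0 < U i i" "\<And>i. i < p \<Longrightarrow> 0 < A i i"
    "\<And>i j. i < p \<Longrightarrow> j < p \<Longrightarrow> M i j = (\<Sum>k<p. U i k * U j k)"
    "\<And>i j. i < p \<Longrightarrow> j < p \<Longrightarrow> (\<Sum>k<p. U k i * A k j) = (if i = j then 1 else 0)"
    "\<And>i j. i < p \<Longrightarrow> j < p \<Longrightarrow> (\<Sum>k<p. A i k * U j k) = (if i = j then 1 else 0)"
  shows "whitening p M U A"
  unfolding whitening_def by (intro conjI allI impI) (fact assms)+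

lemma whiteningD:
  assumes "whitening p M U A"
  shows
    "\<And>i j. i < p \<Longrightarrow> j < p \<Longrightarrow> j < i \<Longrightarrow> U i j = 0"
    "\<And>i j. i < p \<Longrightarrow> j < p \<Longrightarrow> i < j \<Longrightarrow> A i j = 0"
    "\<And>i. i < p \<Longrightarrow> 0 < U i i" "\<And>i. i < p \<Longrightarrow> 0 < A i i"
    "\<And>i j. i < p \<Longrightarrow> j < p \<Longrightarrow> M i j = (\<Sum>k<p. U i k * U j k)"
    "\<And>i j. i < p \<Longrightarrow> j < p \<Longrightarrow> (\<Sum>k<p. U k i * A k j) = (if i = j then 1 else 0)"
    "\<And>i j. i < p \<Longrightarrow> j < p \<Longrightarrow> (\<Sum>k<p. A i k * U j k) = (if i = j then 1 else 0)"
  using assms unfolding whitening_def by simp_all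

lemma sym_pd_whitening: "sym_pd p M \<Longrightarrow> \<exists>U A. whitening p M U A"
proof (induction p arbitrary: M)
  case 0
  then show ?case by (simp add: whitening_def)
next
  case (Suc p)
  define c where "c = sqrt (M p p)"
  have sym: "M i j = M j i" if "i < Suc p" "j < Suc p" for i j
    using Suc.prems that unfolding sym_pd_Suc by blast
  have c: "0 < c" "c * c = M p p" and S: "sym_pd p (schur p M)"
    using Suc.prems unfolding sym_pd_Suc c_def by auto
  from Suc.IH[OF S] obtain U A where UA: "whitening p (schur p M) U A" by blast
  \<comment> \<open>With b the last column of M above the corner, U' = [[U, b/c], [0, c]] and A' =
    [[A, 0], [-b^T A / c^2, 1/c]]. Eliminating the last index first makes U upper and A lower
    triangular, the shape that \<open>nn_integral_triangular\<close> asks of A.\<close>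
  define U' where "U' i j = (if i < p then (if j < p then U i j else M i p / c) else if j < p then 0 else c)" for i j
  define A' where "A' i j = (if i < p then (if j < p then A i j else 0)
     else if j < p then - (\<Sum>k<p. M k p * A k j) / (c * c) else 1 / c)" for i j
  have U1: "U' i j = U i j" if "i < p" "j < p" for i j using that by (simp add: U'_def)
  have U2: "U' i p = M i p / c" if "i < p" for i using that by (simp add: U'_def)
  have U3: "U' p i = 0" if "i < p" for i using that by (simp add: U'_def)
  have U4: "U' p p = c" by (simp add: U'_def)
  have A1: "A' i j = A i j" if "i < p" "j < p" for i j using that by (simp add: A'_def)
  have A2: "A' i p = 0" if "i < p" for i using that by (simp add: A'_def)
  have A3: "A' p i = - (\<Sum>k<p. M k p * A k i) / (c * c)" if "i < p" for i using that by (simp add: A'_def)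
  have A4: "A' p p = 1 / c" by (simp add: A'_def)
  note E = U1 U2 U3 U4 A1 A2 A3 A4
  note W = whiteningD[OF UA]
  have "M i j = (\<Sum>k<Suc p. U' i k * U' j k)" if ij: "i < Suc p" "j < Suc p" for i j
  proof -
    consider "i < p" "j < p" | "i < p" "j = p" | "i = p" "j < p" | "i = p" "j = p"
      using ij by (metis less_SucE)
    then show ?thesis
    proof cases
      case 1
      then show ?thesis using W(5)[of i j] c by (simp add: E schur_def)
    next
      case 3
      then show ?thesis using c sym[of p j] by (simp add: E)
    qed (use c in \<open>simp_all add: E\<close>)
  qed
  moreover have "(\<Sum>k<Suc p. U' k i * A' k j) = (if i = j then 1 else 0)"
    if ij: "i < Suc p" "j < Suc p" for i j
  proof -
    have "(\<Sum>k<p. M k p / c * A k j) = (\<Sum>k<p. M k p * A k j) / c" for j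
      by (simp add: sum_divide_distrib)
    then have *: "(\<Sum>k<p. M k p * A k j) / c - c * (\<Sum>k<p. M k p * A k j) / (c * c) = 0"
        "(\<Sum>k<p. M k p / c * A k j) = (\<Sum>k<p. M k p * A k j) / c" for j
      using c(1) by (simp_all add: field_simps)
    consider "i < p" "j < p" | "i < p" "j = p" | "i = p" "j < p" | "i = p" "j = p"
      using ij by (metis less_SucE)
    then show ?thesis
    proof cases
      case 1
      then show ?thesis using W(6)[of i j] by (simp add: E)
    next
      case 3
      then show ?thesis using *[of j] by (simp add: E)
    qed (use c in \<open>simp_all add: E\<close>)
  qed
  moreover have "(\<Sum>k<Suc p. A' i k * U' j k) = (if i = j then 1 else 0)"
    if ij: "i < Suc p" "j < Suc p" for i j
  proof -
    have "(\<Sum>k<p. - (\<Sum>l<p. M l p * A l k) / (c * c) * U j k) = - M j p / (c * c)" if j: "j < p" for j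
    proof -
      have "(\<Sum>k<p. - (\<Sum>l<p. M l p * A l k) / (c * c) * U j k)
          = - (\<Sum>k<p. \<Sum>l<p. M l p * (A l k * U j k)) / (c * c)"
        by (simp add: sum_distrib_right sum_distrib_left sum_divide_distrib sum_negf mult_ac)
      also have "(\<Sum>k<p. \<Sum>l<p. M l p * (A l k * U j k)) = (\<Sum>l<p. M l p * (\<Sum>k<p. A l k * U j k))"
        by (subst sum.swap) (simp add: sum_distrib_left)
      also have "\<dots> = (\<Sum>l<p. if l = j then M j p else 0)"
        using j W(7) by (intro sum.cong) auto
      also have "\<dots> = M j p" using j by simp
      finally show ?thesis by simp
    qed
    note * = this
    consider "i < p" "j < p" | "i < p" "j = p" | "i = p" "j < p" | "i = p" "j = p"
      using ij by (metis less_SucE)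
    then show ?thesis
    proof cases
      case 1
      then show ?thesis using W(7)[of i j] by (simp add: E)
    next
      case 3
      then show ?thesis using *[of j] c by (simp add: E)
    qed (use c in \<open>simp_all add: E\<close>)
  qed
  moreover have "j < i \<Longrightarrow> U' i j = 0" "i < j \<Longrightarrow> A' i j = 0" "0 < U' i i" "0 < A' i i"
    if "i < Suc p" "j < Suc p" for i j
    using that W(1,2)[of i j] W(3,4)[of i] c by (auto simp: U'_def A'_def less_Suc_eq)
  ultimately have "whitening (Suc p) M U' A'"
    by (intro whiteningI)
  then show ?case by blast
qed

section \<open>Determinants and eigenvalue bounds\<close>

definition fn_mat :: "nat \<Rightarrow> (nat \<Rightarrow> nat \<Rightarrow> real) \<Rightarrow> real mat" where
  "fn_mat p M = mat p p (\<lambda>(i,j). M i j)"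

abbreviation fdet :: "nat \<Rightarrow> (nat \<Rightarrow> nat \<Rightarrow> real) \<Rightarrow> real" where
  "fdet p M \<equiv> det (fn_mat p M)"

definition fnorm :: "nat \<Rightarrow> (nat \<Rightarrow> nat \<Rightarrow> real) \<Rightarrow> real" where
  "fnorm p X = sqrt (\<Sum>i<p. \<Sum>j<p. (X i j)\<^sup>2)"

lemma fn_mat_carrier [simp]: "fn_mat p M \<in> carrier_mat p p"
  by (simp add: fn_mat_def)

lemma fn_mat_cong: "(\<And>i j. i < p \<Longrightarrow> j < p \<Longrightarrow> M i j = N i j) \<Longrightarrow> fn_mat p M = fn_mat p N"
  unfolding fn_mat_def by (rule eq_matI) auto

lemma fn_mat_mult: "fn_mat p X * fn_mat p Y = fn_mat p (\<lambda>i j. \<Sum>k<p. X i k * Y k j)"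
  unfolding fn_mat_def by (rule eq_matI) (auto simp: scalar_prod_def atLeast0LessThan)

lemma fn_mat_transpose: "transpose_mat (fn_mat p X) = fn_mat p (\<lambda>i j. X j i)"
  unfolding fn_mat_def by (rule eq_matI) auto

lemma fdet_mult: "fdet p (\<lambda>i j. \<Sum>k<p. X i k * Y k j) = fdet p X * fdet p Y"
  unfolding fn_mat_mult[symmetric] by (rule det_mult[of _ p]) simp_all

lemma fdet_transpose: "fdet p (\<lambda>i j. X j i) = fdet p X"
  using det_transpose[of "fn_mat p X" p] by (simp add: fn_mat_transpose)

lemma fdet_upper_triangular:
  assumes "\<And>i j. i < p \<Longrightarrow> j < p \<Longrightarrow> j < i \<Longrightarrow> U i j = 0"
  shows "fdet p U = (\<Prod>i<p. U i i)"
proof -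
  have "fdet p U = prod_list (diag_mat (fn_mat p U))"
    by (rule det_upper_triangular[of _ p]) (auto simp: fn_mat_def assms)
  also have "diag_mat (fn_mat p U) = map (\<lambda>i. U i i) [0..<p]"
    by (auto simp: diag_mat_def fn_mat_def)
  also have "prod_list (map (\<lambda>i. U i i) [0..<p]) = (\<Prod>i<p. U i i)"
    by (simp add: prod.distinct_set_conv_list[symmetric] atLeast0LessThan)
  finally show ?thesis .
qed

lemma fdet_lower_triangular:
  assumes "\<And>i j. i < p \<Longrightarrow> j < p \<Longrightarrow> i < j \<Longrightarrow> A i j = 0"
  shows "fdet p A = (\<Prod>i<p. A i i)"
  using fdet_upper_triangular[of p "\<lambda>i j. A j i"] assms by (simp add: fdet_transpose[of p A])

lemma whitening_diag:
  assumes W: "whitening p M U A" and i: "i < p"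
  shows "U i i * A i i = 1"
proof -
  have "1 = (\<Sum>k<p. U k i * A k i)" using whiteningD(6)[OF W i i] by simp
  \<comment> \<open>Only k = i survives: U vanishes below the diagonal and A above it.\<close>
  also have "\<dots> = (\<Sum>k<p. if k = i then U i i * A i i else 0)"
    using whiteningD(1,2)[OF W] i
    by (intro sum.cong refl) (metis lessThan_iff linorder_neqE_nat mult_eq_0_iff)
  also have "\<dots> = U i i * A i i" using i by simp
  finally show ?thesis ..
qed

lemma whitening_det:
  assumes W: "whitening p M U A"
  shows "fdet p M = (\<Prod>i<p. U i i)\<^sup>2" "(\<Prod>i<p. U i i) * (\<Prod>i<p. A i i) = 1"
    "0 < (\<Prod>i<p. U i i)" "fdet p A = (\<Prod>i<p. A i i)"
proof -
  have "fn_mat p M = fn_mat p (\<lambda>i j. \<Sum>k<p. U i k * U j k)"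
    by (rule fn_mat_cong) (rule whiteningD(5)[OF W])
  then show "fdet p M = (\<Prod>i<p. U i i)\<^sup>2"
    using fdet_mult[of p U "\<lambda>i j. U j i"] fdet_upper_triangular[of p U, OF whiteningD(1)[OF W]]
    by (simp add: fdet_transpose[of p U] power2_eq_square)
  show "(\<Prod>i<p. U i i) * (\<Prod>i<p. A i i) = 1"
    using whitening_diag[OF W] by (simp add: prod.distrib[symmetric])
  show "0 < (\<Prod>i<p. U i i)" by (intro prod_pos) (use whiteningD(3)[OF W] in auto)
  show "fdet p A = (\<Prod>i<p. A i i)" by (rule fdet_lower_triangular) (rule whiteningD(2)[OF W])
qed

lemma sym_pd_fdet_pos: "sym_pd p M \<Longrightarrow> 0 < fdet p M"
  using sym_pd_whitening whitening_det(1,3) by (metis zero_less_power)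

section \<open>Frobenius norm and the quadratic slack in the concavity of ln det\<close>

lemma fnorm_power2: "(fnorm p X)\<^sup>2 = (\<Sum>i<p. \<Sum>j<p. (X i j)\<^sup>2)"
  by (simp add: fnorm_def sum_nonneg)

lemma fnorm_nonneg [simp]: "0 \<le> fnorm p X"
  by (simp add: fnorm_def sum_nonneg)

lemma fnorm_L2_set: "fnorm p X = L2_set (\<lambda>(i,j). X i j) ({..<p} \<times> {..<p})"
  unfolding fnorm_def L2_set_def sum.cartesian_product by (simp add: case_prod_beta)

lemma fnorm_triangle: "fnorm p (\<lambda>i j. X i j + Y i j) \<le> fnorm p X + fnorm p Y"
proof -
  have "(\<lambda>(i,j). X i j + Y i j) = (\<lambda>z. (\<lambda>(i,j). X i j) z + (\<lambda>(i,j). Y i j) z)"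
    by auto
  then show ?thesis unfolding fnorm_L2_set by (simp only: L2_set_triangle_ineq)
qed

lemma fnorm_transpose: "fnorm p (\<lambda>i j. X j i) = fnorm p X"
  unfolding fnorm_def by (subst sum.swap) simp

lemma fnorm_mult_transpose: "fnorm p (\<lambda>i j. \<Sum>k<p. X i k * Y j k) \<le> fnorm p X * fnorm p Y"
proof (rule power2_le_imp_le)
  have "(fnorm p (\<lambda>i j. \<Sum>k<p. X i k * Y j k))\<^sup>2
      \<le> (\<Sum>i<p. \<Sum>j<p. (\<Sum>k<p. (X i k)\<^sup>2) * (\<Sum>k<p. (Y j k)\<^sup>2))"
    unfolding fnorm_power2 by (intro sum_mono Cauchy_Schwarz_ineq_sum)
  also have "\<dots> = (fnorm p X * fnorm p Y)\<^sup>2"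
    unfolding power_mult_distrib fnorm_power2 sum_product ..
  finally show "(fnorm p (\<lambda>i j. \<Sum>k<p. X i k * Y j k))\<^sup>2 \<le> (fnorm p X * fnorm p Y)\<^sup>2" .
qed simp

text \<open>One row of an inverse identity, contracted with a vector: the form in which A and U
  cancel each other throughout.\<close>

lemma sum_inverse_apply:
  fixes p a :: nat
  assumes "\<And>k. k < p \<Longrightarrow> (\<Sum>i<p. X i * Y k i) = (if k = a then 1 else 0)" and "a < p"
  shows "(\<Sum>i<p. X i * (\<Sum>k<p. Y k i * f k)) = (f a :: real)"
proof -
  have "(\<Sum>i<p. X i * (\<Sum>k<p. Y k i * f k)) = (\<Sum>k<p. (\<Sum>i<p. X i * Y k i) * f k)"
    unfolding sum_distrib_left sum_distrib_right by (subst sum.swap) (simp add: mult_ac)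
  also have "\<dots> = (\<Sum>k<p. if k = a then f a else 0)"
    using assms(1) by (intro sum.cong) auto
  finally show ?thesis using assms(2) by simp
qed

text \<open>Here \<delta> is the Frobenius norm of V = U - 1. Expanding the square gives \<delta>^2
  = tr M - p - 2 * (sum of U_ii - 1), while ln det M = 2 * (sum of ln U_ii) is at most 2 * (sum of
  U_ii - 1); so \<delta>^2 is slack left over by ln x <= x - 1. Conversely M - 1 = V V^T + V + V^T,
  so a small \<delta> forces M close to 1.\<close>

lemma ln_det_le_trace:
  assumes "sym_pd p M"
  obtains \<delta> where "0 \<le> \<delta>" "ln (fdet p M) \<le> (\<Sum>i<p. M i i) - real p - \<delta>\<^sup>2"
    "fnorm p (\<lambda>i j. M i j - (if i = j then 1 else 0)) \<le> \<delta>\<^sup>2 + 2 * \<delta>"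
proof -
  obtain U A where W: "whitening p M U A" using sym_pd_whitening[OF assms] by blast
  define V where "V i j = U i j - (if i = j then 1 else 0)" for i j
  define \<delta> where "\<delta> = fnorm p V"
  have pos: "0 < U i i" if "i < p" for i using whiteningD(3)[OF W that] .
  have "ln (\<Prod>i<p. U i i) = (\<Sum>i<p. ln (U i i))"
    by (intro ln_prod) (simp, metis pos lessThan_iff less_irrefl)
  then have "ln (fdet p M) = 2 * (\<Sum>i<p. ln (U i i))"
    unfolding whitening_det(1)[OF W] using whitening_det(3)[OF W] pos
    by (subst ln_realpow) simp_all
  also have "\<dots> \<le> (\<Sum>i<p. 2 * (U i i - 1))"
    unfolding sum_distrib_left using pos by (intro sum_mono mult_left_mono ln_le_minus_one) auto
  finally have 1: "ln (fdet p M) \<le> (\<Sum>i<p. 2 * (U i i - 1))" .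
  have "\<delta>\<^sup>2 = (\<Sum>i<p. \<Sum>j<p. (V i j)\<^sup>2)" by (simp add: \<delta>_def fnorm_power2)
  also have "\<dots> = (\<Sum>i<p. (\<Sum>j<p. (U i j)\<^sup>2) + (1 - 2 * U i i))"
  proof (intro sum.cong refl)
    fix i assume i: "i \<in> {..<p}"
    have "(\<Sum>j<p. (V i j)\<^sup>2) = (\<Sum>j<p. (U i j)\<^sup>2 + (if j = i then 1 - 2 * U i i else 0))"
      unfolding V_def by (intro sum.cong refl) (auto simp: power2_eq_square algebra_simps)
    then show "(\<Sum>j<p. (V i j)\<^sup>2) = (\<Sum>j<p. (U i j)\<^sup>2) + (1 - 2 * U i i)"
      using i by (simp add: sum.distrib)
  qed
  also have "\<dots> = (\<Sum>i<p. M i i) - real p - (\<Sum>i<p. 2 * (U i i - 1))"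
    using whiteningD(5)[OF W] by (simp add: sum.distrib sum_subtractf power2_eq_square algebra_simps)
  finally have 2: "ln (fdet p M) \<le> (\<Sum>i<p. M i i) - real p - \<delta>\<^sup>2"
    using 1 by simp
  have "fnorm p (\<lambda>i j. M i j - (if i = j then 1 else 0))
      = fnorm p (\<lambda>i j. (\<Sum>k<p. V i k * V j k) + (V i j + V j i))"
    unfolding fnorm_def
  proof (intro arg_cong[where f=sqrt] sum.cong refl arg_cong[where f="\<lambda>x. x\<^sup>2"])
    fix i j assume ij: "i \<in> {..<p}" "j \<in> {..<p}"
    have "(\<Sum>k<p. V i k * V j k) = (\<Sum>k<p. U i k * U j k - (if k = j then U i j else 0)
        - (if k = i then U j i else 0) + (if k = i then (if i = j then 1 else 0) else 0))"
      unfolding V_def by (intro sum.cong refl) (auto simp: algebra_simps)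
    also have "\<dots> = M i j - U i j - U j i + (if i = j then 1 else 0)"
      using ij whiteningD(5)[OF W] by (simp add: sum.distrib sum_subtractf)
    finally show "M i j - (if i = j then 1 else 0) = (\<Sum>k<p. V i k * V j k) + (V i j + V j i)"
      by (simp add: V_def)
  qed
  also have "\<dots> \<le> fnorm p (\<lambda>i j. \<Sum>k<p. V i k * V j k) + (fnorm p V + fnorm p (\<lambda>i j. V j i))"
    by (intro order.trans[OF fnorm_triangle] add_left_mono fnorm_triangle)
  also have "\<dots> \<le> \<delta>\<^sup>2 + 2 * \<delta>"
    using fnorm_mult_transpose[of p V V] unfolding fnorm_transpose[of p V]
    by (simp add: \<delta>_def power2_eq_square)
  finally show thesis using 2 by (intro that[of \<delta>]) (simp_all add: \<delta>_def)
qed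

text \<open>A matrix and its transpose have the same operator norm: with z = U y, write |z|^2 as the
  inner product of U^T z and y, apply Cauchy-Schwarz, and cancel one factor |z|^2.\<close>

lemma transposed_operator_bound:
  assumes K: "0 \<le> K" and bd: "\<And>x. (\<Sum>i<p. (\<Sum>k<p. U k i * x k)\<^sup>2) \<le> K * (\<Sum>i<p. (x i)\<^sup>2)"
  shows "(\<Sum>i<p. (\<Sum>k<p. U i k * y k)\<^sup>2) \<le> K * (\<Sum>i<p. (y i :: real)\<^sup>2)"
proof -
  define z where "z i = (\<Sum>k<p. U i k * y k)" for i
  define w where "w k = (\<Sum>i<p. U i k * z i)" for k
  define Z where "Z = (\<Sum>i<p. (z i)\<^sup>2)"
  have "Z = (\<Sum>i<p. z i * (\<Sum>k<p. U i k * y k))" by (simp add: Z_def z_def power2_eq_square)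
  also have "\<dots> = (\<Sum>k<p. w k * y k)"
    unfolding w_def sum_distrib_left sum_distrib_right by (subst sum.swap) (simp add: mult_ac)
  finally have "Z\<^sup>2 \<le> (\<Sum>k<p. (w k)\<^sup>2) * (\<Sum>k<p. (y k)\<^sup>2)"
    by (simp add: Cauchy_Schwarz_ineq_sum)
  also have "\<dots> \<le> (K * Z) * (\<Sum>k<p. (y k)\<^sup>2)"
    unfolding w_def Z_def by (intro mult_right_mono bd sum_nonneg) auto
  finally have *: "Z * Z \<le> Z * (K * (\<Sum>k<p. (y k)\<^sup>2))" by (simp add: power2_eq_square mult_ac)
  have "0 \<le> Z" by (simp add: Z_def sum_nonneg)
  then have "Z \<le> K * (\<Sum>k<p. (y k)\<^sup>2)"
    using * K by (cases "Z = 0") (auto simp: sum_nonneg)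
  then show ?thesis by (simp add: Z_def z_def)
qed

text \<open>K bounds the squared operator norm of U, so the two multiplications in U N U^T together
  cost one factor K: one use of \<open>bd\<close> for the rows, one for the columns.\<close>

lemma fnorm_congruence_le:
  assumes K: "0 \<le> K" and bd: "\<And>y. (\<Sum>i<p. (\<Sum>k<p. U i k * y k)\<^sup>2) \<le> K * (\<Sum>i<p. (y i :: real)\<^sup>2)"
  shows "fnorm p (\<lambda>a b. \<Sum>j<p. U b j * (\<Sum>i<p. U a i * N i j)) \<le> K * fnorm p N"
proof (rule power2_le_imp_le)
  have "(fnorm p (\<lambda>a b. \<Sum>j<p. U b j * (\<Sum>i<p. U a i * N i j)))\<^sup>2
      \<le> (\<Sum>a<p. K * (\<Sum>j<p. (\<Sum>i<p. U a i * N i j)\<^sup>2))"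
    unfolding fnorm_power2 by (intro sum_mono bd)
  also have "\<dots> = K * (\<Sum>j<p. \<Sum>a<p. (\<Sum>i<p. U a i * N i j)\<^sup>2)"
    unfolding sum_distrib_left[symmetric] by (subst sum.swap) simp
  also have "\<dots> \<le> K * (\<Sum>j<p. K * (\<Sum>i<p. (N i j)\<^sup>2))"
    by (intro mult_left_mono sum_mono bd K)
  also have "\<dots> = (K * fnorm p N)\<^sup>2"
    unfolding power_mult_distrib fnorm_power2 sum_distrib_left[symmetric]
    by (subst sum.swap) (simp add: power2_eq_square)
  finally show "(fnorm p (\<lambda>a b. \<Sum>j<p. U b j * (\<Sum>i<p. U a i * N i j)))\<^sup>2 \<le> (K * fnorm p N)\<^sup>2" .
qed (use K in simp)

text \<open>Whitening by C reduces to \<open>ln_det_le_trace\<close> at the identity. Since A A^T is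
  the inverse of C, the trace term becomes the tangent of ln det at C, and undoing the whitening
  multiplies the norm estimate by K.\<close>

lemma ln_det_le_supporting:
  assumes B: "sym_pd p B" and W: "whitening p C U A" and K: "0 \<le> K"
    and bd: "\<And>x. (\<Sum>i<p. (\<Sum>k<p. U k i * x k)\<^sup>2) \<le> K * (\<Sum>i<p. (x i)\<^sup>2)"
  obtains \<delta> where "0 \<le> \<delta>"
    "ln (fdet p B) \<le> ln (fdet p C)
       + (\<Sum>i<p. \<Sum>j<p. (\<Sum>k<p. A i k * A j k) * (B i j - C i j)) - \<delta>\<^sup>2"
    "fnorm p (\<lambda>i j. B i j - C i j) \<le> K * (\<delta>\<^sup>2 + 2 * \<delta>)"
proof -
  \<comment> \<open>N = B A and M = A^T B A, the whitened B.\<close>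
  define N where "N k j = (\<Sum>l<p. A l j * B k l)" for k j
  define M where "M i j = (\<Sum>k<p. A k i * N k j)" for i j
  have D6: "(\<Sum>k<p. U k i * A k j) = (if j = i then 1 else 0)" if "i < p" "j < p" for i j
    using whiteningD(6)[OF W that] by auto
  have D7: "(\<Sum>k<p. U j k * A i k) = (if i = j then 1 else 0)" if "i < p" "j < p" for i j
    using whiteningD(7)[OF W that] by (simp add: mult.commute)
  have Bsym: "B i j = B j i" if "i < p" "j < p" for i j
    using B that unfolding sym_pd_def by blast
  have M2: "M i j = (\<Sum>k<p. \<Sum>l<p. A k i * A l j * B k l)" for i j
    unfolding M_def N_def sum_distrib_left by (simp add: mult_ac)
  have "sym_pd p M"
    unfolding sym_pd_def
  proof (intro conjI allI impI)
    fix i j assume "i < p" "j < p"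
    show "M i j = M j i"
      unfolding M2 by (subst sum.swap) (intro sum.cong refl, simp add: Bsym)
  next
    fix x :: "nat \<Rightarrow> real" assume "\<exists>i<p. x i \<noteq> 0"
    then obtain i where i: "i < p" "x i \<noteq> 0" by blast
    define y where "y k = (\<Sum>j<p. A k j * x j)" for k
    have "x i = (\<Sum>k<p. U k i * y k)"
      unfolding y_def using D6 i by (intro sum_inverse_apply[symmetric]) auto
    then have "\<exists>k<p. y k \<noteq> 0" using i by (metis (no_types, lifting) lessThan_iff mult_zero_right sum.neutral)
    then have "0 < qform p B y" using B by (simp add: sym_pd_def)
    also have "qform p B y = (\<Sum>k<p. \<Sum>l<p. \<Sum>i<p. \<Sum>j<p. A k i * x i * B k l * (A l j * x j))"
      unfolding qform_def
    proof (intro sum.cong refl)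
      fix k l
      have "y k * B k l * y l = B k l * (y k * y l)" by simp
      also have "y k * y l = (\<Sum>i<p. \<Sum>j<p. (A k i * x i) * (A l j * x j))"
        by (simp only: y_def sum_product)
      finally show "y k * B k l * y l = (\<Sum>i<p. \<Sum>j<p. A k i * x i * B k l * (A l j * x j))"
        by (simp only: sum_distrib_left mult_ac)
    qed
    also have "\<dots> = (\<Sum>k<p. \<Sum>i<p. \<Sum>l<p. \<Sum>j<p. A k i * x i * B k l * (A l j * x j))"
      by (intro sum.cong refl sum.swap)
    also have "\<dots> = (\<Sum>i<p. \<Sum>k<p. \<Sum>j<p. \<Sum>l<p. A k i * x i * B k l * (A l j * x j))"
      by (subst sum.swap) (intro sum.cong refl sum.swap)
    also have "\<dots> = (\<Sum>i<p. \<Sum>j<p. \<Sum>k<p. \<Sum>l<p. A k i * x i * B k l * (A l j * x j))"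
      by (intro sum.cong refl sum.swap)
    also have "\<dots> = qform p M x"
      unfolding qform_def M2 sum_distrib_left sum_distrib_right by (simp add: mult_ac)
    finally show "0 < qform p M x" .
  qed
  then obtain \<delta> where \<delta>: "0 \<le> \<delta>" "ln (fdet p M) \<le> (\<Sum>i<p. M i i) - real p - \<delta>\<^sup>2"
    "fnorm p (\<lambda>i j. M i j - (if i = j then 1 else 0)) \<le> \<delta>\<^sup>2 + 2 * \<delta>"
    by (rule ln_det_le_trace)
  have "fdet p M = fdet p (\<lambda>i k. A k i) * fdet p N"
    unfolding M_def by (rule fdet_mult)
  also have "N = (\<lambda>k j. \<Sum>l<p. B k l * A l j)" by (simp add: N_def mult.commute fun_eq_iff)
  also have "fdet p (\<lambda>k j. \<Sum>l<p. B k l * A l j) = fdet p B * fdet p A" by (rule fdet_mult)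
  finally have "fdet p M = (\<Prod>i<p. A i i)\<^sup>2 * fdet p B"
    by (simp add: fdet_transpose[of p A] whitening_det(4)[OF W] power2_eq_square)
  then have "fdet p B = fdet p C * fdet p M"
    using whitening_det(1,2)[OF W] by (simp add: power_mult_distrib[symmetric] mult.assoc[symmetric])
  moreover have "0 < fdet p C" "0 < fdet p M"
    using whitening_det(3)[OF W] sym_pd_fdet_pos[OF \<open>sym_pd p M\<close>]
    by (simp_all only: whitening_det(1)[OF W] zero_less_power)
  ultimately have lnB: "ln (fdet p B) = ln (fdet p C) + ln (fdet p M)" by (simp add: ln_mult)
  have tr: "(\<Sum>i<p. \<Sum>k<p. \<Sum>l<p. A k i * A l i * X k l) = (\<Sum>k<p. \<Sum>l<p. (\<Sum>i<p. A k i * A l i) * X k l)"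
    for X
  proof -
    have "(\<Sum>i<p. \<Sum>k<p. \<Sum>l<p. A k i * A l i * X k l) = (\<Sum>k<p. \<Sum>i<p. \<Sum>l<p. A k i * A l i * X k l)"
      by (rule sum.swap)
    also have "\<dots> = (\<Sum>k<p. \<Sum>l<p. (\<Sum>i<p. A k i * A l i) * X k l)"
      unfolding sum_distrib_right by (intro sum.cong refl sum.swap)
    finally show ?thesis .
  qed
  \<comment> \<open>The diagonal of A^T C A is 1, so tr M - p is the linear term evaluated at B -
    C.\<close>
  have CA: "(\<Sum>k<p. \<Sum>l<p. A k i * A l i * C k l) = 1" if i: "i < p" for i
  proof -
    have "(\<Sum>l<p. A l i * C k l) = U k i" if k: "k < p" for k
    proof -
      have "(\<Sum>l<p. A l i * C k l) = (\<Sum>l<p. A l i * (\<Sum>m<p. U l m * U k m))"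
        using whiteningD(5)[OF W] k by (intro sum.cong refl) (simp add: mult.commute)
      also have "\<dots> = U k i"
        using D6 i by (intro sum_inverse_apply) (auto simp: mult.commute)
      finally show ?thesis .
    qed
    moreover have "(\<Sum>l<p. A k i * A l i * C k l) = A k i * (\<Sum>l<p. A l i * C k l)" for k
      by (simp add: sum_distrib_left mult.assoc)
    ultimately have "(\<Sum>k<p. \<Sum>l<p. A k i * A l i * C k l) = (\<Sum>k<p. U k i * A k i)"
      by (simp add: mult.commute)
    then show ?thesis using D6[OF i i] by simp
  qed
  have "(\<Sum>i<p. M i i) - real p = (\<Sum>i<p. \<Sum>k<p. \<Sum>l<p. A k i * A l i * (B k l - C k l))"
    using CA by (simp add: M2 sum_subtractf right_diff_distrib)
  then have 1: "ln (fdet p B) \<le> ln (fdet p C)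
       + (\<Sum>i<p. \<Sum>j<p. (\<Sum>k<p. A i k * A j k) * (B i j - C i j)) - \<delta>\<^sup>2"
    using lnB \<delta>(2) tr[of "\<lambda>k l. B k l - C k l"] by linarith
  \<comment> \<open>B - C = U (M - 1) U^T.\<close>
  have "fnorm p (\<lambda>a b. B a b - C a b) =
    fnorm p (\<lambda>a b. \<Sum>j<p. U b j * (\<Sum>i<p. U a i * (M i j - (if i = j then 1 else 0))))"
    unfolding fnorm_def
  proof (intro arg_cong[where f=sqrt] sum.cong refl arg_cong[where f="\<lambda>x. x\<^sup>2"])
    fix a b assume "a \<in> {..<p}" "b \<in> {..<p}"
    then have ab: "a < p" "b < p" by auto
    have "(\<Sum>i<p. U a i * (M i j - (if i = j then 1 else 0))) = N a j - U a j" if "j < p" for j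
    proof -
      have "(\<Sum>i<p. U a i * M i j) = N a j"
        unfolding M_def using D7 ab by (intro sum_inverse_apply) auto
      moreover have "(\<Sum>i<p. U a i * (M i j - (if i = j then 1 else 0)))
          = (\<Sum>i<p. U a i * M i j - (if i = j then U a j else 0))"
        by (intro sum.cong) (auto simp: algebra_simps)
      ultimately show ?thesis using that by (simp add: sum_subtractf)
    qed
    then have "(\<Sum>j<p. U b j * (\<Sum>i<p. U a i * (M i j - (if i = j then 1 else 0))))
        = (\<Sum>j<p. U b j * N a j) - (\<Sum>j<p. U b j * U a j)"
      by (simp add: right_diff_distrib sum_subtractf)
    also have "(\<Sum>j<p. U b j * N a j) = B a b"
      unfolding N_def using D7 ab by (intro sum_inverse_apply) auto
    finally show "B a b - C a b = (\<Sum>j<p. U b j * (\<Sum>i<p. U a i * (M i j - (if i = j then 1 else 0))))"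
      using whiteningD(5)[OF W ab] by (simp add: mult.commute)
  qed
  also have "\<dots> \<le> K * fnorm p (\<lambda>i j. M i j - (if i = j then 1 else 0))"
    by (rule fnorm_congruence_le[OF K transposed_operator_bound[OF K bd]])
  also have "\<dots> \<le> K * (\<delta>\<^sup>2 + 2 * \<delta>)" by (rule mult_left_mono[OF \<delta>(3) K])
  finally have "fnorm p (\<lambda>i j. B i j - C i j) \<le> K * (\<delta>\<^sup>2 + 2 * \<delta>)" .
  with \<delta>(1) 1 show thesis by (rule that)
qed


section \<open>Quadratic forms and extreme eigenvalues\<close>

lemma qform_whitening:
  assumes W: "whitening p M U A"
  shows "qform p M x = (\<Sum>k<p. (\<Sum>i<p. U i k * x i)\<^sup>2)"
proof -
  have "qform p M x = (\<Sum>i<p. \<Sum>j<p. \<Sum>k<p. (U i k * x i) * (U j k * x j))"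
    unfolding qform_def using whiteningD(5)[OF W]
    by (intro sum.cong refl) (simp add: sum_distrib_left sum_distrib_right mult_ac)
  also have "\<dots> = (\<Sum>k<p. \<Sum>i<p. \<Sum>j<p. (U i k * x i) * (U j k * x j))"
    by (subst (2) sum.swap, subst sum.swap) simp
  finally show ?thesis by (simp add: power2_eq_square sum_product)
qed

text \<open>Takes the place of compactness of the sphere: x = A (U^T x), and the squared length of
  U^T x is the form at x, so |x|^2 is at most \<open>(fnorm p A)\<^sup>2\<close> times the
  form.\<close>

lemma sym_pd_coercive:
  assumes "sym_pd p M"
  obtains \<epsilon> where "0 < \<epsilon>" "\<And>x. \<epsilon> * (\<Sum>i<p. (x i)\<^sup>2) \<le> qform p M x"
proof -
  obtain U A where W: "whitening p M U A" using sym_pd_whitening[OF assms] by blast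
  have "(\<Sum>i<p. (x i)\<^sup>2) \<le> (fnorm p A)\<^sup>2 * qform p M x" for x
  proof -
    define y where "y k = (\<Sum>j<p. U j k * x j)" for k
    have "x i = (\<Sum>k<p. A i k * y k)" if "i < p" for i
      unfolding y_def using whiteningD(7)[OF W that] that
      by (intro sum_inverse_apply[symmetric]) auto
    then have "(\<Sum>i<p. (x i)\<^sup>2) \<le> (\<Sum>i<p. (\<Sum>k<p. (A i k)\<^sup>2) * (\<Sum>k<p. (y k)\<^sup>2))"
      by (intro sum_mono) (simp add: Cauchy_Schwarz_ineq_sum)
    also have "\<dots> = (fnorm p A)\<^sup>2 * qform p M x"
      by (simp add: fnorm_power2 qform_whitening[OF W] y_def sum_distrib_right)
    finally show ?thesis .
  qed
  note * = this
  \<comment> \<open>The \<open>+ 1\<close> keeps the constant positive for p = 0, where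
    \<open>fnorm p A\<close> is 0 and so is its \<open>inverse\<close>.\<close>
  have "inverse ((fnorm p A)\<^sup>2 + 1) * (\<Sum>i<p. (x i)\<^sup>2) \<le> qform p M x" for x
  proof -
    have "0 \<le> qform p M x" unfolding qform_whitening[OF W] by (simp add: sum_nonneg)
    then have "(\<Sum>i<p. (x i)\<^sup>2) \<le> ((fnorm p A)\<^sup>2 + 1) * qform p M x"
      using *[of x] by (simp add: algebra_simps)
    then show ?thesis by (simp add: field_simps add_pos_nonneg add_nonneg_pos)
  qed
  moreover have "0 < inverse ((fnorm p A)\<^sup>2 + 1)"
    by (simp add: add_nonneg_pos)
  ultimately show thesis using that by blast
qed

text \<open>If N x were not 0, moving from x a little in the direction - N x would make the form
  negative, because its first-order term is - 2 s |N x|^2.\<close>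

lemma psd_null_vector:
  assumes sym: "\<And>i j. i < p \<Longrightarrow> j < p \<Longrightarrow> N i j = N j i"
    and psd: "\<And>x. 0 \<le> qform p N x" and null: "qform p N x = 0" and i: "i < p"
  shows "(\<Sum>j<p. N i j * x j) = 0"
proof -
  define v where "v i = (\<Sum>j<p. N i j * x j)" for i
  define V where "V = (\<Sum>i<p. (v i)\<^sup>2)"
  define Q where "Q = qform p N v"
  have c1: "(\<Sum>i<p. \<Sum>j<p. v i * N i j * x j) = V"
    unfolding V_def v_def power2_eq_square by (simp add: sum_distrib_left mult_ac)
  have c2: "(\<Sum>i<p. \<Sum>j<p. x i * N i j * v j) = V"
    unfolding c1[symmetric]
    by (subst sum.swap) (intro sum.cong refl, simp add: sym)
  have exp: "qform p N (\<lambda>i. x i + s * v i) = 2 * s * V + s\<^sup>2 * Q" for s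
  proof -
    have "qform p N (\<lambda>i. x i + s * v i) = (\<Sum>i<p. \<Sum>j<p. x i * N i j * x j
        + s * (v i * N i j * x j) + s * (x i * N i j * v j) + s\<^sup>2 * (v i * N i j * v j))"
      unfolding qform_def by (intro sum.cong refl) (simp add: algebra_simps power2_eq_square)
    also have "\<dots> = qform p N x + s * (\<Sum>i<p. \<Sum>j<p. v i * N i j * x j)
        + s * (\<Sum>i<p. \<Sum>j<p. x i * N i j * v j) + s\<^sup>2 * Q"
      unfolding Q_def qform_def by (simp only: sum.distrib sum_distrib_left)
    finally show ?thesis by (simp add: c1 c2 null)
  qed
  have "0 \<le> V" "0 \<le> Q" by (auto simp: V_def Q_def sum_nonneg psd)
  have "V = 0"
  proof (rule ccontr)
    assume "V \<noteq> 0"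
    with \<open>0 \<le> V\<close> have V: "0 < V" by simp
    \<comment> \<open>Short enough that s * Q < V, so the first-order term dominates; the
      \<open>+ 1\<close> avoids dividing by 0.\<close>
    define s where "s = V / (Q + 1)"
    have s: "0 < s" "s * (Q + 1) = V" using V \<open>0 \<le> Q\<close> by (auto simp: s_def)
    have "0 \<le> 2 * (- s) * V + (- s)\<^sup>2 * Q" using psd exp by metis
    also have "\<dots> = s * (s * (Q + 1) - V) - s * V - s * s"
      by (simp add: algebra_simps power2_eq_square)
    also have "\<dots> < 0"
      unfolding s(2) using mult_pos_pos[OF s(1) V] mult_pos_pos[OF s(1) s(1)] by simp
    finally show False by simp
  qed
  then have "\<forall>i\<in>{..<p}. (v i)\<^sup>2 = 0" unfolding V_def by (subst (asm) sum_nonneg_eq_0_iff) auto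
  with i show ?thesis by (simp add: v_def)
qed

text \<open>Replaces the spectral theorem. Let t be the least constant with form <= t |x|^2. If t >
  K, then t is no eigenvalue, so t 1 - M is semidefinite without null vectors
  (\<open>psd_null_vector\<close>), hence positive definite and coercive; then t could be lowered, a
  contradiction.\<close>

lemma qform_le_of_eigenvalues:
  assumes sym: "\<And>i j. i < p \<Longrightarrow> j < p \<Longrightarrow> M i j = M j i"
    and ev: "\<And>t x. \<exists>i<p. x i \<noteq> 0 \<Longrightarrow> (\<And>i. i < p \<Longrightarrow> (\<Sum>j<p. M i j * x j) = t * x i) \<Longrightarrow> t \<le> K"
  shows "qform p M x \<le> K * (\<Sum>i<p. (x i)\<^sup>2)"
proof (cases "p = 0")
  case True
  then show ?thesis by (simp add: qform_def)
next
  case False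
  define T where "T = {t. \<forall>x. qform p M x \<le> t * (\<Sum>i<p. (x i)\<^sup>2)}"
  have "qform p M x \<le> (\<Sum>i<p. \<Sum>j<p. \<bar>M i j\<bar>) * (\<Sum>i<p. (x i)\<^sup>2)" for x
    unfolding qform_def sum_distrib_right
  proof (intro sum_mono)
    fix i j assume ij: "i \<in> {..<p}" "j \<in> {..<p}"
    have "(x k)\<^sup>2 \<le> (\<Sum>i<p. (x i)\<^sup>2)" if "k \<in> {..<p}" for k
      by (rule member_le_sum) (use that in auto)
    then have le: "(x i)\<^sup>2 \<le> (\<Sum>i<p. (x i)\<^sup>2)" "(x j)\<^sup>2 \<le> (\<Sum>i<p. (x i)\<^sup>2)" using ij by auto
    have "\<bar>x i * x j\<bar> \<le> ((x i)\<^sup>2 + (x j)\<^sup>2) / 2"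
      using sum_squares_bound[of "\<bar>x i\<bar>" "\<bar>x j\<bar>"] by (simp add: abs_mult)
    also have "\<dots> \<le> ((\<Sum>i<p. (x i)\<^sup>2) + (\<Sum>i<p. (x i)\<^sup>2)) / 2"
      by (intro divide_right_mono add_mono le) simp
    finally have "\<bar>x i * x j\<bar> \<le> (\<Sum>i<p. (x i)\<^sup>2)" by simp
    then have "\<bar>M i j\<bar> * \<bar>x i * x j\<bar> \<le> \<bar>M i j\<bar> * (\<Sum>i<p. (x i)\<^sup>2)" by (intro mult_left_mono) auto
    moreover have "x i * M i j * x j \<le> \<bar>M i j\<bar> * \<bar>x i * x j\<bar>"
      by (metis abs_ge_self abs_mult mult.assoc mult.commute)
    ultimately show "x i * M i j * x j \<le> \<bar>M i j\<bar> * (\<Sum>i<p. (x i)\<^sup>2)" by linarith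
  qed
  then have ne: "T \<noteq> {}" unfolding T_def by blast
  have low: "M 0 0 \<le> t" if "t \<in> T" for t
  proof -
    have "qform p M (\<lambda>k. if k = 0 then 1 else 0) \<le> t * (\<Sum>i<p. (if i = 0 then 1 else 0)\<^sup>2)"
      using that unfolding T_def by blast
    also have "(\<Sum>i<p. (if i = 0 then 1 else 0)\<^sup>2 :: real) = (\<Sum>i<p. if i = 0 then 1 else 0)"
      by (intro sum.cong) auto
    finally show ?thesis using False by (simp add: qform_unit)
  qed
  then have bdd: "bdd_below T" by (rule bdd_belowI)
  define t where "t = Inf T"
  have tT: "qform p M x \<le> t * (\<Sum>i<p. (x i)\<^sup>2)" for x
  proof (cases "(\<Sum>i<p. (x i)\<^sup>2) = 0")
    case True
    obtain s where "s \<in> T" using ne by blast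
    then have "qform p M x \<le> s * (\<Sum>i<p. (x i)\<^sup>2)" unfolding T_def by blast
    then show ?thesis unfolding True by simp
  next
    case False
    then have pos: "0 < (\<Sum>i<p. (x i)\<^sup>2)"
      by (metis (no_types, lifting) order_le_less sum_nonneg zero_le_power2)
    have "qform p M x / (\<Sum>i<p. (x i)\<^sup>2) \<le> t"
      unfolding t_def using ne by (rule cInf_greatest) (use pos in \<open>auto simp: T_def field_simps\<close>)
    then show ?thesis using pos by (simp add: field_simps)
  qed
  have "t \<le> K"
  proof (rule ccontr)
    assume "\<not> t \<le> K"
    define N where "N i j = (if i = j then t else 0) - M i j" for i j
    have Nq: "qform p N x = t * (\<Sum>i<p. (x i)\<^sup>2) - qform p M x" for x
    proof -
      have "qform p N x = (\<Sum>i<p. \<Sum>j<p. (if j = i then t * (x i)\<^sup>2 else 0) - x i * M i j * x j)"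
        unfolding qform_def N_def by (intro sum.cong refl) (auto simp: algebra_simps power2_eq_square)
      then show ?thesis by (simp add: qform_def sum_subtractf sum_distrib_left)
    qed
    have Nsym: "N i j = N j i" if "i < p" "j < p" for i j using that sym by (auto simp: N_def)
    have psd: "0 \<le> qform p N x" for x using tT[of x] by (simp add: Nq)
    have "sym_pd p N"
      unfolding sym_pd_def
    proof (intro conjI allI impI)
      fix x :: "nat \<Rightarrow> real" assume ne: "\<exists>i<p. x i \<noteq> 0"
      have "qform p N x \<noteq> 0"
      proof
        assume 0: "qform p N x = 0"
        have "(\<Sum>j<p. M i j * x j) = t * x i" if i: "i < p" for i
        proof -
          have "0 = (\<Sum>j<p. N i j * x j)" using psd_null_vector[OF Nsym psd 0 i] by simp
          also have "\<dots> = (\<Sum>j<p. (if j = i then t * x i else 0) - M i j * x j)"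
            by (intro sum.cong) (auto simp: N_def algebra_simps)
          also have "\<dots> = t * x i - (\<Sum>j<p. M i j * x j)" using i by (simp add: sum_subtractf)
          finally show ?thesis by simp
        qed
        with ev ne \<open>\<not> t \<le> K\<close> show False by blast
      qed
      with psd[of x] show "0 < qform p N x" by simp
    qed (rule Nsym)
    then obtain \<epsilon> where \<epsilon>: "0 < \<epsilon>" "\<And>x. \<epsilon> * (\<Sum>i<p. (x i)\<^sup>2) \<le> qform p N x"
      using sym_pd_coercive by blast
    have "qform p M x \<le> (t - \<epsilon>) * (\<Sum>i<p. (x i)\<^sup>2)" for x
      using \<epsilon>(2)[of x] by (simp add: Nq algebra_simps)
    then have "t - \<epsilon> \<in> T" by (simp add: T_def)
    then have "t \<le> t - \<epsilon>" unfolding t_def using bdd by (rule cInf_lower)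
    with \<epsilon> show False by simp
  qed
  then have "t * (\<Sum>i<p. (x i)\<^sup>2) \<le> K * (\<Sum>i<p. (x i)\<^sup>2)"
    by (intro mult_right_mono) (auto simp: sum_nonneg)
  with tT[of x] show ?thesis by linarith
qed

section \<open>Passage between matrices and index functions\<close>

abbreviation entries :: "real mat \<Rightarrow> nat \<Rightarrow> nat \<Rightarrow> real" where
  "entries A \<equiv> (\<lambda>i j. A $$ (i,j))"

lemma fn_mat_entries: "A \<in> carrier_mat p p \<Longrightarrow> fn_mat p (entries A) = A"
  unfolding fn_mat_def by (rule eq_matI) auto

lemma scalar_prod_mult_mat_vec:
  assumes A: "A \<in> carrier_mat p p" and x: "x \<in> carrier_vec p"
  shows "scalar_prod x (A *\<^sub>v x) = qform p (entries A) (\<lambda>i. x $ i)"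
  using A x unfolding qform_def
  by (auto simp: scalar_prod_def atLeast0LessThan sum_distrib_left mult_ac intro!: sum.cong)

lemma symmetric_mat_iff:
  assumes A: "A \<in> carrier_mat p p"
  shows "symmetric_mat A \<longleftrightarrow> (\<forall>i<p. \<forall>j<p. A $$ (i,j) = A $$ (j,i))"
proof
  assume "symmetric_mat A"
  then have "transpose_mat A $$ (i,j) = A $$ (i,j)" for i j by (simp add: symmetric_mat_def)
  with A show "\<forall>i<p. \<forall>j<p. A $$ (i,j) = A $$ (j,i)"
    by (metis carrier_matD index_transpose_mat(1))
next
  assume "\<forall>i<p. \<forall>j<p. A $$ (i,j) = A $$ (j,i)"
  then show "symmetric_mat A" unfolding symmetric_mat_def using A by (intro eq_matI) auto
qed

lemma pos_def_iff_sym_pd: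
  assumes A: "A \<in> carrier_mat p p"
  shows "pos_def p A \<longleftrightarrow> sym_pd p (entries A)"
proof -
  have "(\<forall>x\<in>carrier_vec p. x \<noteq> 0\<^sub>v p \<longrightarrow> 0 < scalar_prod x (A *\<^sub>v x)) \<longleftrightarrow>
    (\<forall>x. (\<exists>i<p. x i \<noteq> 0) \<longrightarrow> 0 < qform p (entries A) x)" (is "?L \<longleftrightarrow> ?R")
  proof
    assume L: ?L
    show ?R
    proof (intro allI impI)
      fix x :: "nat \<Rightarrow> real" assume "\<exists>i<p. x i \<noteq> 0"
      then have "vec p x \<noteq> 0\<^sub>v p" by (metis index_vec index_zero_vec(1))
      then have "0 < scalar_prod (vec p x) (A *\<^sub>v vec p x)" using L by simp
      also have "\<dots> = qform p (entries A) x"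
        using A by (simp add: scalar_prod_mult_mat_vec qform_def)
      finally show "0 < qform p (entries A) x" .
    qed
  next
    assume R: ?R
    show ?L
    proof (intro ballI impI)
      fix x :: "real Matrix.vec" assume x: "x \<in> carrier_vec p" "x \<noteq> 0\<^sub>v p"
      then have "\<exists>i<p. x $ i \<noteq> 0" by (metis carrier_vecD eq_vecI index_zero_vec(1,2))
      then show "0 < scalar_prod x (A *\<^sub>v x)"
        using R by (simp add: scalar_prod_mult_mat_vec[OF A x(1)])
    qed
  qed
  then show ?thesis
    using A unfolding pos_def_def sym_pd_def symmetric_mat_iff[OF A] by blast
qed

lemma eigenvalueI:
  assumes A: "A \<in> carrier_mat p p" and x: "\<exists>i<p. x i \<noteq> 0"
    and eq: "\<And>i. i < p \<Longrightarrow> (\<Sum>j<p. A $$ (i,j) * x j) = t * x i"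
  shows "eigenvalue A (t :: real)"
  unfolding eigenvalue_def eigenvector_def
proof (intro exI[of _ "vec p x"] conjI)
  show "vec p x \<noteq> 0\<^sub>v (dim_row A)" using x A by (metis carrier_matD(1) index_vec index_zero_vec(1))
  show "A *\<^sub>v vec p x = t \<cdot>\<^sub>v vec p x"
    using A eq by (intro eq_vecI) (auto simp: scalar_prod_def atLeast0LessThan)
qed (use A in auto)

lemma qform_le_max_eigenvalue:
  assumes A: "A \<in> carrier_mat p p" and sym: "symmetric_mat A"
    and ev: "\<And>t. eigenvalue A t \<Longrightarrow> t \<le> K"
  shows "qform p (entries A) x \<le> K * (\<Sum>i<p. (x i)\<^sup>2)"
proof (rule qform_le_of_eigenvalues)
  show "A $$ (i,j) = A $$ (j,i)" if "i < p" "j < p" for i j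
    using sym that unfolding symmetric_mat_iff[OF A] by blast
qed (use ev eigenvalueI[OF A] in blast)

lemma qform_ge_min_eigenvalue:
  assumes A: "A \<in> carrier_mat p p" and sym: "symmetric_mat A"
    and ev: "\<And>t. eigenvalue A t \<Longrightarrow> k \<le> t"
  shows "k * (\<Sum>i<p. (x i)\<^sup>2) \<le> qform p (entries A) x"
proof -
  have "qform p (\<lambda>i j. - A $$ (i,j)) x \<le> - k * (\<Sum>i<p. (x i)\<^sup>2)"
  proof (rule qform_le_of_eigenvalues)
    show "- A $$ (i,j) = - A $$ (j,i)" if "i < p" "j < p" for i j
      using sym that unfolding symmetric_mat_iff[OF A] by metis
    fix t x assume "\<exists>i<p. x i \<noteq> 0" and eq: "\<And>i. i < p \<Longrightarrow> (\<Sum>j<p. - A $$ (i,j) * x j) = t * x i"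
    moreover have "(\<Sum>j<p. A $$ (i,j) * x j) = - t * x i" if "i < p" for i
      using eq[OF that] by (simp add: sum_negf)
    ultimately have "eigenvalue A (- t)" by (intro eigenvalueI[OF A])
    then show "t \<le> - k" using ev[of "- t"] by simp
  qed
  moreover have "qform p (\<lambda>i j. - A $$ (i,j)) x = - qform p (entries A) x"
    by (simp add: qform_def sum_negf)
  ultimately show ?thesis by simp
qed

section \<open>Gaussian samples\<close>

definition lin_map :: "nat \<Rightarrow> (nat \<Rightarrow> nat \<Rightarrow> real) \<Rightarrow> (nat \<Rightarrow> real) \<Rightarrow> nat \<Rightarrow> real" where
  "lin_map p A z = (\<lambda>i\<in>{..<p}. \<Sum>k<p. A i k * z k)"

lemma measurable_lin_map [measurable]:
  "lin_map p A \<in> measurable (PiM {..<p} (\<lambda>_. lborel)) (PiM {..<p} (\<lambda>_. lborel))"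
  unfolding lin_map_def by measurable

interpretation lborel_prod: product_sigma_finite "\<lambda>_ :: 'i. lborel :: real measure"
  by standard

text \<open>Change of variables by Fubini, one coordinate at a time. By triangularity only the last
  output depends on the last input, and for fixed earlier inputs it is affine in it with slope A_pp;
  each step therefore contributes one diagonal entry to the Jacobian.\<close>

lemma nn_integral_triangular:
  assumes "\<And>i j. i < p \<Longrightarrow> j < p \<Longrightarrow> i < j \<Longrightarrow> A i j = 0" and "\<And>i. i < p \<Longrightarrow> 0 < A i i"
    and "f \<in> borel_measurable (PiM {..<p} (\<lambda>_. lborel))"
  shows "(\<integral>\<^sup>+ x. f x \<partial>PiM {..<p} (\<lambda>_. lborel)) =
    ennreal (\<Prod>i<p. A i i) * (\<integral>\<^sup>+ z. f (lin_map p A z) \<partial>PiM {..<p} (\<lambda>_. lborel))"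
  using assms
proof (induction p arbitrary: f)
  case 0
  have "lin_map 0 A z = z" if "z \<in> space (PiM {..<0} (\<lambda>_. lborel))" for z
    using that by (auto simp: lin_map_def space_PiM)
  then have "(\<integral>\<^sup>+ z. f (lin_map 0 A z) \<partial>PiM {..<0} (\<lambda>_. lborel)) = (\<integral>\<^sup>+ z. f z \<partial>PiM {..<0} (\<lambda>_. lborel))"
    by (intro nn_integral_cong) simp
  then show ?case by simp
next
  case (Suc p)
  note f [measurable] = Suc.prems(3)[unfolded lessThan_Suc]
  let ?P = "PiM {..<p} (\<lambda>_. lborel :: real measure)"
  define g where "g z = f (lin_map (Suc p) A z)" for z
  have g [measurable]: "g \<in> borel_measurable (PiM (insert p {..<p}) (\<lambda>_. lborel))"
    using measurable_compose[OF measurable_lin_map[of "Suc p" A] Suc.prems(3)]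
    unfolding g_def lessThan_Suc .
  define F where "F x = (\<integral>\<^sup>+ y. f (x(p := y)) \<partial>lborel)" for x
  have [measurable]: "F \<in> borel_measurable ?P"
    unfolding F_def by measurable
  have [measurable]: "(\<lambda>y. f ((lin_map p A z)(p := y))) \<in> borel_measurable borel" if "z \<in> space ?P" for z
  proof -
    have "lin_map p A z \<in> space ?P" by (simp add: lin_map_def space_PiM)
    then show ?thesis by measurable
  qed
  have upd: "(lin_map p A z)(p := (\<Sum>k<p. A p k * z k) + A p p * y) = lin_map (Suc p) A (z(p := y))"
    for z y
    using Suc.prems(1) by (auto simp: lin_map_def fun_eq_iff less_Suc_eq)
  have "(\<integral>\<^sup>+ x. f x \<partial>PiM {..<Suc p} (\<lambda>_. lborel)) = (\<integral>\<^sup>+ x. F x \<partial>?P)"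
    unfolding lessThan_Suc F_def by (intro lborel_prod.product_nn_integral_insert f) auto
  also have "\<dots> = ennreal (\<Prod>i<p. A i i) * (\<integral>\<^sup>+ z. F (lin_map p A z) \<partial>?P)"
    using Suc.prems(1,2) by (intro Suc.IH) auto
  also have "(\<integral>\<^sup>+ z. F (lin_map p A z) \<partial>?P) =
      (\<integral>\<^sup>+ z. ennreal (A p p) * (\<integral>\<^sup>+ y. g (z(p := y)) \<partial>lborel) \<partial>?P)"
  proof (intro nn_integral_cong)
    fix z assume z: "z \<in> space ?P"
    show "F (lin_map p A z) = ennreal (A p p) * (\<integral>\<^sup>+ y. g (z(p := y)) \<partial>lborel)"
      unfolding F_def g_def using z Suc.prems(2)[of p]
      by (subst nn_integral_real_affine[where c="A p p" and t="\<Sum>k<p. A p k * z k"])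
         (auto simp del: fun_upd_apply simp: upd)
  qed
  also have "\<dots> = ennreal (A p p) * (\<integral>\<^sup>+ z. (\<integral>\<^sup>+ y. g (z(p := y)) \<partial>lborel) \<partial>?P)"
    by (intro nn_integral_cmult) measurable
  also have "(\<integral>\<^sup>+ z. (\<integral>\<^sup>+ y. g (z(p := y)) \<partial>lborel) \<partial>?P)
      = (\<integral>\<^sup>+ z. g z \<partial>PiM {..<Suc p} (\<lambda>_. lborel))"
    unfolding lessThan_Suc by (intro lborel_prod.product_nn_integral_insert[symmetric] g) auto
  moreover have "0 \<le> (\<Prod>i<p. A i i)" "0 \<le> A p p"
    using Suc.prems(2) by (auto intro!: prod_nonneg simp: less_imp_le)
  ultimately show ?case
    by (simp add: mult.assoc ennreal_mult g_def)
qed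

abbreviation std_gauss :: "nat \<Rightarrow> (nat \<Rightarrow> real) measure" where
  "std_gauss p \<equiv> PiM {..<p} (\<lambda>_. density lborel std_normal_density)"

lemma prob_space_std_normal: "prob_space (density lborel std_normal_density)"
  by (rule prob_space_normal_density) simp

lemma std_gauss_eq_density:
  "std_gauss p = density (PiM {..<p} (\<lambda>_. lborel)) (\<lambda>z. ennreal (\<Prod>k<p. std_normal_density (z k)))"
proof (rule sym, rule product_sigma_finite.PiM_eqI)
  show "product_sigma_finite (\<lambda>_ :: nat. density lborel std_normal_density)"
    using prob_space_std_normal
    by (intro product_sigma_finite.intro prob_space_imp_sigma_finite)
  show "sets (density (PiM {..<p} (\<lambda>_. lborel)) (\<lambda>z. ennreal (\<Prod>k<p. std_normal_density (z k)))) =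
    sets (std_gauss p)"
    unfolding sets_density by (intro sets_PiM_cong) auto
  fix B :: "nat \<Rightarrow> real set" assume "\<And>i. i \<in> {..<p} \<Longrightarrow> B i \<in> sets (density lborel std_normal_density)"
  then have B [measurable]: "B i \<in> sets borel" if "i < p" for i using that by auto
  have [measurable]: "Pi\<^sub>E {..<p} B \<in> sets (PiM {..<p} (\<lambda>_. lborel))"
    by (rule sets_PiM_I_finite) (use B in auto)
  have "emeasure (density (PiM {..<p} (\<lambda>_. lborel)) (\<lambda>z. ennreal (\<Prod>k<p. std_normal_density (z k)))) (Pi\<^sub>E {..<p} B)
    = (\<integral>\<^sup>+ z. ennreal (\<Prod>k<p. std_normal_density (z k)) * indicator (Pi\<^sub>E {..<p} B) z \<partial>PiM {..<p} (\<lambda>_. lborel))"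
    by (rule emeasure_density) measurable
  also have "\<dots> = (\<integral>\<^sup>+ z. (\<Prod>k<p. ennreal (std_normal_density (z k)) * indicator (B k) (z k)) \<partial>PiM {..<p} (\<lambda>_. lborel))"
  proof (intro nn_integral_cong)
    fix z assume "z \<in> space (PiM {..<p} (\<lambda>_. lborel :: real measure))"
    then have "indicator (Pi\<^sub>E {..<p} B) z = (\<Prod>k<p. indicator (B k) (z k) :: ennreal)"
      by (auto simp: indicator_def space_PiM PiE_iff prod_zero_iff split: if_splits)
    then show "ennreal (\<Prod>k<p. std_normal_density (z k)) * indicator (Pi\<^sub>E {..<p} B) z =
        (\<Prod>k<p. ennreal (std_normal_density (z k)) * indicator (B k) (z k))"
      by (simp add: prod.distrib prod_ennreal)
  qed
  also have "\<dots> = (\<Prod>k<p. \<integral>\<^sup>+ x. ennreal (std_normal_density x) * indicator (B k) x \<partial>lborel)"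
    by (rule lborel_prod.product_nn_integral_prod) (use B in auto)
  also have "\<dots> = (\<Prod>k<p. emeasure (density lborel std_normal_density) (B k))"
    by (intro prod.cong refl emeasure_density[symmetric]) (use B in auto)
  finally show "emeasure (density (PiM {..<p} (\<lambda>_. lborel)) (\<lambda>z. ennreal (\<Prod>k<p. std_normal_density (z k)))) (Pi\<^sub>E {..<p} B)
    = (\<Prod>i<p. emeasure (density lborel std_normal_density) (B i))" .
qed simp

lemma borel_measurable_gauss_dens [measurable]:
  "gauss_dens p \<Omega> \<in> borel_measurable (PiM {..<p} (\<lambda>_. lborel))"
  unfolding gauss_dens_def by measurable

text \<open>The Jacobian, the product of the A_ii, cancels the square root of det Omega, the product
  of the U_ii; the quadratic form at A z is |U^T A z|^2 = |z|^2.\<close>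

lemma gauss_dens_lin_map:
  assumes \<Omega>: "\<Omega> \<in> carrier_mat p p" and W: "whitening p (entries \<Omega>) U A"
  shows "(\<Prod>i<p. A i i) * gauss_dens p \<Omega> (lin_map p A z) = (\<Prod>k<p. std_normal_density (z k))"
proof -
  have "(\<Sum>i<p. \<Sum>j<p. lin_map p A z i * \<Omega> $$ (i,j) * lin_map p A z j) = qform p (entries \<Omega>) (lin_map p A z)"
    by (simp add: qform_def)
  also have "\<dots> = (\<Sum>k<p. (z k)\<^sup>2)"
    unfolding qform_whitening[OF W]
  proof (intro sum.cong refl arg_cong[where f="\<lambda>x. x\<^sup>2"])
    fix k assume k: "k \<in> {..<p}"
    have "(\<Sum>i<p. U i k * lin_map p A z i) = (\<Sum>i<p. U i k * (\<Sum>l<p. A i l * z l))"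
      by (simp add: lin_map_def)
    also have "\<dots> = z k"
      using whiteningD(6)[OF W] k by (intro sum_inverse_apply) auto
    finally show "(\<Sum>i<p. U i k * lin_map p A z i) = z k" .
  qed
  finally have q: "(\<Sum>i<p. \<Sum>j<p. lin_map p A z i * \<Omega> $$ (i,j) * lin_map p A z j) = (\<Sum>k<p. (z k)\<^sup>2)" .
  have "det \<Omega> = (\<Prod>i<p. U i i)\<^sup>2"
    using whitening_det(1)[OF W] by (simp add: fn_mat_entries[OF \<Omega>])
  then have d: "sqrt (det \<Omega>) = (\<Prod>i<p. U i i)" using whitening_det(3)[OF W] by simp
  have "(\<Prod>k<p. std_normal_density (z k)) = (1 / sqrt (2 * pi)) ^ p * exp (\<Sum>k<p. - (z k)\<^sup>2 / 2)"
    by (simp add: std_normal_density_def prod.distrib exp_sum prod_dividef power_one_over)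
  also have "(1 / sqrt (2 * pi)) ^ p = (2 * pi) powr (- real p / 2)"
    by (simp add: powr_minus powr_half_sqrt[symmetric] powr_powr powr_realpow[symmetric] power_one_over inverse_eq_divide)
  also have "(\<Sum>k<p. - (z k)\<^sup>2 / 2) = - (\<Sum>k<p. (z k)\<^sup>2) / 2"
    by (simp add: sum_negf sum_divide_distrib)
  finally show ?thesis
    unfolding gauss_dens_def q d using whitening_det(2)[OF W] by (simp add: mult_ac)
qed

text \<open>Turns every moment under \<open>gaussian\<close> into one of linear combinations of
  independent standard normals.\<close>

lemma gaussian_eq_distr:
  assumes \<Omega>: "\<Omega> \<in> carrier_mat p p" and W: "whitening p (entries \<Omega>) U A"
  shows "gaussian p \<Omega> = distr (std_gauss p) (PiM {..<p} (\<lambda>_. lborel)) (lin_map p A)"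
proof (rule measure_eqI)
  show "sets (gaussian p \<Omega>) = sets (distr (std_gauss p) (PiM {..<p} (\<lambda>_. lborel)) (lin_map p A))"
    by (simp add: gaussian_def)
  fix X assume "X \<in> sets (gaussian p \<Omega>)"
  then have X [measurable]: "X \<in> sets (PiM {..<p} (\<lambda>_. lborel))" by (simp add: gaussian_def)
  let ?P = "PiM {..<p} (\<lambda>_. lborel :: real measure)"
  have pos: "0 \<le> (\<Prod>i<p. A i i)" using whiteningD(4)[OF W] by (intro prod_nonneg) (auto intro: less_imp_le)
  have "emeasure (gaussian p \<Omega>) X = (\<integral>\<^sup>+ x. ennreal (gauss_dens p \<Omega> x) * indicator X x \<partial>?P)"
    unfolding gaussian_def by (rule emeasure_density) measurable
  also have "\<dots> = ennreal (\<Prod>i<p. A i i) *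
      (\<integral>\<^sup>+ z. ennreal (gauss_dens p \<Omega> (lin_map p A z)) * indicator X (lin_map p A z) \<partial>?P)"
    using whiteningD(2,4)[OF W] by (intro nn_integral_triangular) measurable
  also have "\<dots> = (\<integral>\<^sup>+ z. ennreal (\<Prod>i<p. A i i) *
      (ennreal (gauss_dens p \<Omega> (lin_map p A z)) * indicator X (lin_map p A z)) \<partial>?P)"
    by (rule nn_integral_cmult[symmetric]) measurable
  also have "\<dots> = (\<integral>\<^sup>+ z. ennreal (\<Prod>k<p. std_normal_density (z k)) * indicator (lin_map p A -` X \<inter> space ?P) z \<partial>?P)"
    by (intro nn_integral_cong)
       (simp add: mult.assoc[symmetric] ennreal_mult'[OF pos, symmetric] gauss_dens_lin_map[OF \<Omega> W] indicator_def)
  also have "\<dots> = emeasure (std_gauss p) (lin_map p A -` X \<inter> space ?P)"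
    unfolding std_gauss_eq_density by (rule emeasure_density[symmetric]) measurable
  also have "\<dots> = emeasure (distr (std_gauss p) ?P (lin_map p A)) X"
    by (subst emeasure_distr) (auto simp: std_gauss_eq_density)
  finally show "emeasure (gaussian p \<Omega>) X = emeasure (distr (std_gauss p) ?P (lin_map p A)) X" .
qed

lemma prob_space_std_gauss: "prob_space (std_gauss p)"
  by (intro prob_space_PiM prob_space_std_normal)

section \<open>Moments and concentration of the sample covariance\<close>

lemma indep_vars_PiM_coordinates:
  assumes "I \<noteq> {}" and M: "\<And>i. i \<in> I \<Longrightarrow> prob_space (M i)"
  shows "prob_space.indep_vars (PiM I M) M (\<lambda>i \<omega>. \<omega> i) I"
proof -
  interpret prob_space "PiM I M" by (rule prob_space_PiM) (rule M)
  have "distr (PiM I M) (PiM I M) (\<lambda>x. \<lambda>i\<in>I. x i) = distr (PiM I M) (PiM I M) (\<lambda>x. x)"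
    by (intro distr_cong refl) (auto simp: space_PiM PiE_iff extensional_restrict)
  also have "\<dots> = PiM I M" by (rule distr_id)
  also have "\<dots> = PiM I (\<lambda>i. distr (PiM I M) (M i) (\<lambda>x. x i))"
    by (intro PiM_cong refl distr_PiM_component[symmetric] M)
  finally show ?thesis
    using assms(1) by (subst indep_vars_iff_distr_eq_PiM') auto
qed

lemma std_gauss_linear_moments:
  fixes c :: "nat \<Rightarrow> real" and p :: nat
  defines "X \<equiv> (\<lambda>z. \<Sum>k<p. c k * z k)" and "s2 \<equiv> \<Sum>k<p. (c k)\<^sup>2"
  shows "integrable (std_gauss p) (\<lambda>z. (X z)\<^sup>2)" "integral\<^sup>L (std_gauss p) (\<lambda>z. (X z)\<^sup>2) = s2"
    "integrable (std_gauss p) (\<lambda>z. (X z) ^ 4)" "integral\<^sup>L (std_gauss p) (\<lambda>z. (X z) ^ 4) = 3 * s2\<^sup>2"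
proof -
  interpret prob_space "std_gauss p" by (rule prob_space_std_gauss)
  \<comment> \<open>Normal densities need a positive standard deviation, so vanishing coefficients
    are removed first; if none is left, the combination is identically 0.\<close>
  define K where "K = {k. k < p \<and> c k \<noteq> 0}"
  have K: "finite K" "K \<subseteq> {..<p}" "\<And>k. k \<in> K \<Longrightarrow> c k \<noteq> 0" by (auto simp: K_def)
  have XK: "X = (\<lambda>z. \<Sum>k\<in>K. c k * z k)"
    unfolding X_def by (intro ext sum.mono_neutral_right) (auto simp: K_def)
  have sK: "s2 = (\<Sum>k\<in>K. (c k)\<^sup>2)"
    unfolding s2_def by (intro sum.mono_neutral_right) (auto simp: K_def)
  have "integrable (std_gauss p) (\<lambda>z. (X z)\<^sup>2) \<and> integral\<^sup>L (std_gauss p) (\<lambda>z. (X z)\<^sup>2) = s2 \<and>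
    integrable (std_gauss p) (\<lambda>z. (X z) ^ 4) \<and> integral\<^sup>L (std_gauss p) (\<lambda>z. (X z) ^ 4) = 3 * s2\<^sup>2"
  proof (cases "K = {}")
    case True
    then show ?thesis by (simp add: XK sK)
  next
    case False
    then have "{..<p} \<noteq> {}" using K by blast
    from indep_vars_PiM_coordinates[OF this, of "\<lambda>_. density lborel std_normal_density"]
    have "indep_vars (\<lambda>_. density lborel std_normal_density) (\<lambda>i \<omega>. \<omega> i) {..<p}"
      using prob_space_std_normal by simp
    then have "indep_vars (\<lambda>_. borel) (\<lambda>i \<omega>. c i * \<omega> i) {..<p}"
      by (rule indep_vars_compose2) measurable
    then have ind: "indep_vars (\<lambda>_. borel) (\<lambda>i \<omega>. c i * \<omega> i) K"
      by (rule indep_vars_subset) (rule K)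
    have nd: "distributed (std_gauss p) lborel (\<lambda>\<omega>. c k * \<omega> k) (normal_density 0 \<bar>c k\<bar>)" if k: "k \<in> K" for k
    proof -
      have "distr (std_gauss p) (density lborel std_normal_density) (\<lambda>\<omega>. \<omega> k) = density lborel std_normal_density"
        using k K by (intro distr_PiM_component prob_space_std_normal) auto
      moreover have "distr (std_gauss p) (density lborel std_normal_density) (\<lambda>\<omega>. \<omega> k) = distr (std_gauss p) lborel (\<lambda>\<omega>. \<omega> k)"
        by (intro distr_cong) auto
      moreover have "(\<lambda>\<omega>. \<omega> k) \<in> borel_measurable (std_gauss p)"
        using k K measurable_component_singleton[of k "{..<p}" "\<lambda>_. density lborel std_normal_density"] by auto
      ultimately have "distributed (std_gauss p) lborel (\<lambda>\<omega>. \<omega> k) std_normal_density"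
        by (simp add: distributed_def)
      from normal_density_affine[OF this, of "c k" 0] show ?thesis using K(3)[OF k] by simp
    qed
    define \<sigma> where "\<sigma> = sqrt s2"
    have s2: "0 < s2" unfolding sK using False K by (intro sum_pos) auto
    then have \<sigma>: "0 < \<sigma>" "\<sigma>\<^sup>2 = s2" by (auto simp: \<sigma>_def)
    have D: "distributed (std_gauss p) lborel X (normal_density 0 \<sigma>)"
      using sum_indep_normal[OF K(1) False ind, of "\<lambda>k. \<bar>c k\<bar>" "\<lambda>_. 0"] nd K(3)
      by (simp add: XK sK \<sigma>_def)
    have i: "integrable (std_gauss p) (\<lambda>z. (X z) ^ (2 * k))" for k
      using distributed_integrable[OF D, of "\<lambda>x. x ^ (2 * k)"] integrable_normal_moment[OF \<sigma>(1), of 0 "2 * k"]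
      by simp
    have e: "integral\<^sup>L (std_gauss p) (\<lambda>z. (X z) ^ (2 * k)) = fact (2 * k) / ((2 / \<sigma>\<^sup>2) ^ k * fact k)" for k
      using distributed_integral[OF D, of "\<lambda>x. x ^ (2 * k)"] integral_normal_moment_even[OF \<sigma>(1), of 0 k]
      by simp
    show ?thesis
      using i[of 1] i[of 2] e[of 1, unfolded \<sigma>(2)] e[of 2, unfolded \<sigma>(2)] s2
      by (simp add: fact_numeral field_simps power2_eq_square)
  qed
  then show "integrable (std_gauss p) (\<lambda>z. (X z)\<^sup>2)" "integral\<^sup>L (std_gauss p) (\<lambda>z. (X z)\<^sup>2) = s2"
    "integrable (std_gauss p) (\<lambda>z. (X z) ^ 4)" "integral\<^sup>L (std_gauss p) (\<lambda>z. (X z) ^ 4) = 3 * s2\<^sup>2"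
    by auto
qed


lemma prob_space_gaussian:
  assumes "pos_def p \<Omega>" shows "prob_space (gaussian p \<Omega>)"
proof -
  have \<Omega>: "\<Omega> \<in> carrier_mat p p" using assms by (simp add: pos_def_def)
  obtain U A where W: "whitening p (entries \<Omega>) U A"
    using sym_pd_whitening assms pos_def_iff_sym_pd[OF \<Omega>] by blast
  show ?thesis
    unfolding gaussian_eq_distr[OF \<Omega> W]
    by (rule prob_space.prob_space_distr[OF prob_space_std_gauss]) (simp add: std_gauss_eq_density)
qed

text \<open>Polarisation writes x_i x_j through squares of linear combinations, whose moments are
  known; the fourth-order moment is only bounded, by (a b)^2 <= (a^4 + b^4) / 2, which is enough for
  Chebyshev.\<close>

lemma gaussian_product_moments:
  fixes A :: "nat \<Rightarrow> nat \<Rightarrow> real"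
  assumes \<Omega>: "\<Omega> \<in> carrier_mat p p" and W: "whitening p (entries \<Omega>) U A" and ij: "i < p" "j < p"
  defines "S \<equiv> \<lambda>i j. \<Sum>k<p. A i k * A j k"
  shows "integrable (gaussian p \<Omega>) (\<lambda>x. x i * x j)"
    "integral\<^sup>L (gaussian p \<Omega>) (\<lambda>x. x i * x j) = S i j"
    "integrable (gaussian p \<Omega>) (\<lambda>x. (x i * x j)\<^sup>2)"
    "integral\<^sup>L (gaussian p \<Omega>) (\<lambda>x. (x i * x j)\<^sup>2) \<le> 3 * ((S i i)\<^sup>2 + (S j j)\<^sup>2) / 2"
proof -
  let ?P = "PiM {..<p} (\<lambda>_. lborel :: real measure)"
  have lin [measurable]: "lin_map p A \<in> measurable (std_gauss p) ?P"
    using measurable_lin_map by (simp add: std_gauss_eq_density)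
  have tr: "integrable (gaussian p \<Omega>) f \<longleftrightarrow> integrable (std_gauss p) (\<lambda>z. f (lin_map p A z))"
    "integral\<^sup>L (gaussian p \<Omega>) f = integral\<^sup>L (std_gauss p) (\<lambda>z. f (lin_map p A z))"
    if [measurable]: "f \<in> borel_measurable ?P" for f :: "(nat \<Rightarrow> real) \<Rightarrow> real"
    unfolding gaussian_eq_distr[OF \<Omega> W] by (simp_all add: integrable_distr_eq integral_distr)
  define X where "X i z = (\<Sum>k<p. A i k * z k)" for i z
  define Z where "Z z = (\<Sum>k<p. (A i k + A j k) * z k)" for z
  have lX: "lin_map p A z i = X i z" "lin_map p A z j = X j z" for z
    using ij by (auto simp: lin_map_def X_def)
  have [measurable]: "(\<lambda>x. x i) \<in> borel_measurable ?P" "(\<lambda>x. x j) \<in> borel_measurable ?P"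
    using ij by (auto intro!: measurable_component_singleton[THEN measurable_compose])
  note mX = std_gauss_linear_moments[where p=p, of "A i", folded X_def]
    std_gauss_linear_moments[where p=p, of "A j", folded X_def]
  note mZ = std_gauss_linear_moments[where p=p, of "\<lambda>k. A i k + A j k", folded Z_def]
  have pol: "X i z * X j z = ((Z z)\<^sup>2 - (X i z)\<^sup>2 - (X j z)\<^sup>2) / 2" for z
  proof -
    have "Z z = X i z + X j z" by (simp add: Z_def X_def sum.distrib distrib_right)
    then show ?thesis by (simp add: power2_eq_square algebra_simps)
  qed
  show "integrable (gaussian p \<Omega>) (\<lambda>x. x i * x j)"
    using mX mZ by (subst tr) (simp_all add: lX pol)
  have "integral\<^sup>L (gaussian p \<Omega>) (\<lambda>x. x i * x j) =
      ((\<Sum>k<p. (A i k + A j k)\<^sup>2) - (\<Sum>k<p. (A i k)\<^sup>2) - (\<Sum>k<p. (A j k)\<^sup>2)) / 2"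
    using mX mZ by (subst tr) (simp_all add: lX pol)
  also have "\<dots> = S i j"
    unfolding S_def sum_subtractf[symmetric] sum_divide_distrib
    by (intro sum.cong refl) (simp add: power2_eq_square algebra_simps)
  finally show "integral\<^sup>L (gaussian p \<Omega>) (\<lambda>x. x i * x j) = S i j" .
  have le: "(X i z * X j z)\<^sup>2 \<le> ((X i z) ^ 4 + (X j z) ^ 4) / 2" for z
    using sum_squares_bound[of "(X i z)\<^sup>2" "(X j z)\<^sup>2"]
    by (simp add: power_mult_distrib power2_eq_square power4_eq_xxxx mult_ac)
  have int: "integrable (std_gauss p) (\<lambda>z. ((X i z) ^ 4 + (X j z) ^ 4) / 2)"
    using mX by simp
  have "integrable (std_gauss p) (\<lambda>z. (X i z * X j z)\<^sup>2)"
  proof (rule Bochner_Integration.integrable_bound[OF int])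
    show "(\<lambda>z. (X i z * X j z)\<^sup>2) \<in> borel_measurable (std_gauss p)"
      unfolding lX[symmetric] by measurable
    show "AE z in std_gauss p. norm ((X i z * X j z)\<^sup>2) \<le> norm (((X i z) ^ 4 + (X j z) ^ 4) / 2)"
      using le by (intro AE_I2) (simp add: order.trans[OF _ abs_ge_self])
  qed
  note int2 = this
  then show "integrable (gaussian p \<Omega>) (\<lambda>x. (x i * x j)\<^sup>2)"
    by (subst tr) (simp_all add: lX)
  have "integral\<^sup>L (gaussian p \<Omega>) (\<lambda>x. (x i * x j)\<^sup>2) = integral\<^sup>L (std_gauss p) (\<lambda>z. (X i z * X j z)\<^sup>2)"
    by (subst tr) (simp_all add: lX)
  also have "\<dots> \<le> integral\<^sup>L (std_gauss p) (\<lambda>z. ((X i z) ^ 4 + (X j z) ^ 4) / 2)"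
    by (intro integral_mono int int2 le)
  also have "\<dots> = 3 * ((S i i)\<^sup>2 + (S j j)\<^sup>2) / 2"
    using mX by (simp add: S_def power2_eq_square)
  finally show "integral\<^sup>L (gaussian p \<Omega>) (\<lambda>x. (x i * x j)\<^sup>2) \<le> 3 * ((S i i)\<^sup>2 + (S j j)\<^sup>2) / 2" .
qed

text \<open>The cross terms vanish by independence and centring.\<close>

lemma product_centered_sum_second_moment:
  fixes f :: "'a \<Rightarrow> real" and n :: nat
  assumes G: "prob_space G" and f: "integrable G f" "integral\<^sup>L G f = 0" "integrable G (\<lambda>x. (f x)\<^sup>2)"
  shows "integrable (PiM {..<n} (\<lambda>_. G)) (\<lambda>Y. (\<Sum>l<n. f (Y l))\<^sup>2)"
    "integral\<^sup>L (PiM {..<n} (\<lambda>_. G)) (\<lambda>Y. (\<Sum>l<n. f (Y l))\<^sup>2) = real n * integral\<^sup>L G (\<lambda>x. (f x)\<^sup>2)"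
proof -
  let ?P = "PiM {..<n} (\<lambda>_. G)"
  interpret prob_space ?P by (rule prob_space_PiM) (rule G)
  have comp: "integrable ?P (\<lambda>Y. g (Y l))" "integral\<^sup>L ?P (\<lambda>Y. g (Y l)) = integral\<^sup>L G g"
    if "integrable G g" "l < n" for g :: "'a \<Rightarrow> real" and l
  proof -
    have d: "distr ?P G (\<lambda>Y. Y l) = G" using that G by (intro distr_PiM_component) auto
    have m: "(\<lambda>Y. Y l) \<in> measurable ?P G" using that by (intro measurable_component_singleton) simp
    have g: "g \<in> borel_measurable G" using that by simp
    show "integrable ?P (\<lambda>Y. g (Y l))"
      using integrable_distr_eq[OF m g] that by (simp add: d)
    show "integral\<^sup>L ?P (\<lambda>Y. g (Y l)) = integral\<^sup>L G g"
      using integral_distr[OF m g] by (simp add: d)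
  qed
  have cross: "integrable ?P (\<lambda>Y. f (Y l) * f (Y m)) \<and>
      integral\<^sup>L ?P (\<lambda>Y. f (Y l) * f (Y m)) = (if l = m then integral\<^sup>L G (\<lambda>x. (f x)\<^sup>2) else 0)"
    if lm: "l < n" "m < n" for l m
  proof (cases "l = m")
    case True
    then show ?thesis using comp[OF f(3) lm(1)] by (simp add: power2_eq_square)
  next
    case False
    have "{..<n} \<noteq> {}" using lm by auto
    from indep_vars_PiM_coordinates[OF this, of "\<lambda>_. G"] G
    have "indep_vars (\<lambda>_. G) (\<lambda>i \<omega>. \<omega> i) {..<n}" by simp
    then have "indep_vars (\<lambda>_. borel) (\<lambda>i \<omega>. f (\<omega> i)) {..<n}"
      by (rule indep_vars_compose2) (use f in simp)
    then have ind: "indep_vars (\<lambda>_. borel) (\<lambda>i \<omega>. f (\<omega> i)) {l, m}"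
      by (rule indep_vars_subset) (use lm in auto)
    have i: "integrable ?P (\<lambda>\<omega>. f (\<omega> i))" if "i \<in> {l, m}" for i
      using that lm comp(1)[OF f(1)] by auto
    show ?thesis
      using indep_vars_integrable[OF _ ind i] indep_vars_lebesgue_integral[OF _ ind i]
        False comp(2)[OF f(1)] lm f(2) by simp
  qed
  have sq: "(\<Sum>l<n. f (Y l))\<^sup>2 = (\<Sum>l<n. \<Sum>m<n. f (Y l) * f (Y m))" for Y
    by (simp add: power2_eq_square sum_product)
  show "integrable ?P (\<lambda>Y. (\<Sum>l<n. f (Y l))\<^sup>2)"
    unfolding sq using cross by (intro Bochner_Integration.integrable_sum) auto
  have "integral\<^sup>L ?P (\<lambda>Y. (\<Sum>l<n. f (Y l))\<^sup>2) = (\<Sum>l<n. \<Sum>m<n. integral\<^sup>L ?P (\<lambda>Y. f (Y l) * f (Y m)))"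
    unfolding sq using cross
    by (subst Bochner_Integration.integral_sum) (auto intro!: sum.cong Bochner_Integration.integral_sum)
  also have "\<dots> = (\<Sum>l<n. \<Sum>m<n. if l = m then integral\<^sup>L G (\<lambda>x. (f x)\<^sup>2) else 0)"
    using cross by (intro sum.cong refl) auto
  finally show "integral\<^sup>L ?P (\<lambda>Y. (\<Sum>l<n. f (Y l))\<^sup>2) = real n * integral\<^sup>L G (\<lambda>x. (f x)\<^sup>2)"
    by simp
qed

text \<open>Markov's inequality for the summed squared errors. The expectation is proportional to
  the number of entries in I, which is what later produces p + |E| instead of p^2.\<close>

lemma sample_covariance_concentration:
  fixes A :: "nat \<Rightarrow> nat \<Rightarrow> real" and n :: nat
  assumes pd: "pos_def p \<Omega>" and W: "whitening p (entries \<Omega>) U A"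
    and I: "finite I" "I \<subseteq> {..<p} \<times> {..<p}" and t: "0 < t"
  defines "S \<equiv> \<lambda>i j. \<Sum>k<p. A i k * A j k"
  assumes \<kappa>: "\<And>i. i < p \<Longrightarrow> S i i \<le> \<kappa>"
  defines "V \<equiv> \<lambda>Y. \<Sum>(i,j)\<in>I. (\<Sum>l<n. Y l i * Y l j - S i j)\<^sup>2"
  shows "{Y \<in> space (sample_law n p \<Omega>). t \<le> V Y} \<in> sets (sample_law n p \<Omega>)"
    "measure (sample_law n p \<Omega>) {Y \<in> space (sample_law n p \<Omega>). t \<le> V Y}
      \<le> real (card I) * real n * (3 * \<kappa>\<^sup>2) / t"
proof -
  have \<Omega>: "\<Omega> \<in> carrier_mat p p" using pd by (simp add: pos_def_def)
  interpret G: prob_space "gaussian p \<Omega>" by (rule prob_space_gaussian[OF pd])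
  define f where "f i j x = x i * x j - S i j" for i j and x :: "nat \<Rightarrow> real"
  have f: "integrable (gaussian p \<Omega>) (f i j)" "integral\<^sup>L (gaussian p \<Omega>) (f i j) = 0"
      "integrable (gaussian p \<Omega>) (\<lambda>x. (f i j x)\<^sup>2)" "integral\<^sup>L (gaussian p \<Omega>) (\<lambda>x. (f i j x)\<^sup>2) \<le> 3 * \<kappa>\<^sup>2"
    if ij: "i < p" "j < p" for i j
  proof -
    have SS: "(\<Sum>k<p. A i k * A j k) = S i j" for i j by (simp add: S_def)
    note m = gaussian_product_moments[OF \<Omega> W ij, unfolded SS]
    have fs: "(f i j x)\<^sup>2 = (x i * x j)\<^sup>2 - 2 * S i j * (x i * x j) + (S i j)\<^sup>2" for x
      by (simp add: f_def power2_diff)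
    show "integrable (gaussian p \<Omega>) (f i j)" unfolding f_def using m by simp
    show "integral\<^sup>L (gaussian p \<Omega>) (f i j) = 0" unfolding f_def using m by (simp add: G.prob_space)
    show "integrable (gaussian p \<Omega>) (\<lambda>x. (f i j x)\<^sup>2)" unfolding fs using m by simp
    have "0 \<le> S i i" "0 \<le> S j j" by (auto simp: S_def sum_nonneg)
    then have "(S i i)\<^sup>2 \<le> \<kappa>\<^sup>2" "(S j j)\<^sup>2 \<le> \<kappa>\<^sup>2" using \<kappa> ij by (auto intro: power_mono)
    moreover have "integral\<^sup>L (gaussian p \<Omega>) (\<lambda>x. (f i j x)\<^sup>2)
        = integral\<^sup>L (gaussian p \<Omega>) (\<lambda>x. (x i * x j)\<^sup>2) - (S i j)\<^sup>2"
      unfolding fs using m by (simp add: G.prob_space power2_eq_square)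
    moreover have "e \<le> 3 * k" if "a \<le> k" "b \<le> k" "e = r - s" "r \<le> 3 * (a + b) / 2" "0 \<le> s"
      for a b e k r s :: real
    proof -
      have "2 * r \<le> 3 * a + 3 * b" using that(4) by simp
      then show ?thesis using that(1-3,5) by linarith
    qed
    ultimately show "integral\<^sup>L (gaussian p \<Omega>) (\<lambda>x. (f i j x)\<^sup>2) \<le> 3 * \<kappa>\<^sup>2"
      using m(4) zero_le_power2[of "S i j"] by blast
  qed
  let ?L = "sample_law n p \<Omega>"
  have VF: "V Y = (\<Sum>ij\<in>I. (\<Sum>l<n. f (fst ij) (snd ij) (Y l))\<^sup>2)" for Y
    by (simp add: V_def f_def case_prod_beta)
  have s: "integrable ?L (\<lambda>Y. (\<Sum>l<n. f (fst ij) (snd ij) (Y l))\<^sup>2)"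
    "integral\<^sup>L ?L (\<lambda>Y. (\<Sum>l<n. f (fst ij) (snd ij) (Y l))\<^sup>2) \<le> real n * (3 * \<kappa>\<^sup>2)" if "ij \<in> I" for ij
  proof -
    have "fst ij < p" "snd ij < p" using that I by auto
    note ff = f[OF this]
    note ps = product_centered_sum_second_moment[OF prob_space_gaussian[OF pd] ff(1-3), of n]
    show "integrable ?L (\<lambda>Y. (\<Sum>l<n. f (fst ij) (snd ij) (Y l))\<^sup>2)"
      using ps(1) by (simp add: sample_law_def)
    show "integral\<^sup>L ?L (\<lambda>Y. (\<Sum>l<n. f (fst ij) (snd ij) (Y l))\<^sup>2) \<le> real n * (3 * \<kappa>\<^sup>2)"
      using ps(2) ff(4) by (simp add: sample_law_def mult_left_mono)
  qed
  have iV: "integrable ?L V" unfolding VF using s by (intro Bochner_Integration.integrable_sum) auto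
  have "integral\<^sup>L ?L V = (\<Sum>ij\<in>I. integral\<^sup>L ?L (\<lambda>Y. (\<Sum>l<n. f (fst ij) (snd ij) (Y l))\<^sup>2))"
    unfolding VF using s by (intro Bochner_Integration.integral_sum) auto
  also have "\<dots> \<le> (\<Sum>ij\<in>I. real n * (3 * \<kappa>\<^sup>2))" by (intro sum_mono s)
  finally have eV: "integral\<^sup>L ?L V \<le> real (card I) * real n * (3 * \<kappa>\<^sup>2)" by simp
  have [measurable]: "V \<in> borel_measurable ?L" using iV by simp
  show "{Y \<in> space ?L. t \<le> V Y} \<in> sets ?L" by measurable
  have "measure ?L {Y \<in> space ?L. t \<le> V Y} \<le> integral\<^sup>L ?L V / t"
    by (rule integral_Markov_inequality_measure[OF iV sets.top])
       (auto simp: V_def sum_nonneg t case_prod_beta)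
  also have "\<dots> \<le> real (card I) * real n * (3 * \<kappa>\<^sup>2) / t"
    using eV t by (intro divide_right_mono) auto
  finally show "measure ?L {Y \<in> space ?L. t \<le> V Y} \<le> real (card I) * real n * (3 * \<kappa>\<^sup>2) / t" .
qed

section \<open>Log-concavity and the dilation argument\<close>

lemma ln_det_le_tangent:
  assumes B: "sym_pd p B" and W: "whitening p C U A"
  shows "ln (fdet p B) \<le> ln (fdet p C) + (\<Sum>i<p. \<Sum>j<p. (\<Sum>k<p. A i k * A j k) * (B i j - C i j))"
proof -
  \<comment> \<open>Any operator bound will do, because the slack \<delta>^2 is dropped.\<close>
  have bd: "(\<Sum>i<p. (\<Sum>k<p. U k i * x k)\<^sup>2) \<le> (\<Sum>i<p. \<Sum>k<p. (U k i)\<^sup>2) * (\<Sum>i<p. (x i)\<^sup>2)" for x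
    by (subst sum_distrib_right) (intro sum_mono Cauchy_Schwarz_ineq_sum)
  obtain \<delta> where "ln (fdet p B) \<le> ln (fdet p C)
      + (\<Sum>i<p. \<Sum>j<p. (\<Sum>k<p. A i k * A j k) * (B i j - C i j)) - \<delta>\<^sup>2"
    by (rule ln_det_le_supporting[OF B W _ bd]) (auto simp: sum_nonneg)
  then show ?thesis using zero_le_power2[of \<delta>] by linarith
qed

lemma sym_pd_convex:
  assumes X: "sym_pd p X" and Y: "sym_pd p Y" and t: "0 \<le> t" "t \<le> 1"
  shows "sym_pd p (\<lambda>i j. (1 - t) * X i j + t * Y i j)"
  unfolding sym_pd_def
proof (intro conjI allI impI)
  fix i j assume "i < p" "j < p"
  then show "(1 - t) * X i j + t * Y i j = (1 - t) * X j i + t * Y j i"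
    using X Y by (simp add: sym_pd_def)
next
  fix x :: "nat \<Rightarrow> real" assume "\<exists>i<p. x i \<noteq> 0"
  then have pos: "0 < qform p X x" "0 < qform p Y x" using X Y by (auto simp: sym_pd_def)
  have "qform p (\<lambda>i j. (1 - t) * X i j + t * Y i j) x = (1 - t) * qform p X x + t * qform p Y x"
    unfolding qform_def sum_distrib_left sum.distrib[symmetric]
    by (intro sum.cong refl) (simp add: algebra_simps)
  also have "\<dots> > 0"
  proof (cases "t = 0")
    case False
    then have "0 < t * qform p Y x" "0 \<le> (1 - t) * qform p X x" using t pos by auto
    then show ?thesis by linarith
  qed (use pos in simp)
  finally show "0 < qform p (\<lambda>i j. (1 - t) * X i j + t * Y i j) x" .
qed

text \<open>The tangent at the convex combination Z dominates ln det at both end points, and the two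
  linear terms cancel when weighted by 1 - t and t.\<close>

lemma ln_det_concave:
  assumes X: "sym_pd p X" and Y: "sym_pd p Y" and t: "0 \<le> t" "t \<le> 1"
  shows "(1 - t) * ln (fdet p X) + t * ln (fdet p Y) \<le> ln (fdet p (\<lambda>i j. (1 - t) * X i j + t * Y i j))"
proof -
  define Z where "Z = (\<lambda>i j. (1 - t) * X i j + t * Y i j)"
  obtain U A where W: "whitening p Z U A"
    using sym_pd_whitening[OF sym_pd_convex[OF assms]] unfolding Z_def by blast
  define T where "T B = (\<Sum>i<p. \<Sum>j<p. (\<Sum>k<p. A i k * A j k) * (B i j - Z i j))" for B
  have le: "ln (fdet p X) \<le> ln (fdet p Z) + T X" "ln (fdet p Y) \<le> ln (fdet p Z) + T Y"
    unfolding T_def using X Y W by (auto intro: ln_det_le_tangent)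
  have 0: "(1 - t) * T X + t * T Y = 0"
  proof -
    have "(1 - t) * T X + t * T Y = (\<Sum>i<p. \<Sum>j<p. (\<Sum>k<p. A i k * A j k) *
        ((1 - t) * (X i j - Z i j) + t * (Y i j - Z i j)))"
      unfolding T_def sum_distrib_left sum.distrib[symmetric]
      by (intro sum.cong refl) (simp add: algebra_simps)
    also have "\<dots> = (\<Sum>i<p. \<Sum>j<p. 0)"
      by (intro sum.cong refl) (simp add: Z_def algebra_simps)
    finally show ?thesis by simp
  qed
  have "(1 - t) * ln (fdet p X) + t * ln (fdet p Y)
      \<le> (1 - t) * (ln (fdet p Z) + T X) + t * (ln (fdet p Z) + T Y)"
    using t by (intro add_mono mult_left_mono le) auto
  also have "\<dots> = ln (fdet p Z) + ((1 - t) * T X + t * T Y)" by (simp add: algebra_simps)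
  finally show ?thesis by (simp add: 0 Z_def)
qed

text \<open>The log posterior density for a fixed graph up to an additive constant, with \<alpha> =
  (\<beta> + n) / 2 and Q = Psi plus the sum of the Y_l Y_l^T (see
  \<open>gwish_likelihood_eq_exp\<close>).\<close>

definition log_kernel :: "nat \<Rightarrow> real \<Rightarrow> (nat \<Rightarrow> nat \<Rightarrow> real) \<Rightarrow> (nat \<Rightarrow> nat \<Rightarrow> real) \<Rightarrow> real" where
  "log_kernel p \<alpha> Q M = \<alpha> * ln (fdet p M) - (\<Sum>i<p. \<Sum>j<p. Q i j * M i j) / 2"

lemma log_kernel_concave:
  assumes "sym_pd p X" "sym_pd p Y" "0 \<le> t" "t \<le> 1" and \<alpha>: "0 \<le> \<alpha>"
  shows "(1 - t) * log_kernel p \<alpha> Q X + t * log_kernel p \<alpha> Q Y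
    \<le> log_kernel p \<alpha> Q (\<lambda>i j. (1 - t) * X i j + t * Y i j)"
proof -
  have lin: "(\<Sum>i<p. \<Sum>j<p. Q i j * ((1 - t) * X i j + t * Y i j))
      = (1 - t) * (\<Sum>i<p. \<Sum>j<p. Q i j * X i j) + t * (\<Sum>i<p. \<Sum>j<p. Q i j * Y i j)"
    unfolding sum_distrib_left sum.distrib[symmetric]
    by (intro sum.cong refl) (simp add: algebra_simps)
  show ?thesis
    using mult_left_mono[OF ln_det_concave[OF assms(1-4)] \<alpha>]
    unfolding log_kernel_def lin by (simp add: algebra_simps add_divide_distrib diff_divide_distrib)
qed

text \<open>Converts the slack \<delta>^2 into the distance \<rho> <= K (\<delta>^2 + 2 \<delta>).
  For \<delta> <= 1 this gives \<rho> <= 3 K \<delta>; for larger \<delta> the cap \<rho> <= 3 K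
  gives the same. Hence \<delta>^2 >= \<rho>^2 / (9 K^2).\<close>

lemma ln_det_quadratic_bound:
  assumes B: "sym_pd p B" and W: "whitening p M0 U A" and K: "1 \<le> K"
    and op: "\<And>x. qform p M0 x \<le> K * (\<Sum>i<p. (x i)\<^sup>2)"
    and \<rho>: "fnorm p (\<lambda>i j. B i j - M0 i j) = \<rho>" "\<rho> \<le> 3 * K"
  shows "ln (fdet p B) \<le> ln (fdet p M0)
    + (\<Sum>i<p. \<Sum>j<p. (\<Sum>k<p. A i k * A j k) * (B i j - M0 i j)) - \<rho>\<^sup>2 / (9 * K\<^sup>2)"
proof -
  have "(\<Sum>i<p. (\<Sum>k<p. U k i * x k)\<^sup>2) \<le> K * (\<Sum>i<p. (x i)\<^sup>2)" for x
    using op[of x] by (simp add: qform_whitening[OF W])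
  then obtain \<delta> where \<delta>: "0 \<le> \<delta>" "ln (fdet p B) \<le> ln (fdet p M0)
      + (\<Sum>i<p. \<Sum>j<p. (\<Sum>k<p. A i k * A j k) * (B i j - M0 i j)) - \<delta>\<^sup>2"
    "\<rho> \<le> K * (\<delta>\<^sup>2 + 2 * \<delta>)"
    using ln_det_le_supporting[OF B W, of K] K unfolding \<rho>(1) by force
  have "0 \<le> \<rho>" using \<rho>(1) fnorm_nonneg by metis
  have "\<rho> \<le> 3 * K * \<delta>"
  proof (cases "\<delta> \<le> 1")
    case True
    then have "\<delta>\<^sup>2 + 2 * \<delta> \<le> 3 * \<delta>" using \<delta>(1) by (simp add: power2_eq_square mult_left_le)
    then have "K * (\<delta>\<^sup>2 + 2 * \<delta>) \<le> K * (3 * \<delta>)" using K by (intro mult_left_mono) auto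
    then show ?thesis using \<delta>(3) by (simp add: mult_ac)
  next
    case False
    then have "3 * K * 1 \<le> 3 * K * \<delta>" using K by (intro mult_left_mono) auto
    then show ?thesis using \<rho>(2) by simp
  qed
  then have "\<rho>\<^sup>2 \<le> (3 * K * \<delta>)\<^sup>2" using \<open>0 \<le> \<rho>\<close> by (rule power_mono)
  then have "\<rho>\<^sup>2 / (9 * K\<^sup>2) \<le> \<delta>\<^sup>2" using K by (simp add: divide_le_eq power_mult_distrib mult_ac)
  then show ?thesis using \<delta>(2) by linarith
qed

text \<open>The matrix 2 \<alpha> A A^T - Q is twice the gradient of the log kernel at M0. As B - M0
  is supported on I, Cauchy-Schwarz involves only the gradient entries in I; this is where sparsity
  of the graph enters.\<close>

lemma log_kernel_drop:
  assumes B: "sym_pd p B" and W: "whitening p M0 U A" and K: "1 \<le> K"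
    and op: "\<And>x. qform p M0 x \<le> K * (\<Sum>i<p. (x i)\<^sup>2)"
    and \<rho>: "fnorm p (\<lambda>i j. B i j - M0 i j) = \<rho>" "\<rho> \<le> 3 * K"
    and \<alpha>: "0 \<le> \<alpha>"
    and I: "I \<subseteq> {..<p} \<times> {..<p}"
    and supp: "\<And>i j. i < p \<Longrightarrow> j < p \<Longrightarrow> (i,j) \<notin> I \<Longrightarrow> B i j = M0 i j"
    and h: "0 \<le> h" "(\<Sum>(i,j)\<in>I. (2 * \<alpha> * (\<Sum>k<p. A i k * A j k) - Q i j)\<^sup>2) \<le> h\<^sup>2"
  shows "log_kernel p \<alpha> Q B \<le> log_kernel p \<alpha> Q M0 - (\<alpha> * \<rho>\<^sup>2 / (9 * K\<^sup>2) - h * \<rho> / 2)"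
proof -
  define S where "S i j = (\<Sum>k<p. A i k * A j k)" for i j
  define D where "D i j = B i j - M0 i j" for i j
  define H where "H i j = 2 * \<alpha> * S i j - Q i j" for i j
  have fin: "finite I" using I by (rule finite_subset) auto
  have "0 \<le> \<rho>" using \<rho>(1) fnorm_nonneg by metis
  have restr: "(\<Sum>i<p. \<Sum>j<p. X i j) = (\<Sum>(i,j)\<in>I. X i j)"
    if "\<And>i j. i < p \<Longrightarrow> j < p \<Longrightarrow> (i,j) \<notin> I \<Longrightarrow> X i j = 0" for X :: "nat \<Rightarrow> nat \<Rightarrow> real"
    unfolding sum.cartesian_product using I that by (intro sum.mono_neutral_right) auto
  have D0: "D i j = 0" if "i < p" "j < p" "(i,j) \<notin> I" for i j using supp[OF that] by (simp add: D_def)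
  have D2: "(\<Sum>(i,j)\<in>I. (D i j)\<^sup>2) = \<rho>\<^sup>2"
  proof -
    have "fnorm p D = \<rho>" using \<rho>(1) by (simp add: D_def[abs_def])
    then show ?thesis
      using restr[of "\<lambda>i j. (D i j)\<^sup>2"] D0 fnorm_power2[of p D] by simp
  qed
  have "(\<Sum>(i,j)\<in>I. H i j * D i j)\<^sup>2 \<le> (\<Sum>(i,j)\<in>I. (H i j)\<^sup>2) * (\<Sum>(i,j)\<in>I. (D i j)\<^sup>2)"
    using Cauchy_Schwarz_ineq_sum[of "\<lambda>(i,j). H i j" "\<lambda>(i,j). D i j" I]
    by (simp add: case_prod_beta)
  also have "\<dots> \<le> h\<^sup>2 * \<rho>\<^sup>2"
    unfolding D2 using h(2) by (intro mult_right_mono) (auto simp: H_def S_def)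
  finally have "(\<Sum>(i,j)\<in>I. H i j * D i j)\<^sup>2 \<le> (h * \<rho>)\<^sup>2" by (simp add: power_mult_distrib)
  then have HD: "(\<Sum>(i,j)\<in>I. H i j * D i j) \<le> h * \<rho>"
    by (rule power2_le_imp_le) (simp add: h(1) \<open>0 \<le> \<rho>\<close>)
  have HD': "(\<Sum>(i,j)\<in>I. H i j * D i j) = (\<Sum>i<p. \<Sum>j<p. H i j * D i j)"
    using restr[of "\<lambda>i j. H i j * D i j"] D0 by simp
  have "\<alpha> * ln (fdet p B) \<le> \<alpha> * (ln (fdet p M0) + (\<Sum>i<p. \<Sum>j<p. S i j * D i j) - \<rho>\<^sup>2 / (9 * K\<^sup>2))"
    unfolding S_def D_def by (intro mult_left_mono ln_det_quadratic_bound[OF B W K op \<rho>] \<alpha>)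
  moreover have "(\<Sum>i<p. \<Sum>j<p. H i j * D i j) = 2 * \<alpha> * (\<Sum>i<p. \<Sum>j<p. S i j * D i j)
      - (\<Sum>i<p. \<Sum>j<p. Q i j * B i j) + (\<Sum>i<p. \<Sum>j<p. Q i j * M0 i j)"
    unfolding H_def D_def sum_distrib_left sum_subtractf[symmetric] sum.distrib[symmetric]
    by (intro sum.cong refl) (simp add: algebra_simps)
  ultimately show ?thesis
    using HD HD' unfolding log_kernel_def by (simp add: algebra_simps)
qed

text \<open>Concavity along the ray from M0 through M1 transports the drop at distance \<rho> from M0
  to a drop between the midpoint and M1.\<close>

lemma log_kernel_midpoint_drop:
  assumes M1: "sym_pd p M1" and M0: "sym_pd p M0" and W: "whitening p M0 U A" and K: "1 \<le> K"
    and op: "\<And>x. qform p M0 x \<le> K * (\<Sum>i<p. (x i)\<^sup>2)"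
    and \<rho>: "0 < \<rho>" "2 * \<rho> < fnorm p (\<lambda>i j. M1 i j - M0 i j)" "\<rho> \<le> 3 * K"
    and \<alpha>: "0 \<le> \<alpha>"
    and I: "I \<subseteq> {..<p} \<times> {..<p}"
    and supp: "\<And>i j. i < p \<Longrightarrow> j < p \<Longrightarrow> (i,j) \<notin> I \<Longrightarrow> M1 i j = M0 i j"
    and h: "0 \<le> h" "(\<Sum>(i,j)\<in>I. (2 * \<alpha> * (\<Sum>k<p. A i k * A j k) - Q i j)\<^sup>2) \<le> h\<^sup>2"
    and \<kappa>: "0 \<le> \<kappa>" "\<kappa> \<le> \<alpha> * \<rho>\<^sup>2 / (9 * K\<^sup>2) - h * \<rho> / 2"
  shows "log_kernel p \<alpha> Q M1 \<le> log_kernel p \<alpha> Q (\<lambda>i j. (M0 i j + M1 i j) / 2) - \<kappa>"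
proof -
  let ?g = "log_kernel p \<alpha> Q"
  define N where "N = fnorm p (\<lambda>i j. M1 i j - M0 i j)"
  \<comment> \<open>The point B = M0 + u (M1 - M0) is at distance exactly \<rho> from M0. Since 2
    \<rho> < N, it lies between M0 and Mid, with weight 2 u <= 1 on Mid.\<close>
  define u where "u = \<rho> / N"
  have u: "0 < u" "2 * u \<le> 1" using \<rho> by (auto simp: u_def N_def)
  define Mid where "Mid = (\<lambda>i j. (M0 i j + M1 i j) / 2)"
  define B where "B = (\<lambda>i j. (1 - u) * M0 i j + u * M1 i j)"
  have mid: "Mid = (\<lambda>i j. (1 - 1/2) * M0 i j + (1/2) * M1 i j)" by (simp add: Mid_def fun_eq_iff field_simps)
  have Mid: "sym_pd p Mid" unfolding mid by (rule sym_pd_convex[OF M0 M1]) auto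
  have B2: "B = (\<lambda>i j. (1 - 2 * u) * M0 i j + (2 * u) * Mid i j)"
    by (simp add: B_def Mid_def fun_eq_iff field_simps)
  have pdB: "sym_pd p B" unfolding B_def using u by (intro sym_pd_convex[OF M0 M1]) auto
  have "fnorm p (\<lambda>i j. B i j - M0 i j) = sqrt (u\<^sup>2 * (\<Sum>i<p. \<Sum>j<p. (M1 i j - M0 i j)\<^sup>2))"
    unfolding fnorm_def sum_distrib_left
    by (intro arg_cong[where f=sqrt] sum.cong refl) (simp add: B_def power_mult_distrib[symmetric] algebra_simps)
  also have "\<dots> = u * N" using u by (simp add: real_sqrt_mult N_def fnorm_def)
  also have "\<dots> = \<rho>" using \<rho> by (simp add: u_def N_def)
  finally have nB: "fnorm p (\<lambda>i j. B i j - M0 i j) = \<rho>" .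
  have suppB: "B i j = M0 i j" if "i < p" "j < p" "(i,j) \<notin> I" for i j
    using supp[OF that] by (simp add: B_def algebra_simps)
  have 1: "?g B \<le> ?g M0 - \<kappa>"
    using log_kernel_drop[OF pdB W K op nB \<rho>(3) \<alpha> I suppB h] \<kappa>(2) by linarith
  have 2: "(1 - 2 * u) * ?g M0 + 2 * u * ?g Mid \<le> ?g B"
    unfolding B2 using u \<alpha> by (intro log_kernel_concave[OF M0 Mid]) auto
  have 3: "(1 - 1/2) * ?g M0 + (1/2) * ?g M1 \<le> ?g Mid"
    unfolding mid by (intro log_kernel_concave[OF M0 M1]) (use \<alpha> in auto)
  \<comment> \<open>Slopes decrease along the ray: the drop \<kappa> over the piece from M0 to B
    forces at least \<kappa> from M0 to Mid, and then at least as much again from Mid to M1.\<close>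
  have "2 * u * (?g Mid - ?g M0) \<le> - \<kappa>" using 1 2 by (simp add: algebra_simps)
  also have "- \<kappa> \<le> 2 * u * (- \<kappa>)" using mult_right_mono[OF u(2) \<kappa>(1)] by simp
  finally have "?g Mid - ?g M0 \<le> - \<kappa>"
    by (rule mult_left_le_imp_le) (use u(1) in simp)
  with 3 show ?thesis unfolding Mid_def[symmetric] by (simp add: algebra_simps)
qed

text \<open>The same Fubini induction as in \<open>nn_integral_triangular\<close>, now over an
  arbitrary finite index set, since the coordinates of M_G are indexed by pairs.\<close>

lemma nn_integral_PiM_affine:
  fixes t :: "'i \<Rightarrow> real"
  assumes "finite I" and c: "0 < c" and "f \<in> borel_measurable (PiM I (\<lambda>_. lborel))"
  shows "(\<integral>\<^sup>+ x. f x \<partial>PiM I (\<lambda>_. lborel)) =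
    ennreal (c ^ card I) * (\<integral>\<^sup>+ x. f (\<lambda>i\<in>I. t i + c * x i) \<partial>PiM I (\<lambda>_. lborel))"
  using assms(1,3)
proof (induction I arbitrary: f rule: finite_induct)
  case empty
  have "(\<lambda>i\<in>{}. t i + c * x i) = x" if "x \<in> space (PiM {} (\<lambda>_. lborel))" for x
    using that by (auto simp: space_PiM)
  then have "(\<integral>\<^sup>+ x. f (\<lambda>i\<in>{}. t i + c * x i) \<partial>PiM {} (\<lambda>_. lborel)) = (\<integral>\<^sup>+ x. f x \<partial>PiM {} (\<lambda>_. lborel))"
    by (intro nn_integral_cong) simp
  then show ?case by (simp only: card.empty power_0 ennreal_1 mult_1)
next
  case (insert k I)
  note f [measurable] = insert.prems
  let ?P = "PiM I (\<lambda>_. lborel :: real measure)"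
  define g where "g x = f (\<lambda>i\<in>insert k I. t i + c * x i)" for x
  have g [measurable]: "g \<in> borel_measurable (PiM (insert k I) (\<lambda>_. lborel))"
    unfolding g_def by measurable
  define F where "F x = (\<integral>\<^sup>+ y. f (x(k := y)) \<partial>lborel)" for x
  have [measurable]: "F \<in> borel_measurable ?P"
    unfolding F_def by measurable
  have [measurable]: "(\<lambda>y. f ((\<lambda>i\<in>I. t i + c * x i)(k := y))) \<in> borel_measurable borel" for x
  proof -
    have "(\<lambda>i\<in>I. t i + c * x i) \<in> space ?P" by (simp add: space_PiM)
    then show ?thesis by measurable
  qed
  have upd: "(\<lambda>i\<in>I. t i + c * x i)(k := t k + c * y) = (\<lambda>i\<in>insert k I. t i + c * (x(k := y)) i)" for x y
    using insert.hyps by (auto simp: fun_eq_iff)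
  have "(\<integral>\<^sup>+ x. f x \<partial>PiM (insert k I) (\<lambda>_. lborel)) = (\<integral>\<^sup>+ x. F x \<partial>?P)"
    unfolding F_def by (intro lborel_prod.product_nn_integral_insert f insert.hyps)
  also have "\<dots> = ennreal (c ^ card I) * (\<integral>\<^sup>+ x. F (\<lambda>i\<in>I. t i + c * x i) \<partial>?P)"
    by (rule insert.IH) measurable
  also have "(\<integral>\<^sup>+ x. F (\<lambda>i\<in>I. t i + c * x i) \<partial>?P) =
      (\<integral>\<^sup>+ x. ennreal c * (\<integral>\<^sup>+ y. g (x(k := y)) \<partial>lborel) \<partial>?P)"
  proof (intro nn_integral_cong)
    fix x
    show "F (\<lambda>i\<in>I. t i + c * x i) = ennreal c * (\<integral>\<^sup>+ y. g (x(k := y)) \<partial>lborel)"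
      unfolding F_def g_def upd[symmetric] using c
      by (subst nn_integral_real_affine[where c=c and t="t k"]) auto
  qed
  also have "\<dots> = ennreal c * (\<integral>\<^sup>+ x. (\<integral>\<^sup>+ y. g (x(k := y)) \<partial>lborel) \<partial>?P)"
    by (intro nn_integral_cmult) measurable
  also have "(\<integral>\<^sup>+ x. (\<integral>\<^sup>+ y. g (x(k := y)) \<partial>lborel) \<partial>?P) = (\<integral>\<^sup>+ x. g x \<partial>PiM (insert k I) (\<lambda>_. lborel))"
    by (intro lborel_prod.product_nn_integral_insert[symmetric] g insert.hyps)
  also have "ennreal (c ^ card I) * (ennreal c * (\<integral>\<^sup>+ x. g x \<partial>PiM (insert k I) (\<lambda>_. lborel)))
      = ennreal (c ^ card (insert k I)) * (\<integral>\<^sup>+ x. g x \<partial>PiM (insert k I) (\<lambda>_. lborel))"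
    using c insert.hyps by (simp add: mult.assoc[symmetric] ennreal_mult mult.commute)
  finally show ?case unfolding g_def .
qed

section \<open>Coordinates on M_G, measurability of the integrands and the dilation\<close>

lemma finite_free_coords:
  assumes "is_graph p E"
  shows "finite (free_coords p E)" "card (free_coords p E) = p + card E" "finite E"
    "free_coords p E \<subseteq> {..<p} \<times> {..<p}"
proof -
  have E: "E \<subseteq> graph_pairs p" using assms by (simp add: is_graph_def)
  have "graph_pairs p \<subseteq> {..<p} \<times> {..<p}" by (auto simp: graph_pairs_def)
  with E show fE: "finite E" by (meson finite_SigmaI finite_lessThan finite_subset)
  have d: "{(i,i) | i. i < p} = (\<lambda>i. (i,i)) ` {..<p}" by auto
  have "{(i,i) | i. i < p} \<inter> E = {}" using E by (auto simp: graph_pairs_def)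
  moreover have "card {(i,i) | i. i < p} = p" unfolding d by (subst card_image) (auto simp: inj_on_def)
  ultimately show "finite (free_coords p E)" "card (free_coords p E) = p + card E"
    unfolding free_coords_def using fE by (auto simp: card_Un_disjoint d)
  show "free_coords p E \<subseteq> {..<p} \<times> {..<p}"
    using E by (auto simp: free_coords_def graph_pairs_def)
qed

lemma coord_mat_carrier [simp]: "coord_mat p E w \<in> carrier_mat p p"
  by (simp add: coord_mat_def)

lemma coord_mat_index:
  "i < p \<Longrightarrow> j < p \<Longrightarrow> coord_mat p E w $$ (i,j) =
    (if (min i j, max i j) \<in> free_coords p E then w (min i j, max i j) else 0)"
  by (simp add: coord_mat_def)

lemma in_PG_coord_mat:
  "in_PG p E (coord_mat p E w) \<longleftrightarrow> sym_pd p (entries (coord_mat p E w))"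
proof -
  have "in_MG p E (coord_mat p E w)"
    unfolding in_MG_def symmetric_mat_iff[OF coord_mat_carrier]
    by (auto simp: coord_mat_index min.commute max.commute free_coords_def adj_def)
  then show ?thesis unfolding in_PG_def by (simp add: pos_def_iff_sym_pd)
qed

lemma measurable_coord_mat_index:
  assumes "i < p" "j < p"
  shows "(\<lambda>w. coord_mat p E w $$ (i,j)) \<in> borel_measurable (leb_MG p E)"
proof (cases "(min i j, max i j) \<in> free_coords p E")
  case True
  then show ?thesis
    unfolding coord_mat_index[OF assms] leb_MG_def by simp
next
  case False
  then show ?thesis unfolding coord_mat_index[OF assms] by simp
qed

lemma measurable_det:
  fixes B :: "'a \<Rightarrow> real mat"
  assumes "\<And>w. B w \<in> carrier_mat p p" and "\<And>i j. i < p \<Longrightarrow> j < p \<Longrightarrow> (\<lambda>w. B w $$ (i,j)) \<in> borel_measurable M"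
  shows "(\<lambda>w. det (B w)) \<in> borel_measurable M"
  unfolding det_def'[OF assms(1)]
proof (intro borel_measurable_sum borel_measurable_times borel_measurable_const borel_measurable_prod)
  fix \<sigma> i assume "\<sigma> \<in> {\<sigma>. \<sigma> permutes {0..<p}}" "i \<in> {0..<p}"
  then have "i < p" "\<sigma> i < p" using permutes_in_image[of \<sigma> "{0..<p}" i] by auto
  then show "(\<lambda>w. B w $$ (i, \<sigma> i)) \<in> borel_measurable M" by (rule assms(2))
qed


lemma trace_mult:
  assumes \<Psi>: "\<Psi> \<in> carrier_mat p p" and \<Omega>: "\<Omega> \<in> carrier_mat p p"
  shows "trace_mat p (\<Psi> * \<Omega>) = (\<Sum>i<p. \<Sum>k<p. \<Psi> $$ (i,k) * \<Omega> $$ (k,i))"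
  unfolding trace_mat_def using \<Psi> \<Omega>
  by (intro sum.cong refl) (auto simp: scalar_prod_def atLeast0LessThan)

text \<open>Prior and likelihood merge into one exponent because each Gaussian exponent is linear in
  Omega: it pairs Omega entrywise with Y_l Y_l^T, just as the trace pairs it with Psi.\<close>

lemma gwish_likelihood_eq_exp:
  assumes \<Psi>: "\<Psi> \<in> carrier_mat p p" and \<Omega>: "\<Omega> \<in> carrier_mat p p" and pd: "sym_pd p (entries \<Omega>)"
  shows "gwish_kernel p \<beta> \<Psi> \<Omega> * likelihood n p \<Omega> Y =
    exp (real n * ln ((2 * pi) powr (- real p / 2)) +
      log_kernel p ((\<beta> + real n) / 2) (\<lambda>i j. \<Psi> $$ (i,j) + (\<Sum>l<n. Y l i * Y l j)) (entries \<Omega>))"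
proof -
  define d where "d = det \<Omega>"
  define c where "c = (2 * pi) powr (- real p / 2)"
  define q where "q l = (\<Sum>i<p. \<Sum>j<p. Y l i * \<Omega> $$ (i,j) * Y l j)" for l
  define \<tau> where "\<tau> = (\<Sum>i<p. \<Sum>j<p. \<Psi> $$ (i,j) * \<Omega> $$ (i,j))"
  have fd: "fdet p (entries \<Omega>) = d" by (simp add: d_def fn_mat_entries[OF \<Omega>])
  then have d: "0 < d" using sym_pd_fdet_pos[OF pd] by simp
  have c: "0 < c" by (simp add: c_def)
  have sym: "\<Omega> $$ (i,j) = \<Omega> $$ (j,i)" if "i < p" "j < p" for i j
    using pd that unfolding sym_pd_def by blast
  have "trace_mat p (\<Psi> * \<Omega>) = \<tau>"
    unfolding trace_mult[OF \<Psi> \<Omega>] \<tau>_def by (intro sum.cong refl) (simp add: sym)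
  then have g: "gwish_kernel p \<beta> \<Psi> \<Omega> = exp (\<beta> / 2 * ln d - \<tau> / 2)"
    using d by (simp add: gwish_kernel_def d_def[symmetric] powr_def mult_exp_exp)
  have "gauss_dens p \<Omega> (Y l) = exp (ln c + ln d / 2 - q l / 2)" for l
  proof -
    have "sqrt d = exp (ln d / 2)"
      using d by (simp add: powr_half_sqrt[symmetric] powr_def)
    moreover have "gauss_dens p \<Omega> (Y l) = c * sqrt d * exp (- q l / 2)"
      by (simp add: gauss_dens_def d_def c_def q_def)
    ultimately have "gauss_dens p \<Omega> (Y l) = exp (ln c) * exp (ln d / 2) * exp (- q l / 2)"
      using c by simp
    then show ?thesis by (simp add: mult_exp_exp)
  qed
  then have "likelihood n p \<Omega> Y = exp (\<Sum>l<n. ln c + ln d / 2 - q l / 2)"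
    unfolding likelihood_def by (simp add: exp_sum)
  also have "(\<Sum>l<n. ln c + ln d / 2 - q l / 2) = real n * ln c + real n / 2 * ln d - (\<Sum>l<n. q l) / 2"
    by (simp add: sum.distrib sum_subtractf sum_divide_distrib algebra_simps)
  finally have l: "likelihood n p \<Omega> Y = exp (real n * ln c + real n / 2 * ln d - (\<Sum>l<n. q l) / 2)" .
  have "(\<Sum>l<n. q l) = (\<Sum>i<p. \<Sum>j<p. (\<Sum>l<n. Y l i * Y l j) * \<Omega> $$ (i,j))"
  proof -
    have "(\<Sum>l<n. q l) = (\<Sum>i<p. \<Sum>l<n. \<Sum>j<p. Y l i * \<Omega> $$ (i,j) * Y l j)"
      unfolding q_def by (rule sum.swap)
    also have "\<dots> = (\<Sum>i<p. \<Sum>j<p. \<Sum>l<n. Y l i * \<Omega> $$ (i,j) * Y l j)"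
      by (intro sum.cong refl sum.swap)
    also have "\<dots> = (\<Sum>i<p. \<Sum>j<p. (\<Sum>l<n. Y l i * Y l j) * \<Omega> $$ (i,j))"
      unfolding sum_distrib_right by (simp add: mult_ac)
    finally show ?thesis .
  qed
  then have Q: "(\<Sum>i<p. \<Sum>j<p. (\<Psi> $$ (i,j) + (\<Sum>l<n. Y l i * Y l j)) * \<Omega> $$ (i,j)) = \<tau> + (\<Sum>l<n. q l)"
    by (simp add: \<tau>_def distrib_right sum.distrib)
  show ?thesis
    unfolding g l log_kernel_def Q fd exp_add[symmetric] c_def[symmetric]
    by (simp add: field_simps)
qed

lemma measurable_gwish_kernel:
  assumes \<Psi>: "\<Psi> \<in> carrier_mat p p"
  shows "(\<lambda>w. gwish_kernel p \<beta> \<Psi> (coord_mat p E w)) \<in> borel_measurable (leb_MG p E)"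
proof -
  have [measurable]: "(\<lambda>w. det (coord_mat p E w)) \<in> borel_measurable (leb_MG p E)"
    by (rule measurable_det[where p=p]) (auto intro: measurable_coord_mat_index)
  have "(\<lambda>w. \<Sum>i<p. \<Sum>k<p. \<Psi> $$ (i,k) * coord_mat p E w $$ (k,i)) \<in> borel_measurable (leb_MG p E)"
    by (intro borel_measurable_sum borel_measurable_times borel_measurable_const measurable_coord_mat_index) auto
  then have [measurable]: "(\<lambda>w. trace_mat p (\<Psi> * coord_mat p E w)) \<in> borel_measurable (leb_MG p E)"
    by (simp add: trace_mult[OF \<Psi> coord_mat_carrier])
  show ?thesis unfolding gwish_kernel_def by measurable
qed

lemma measurable_likelihood:
  "(\<lambda>w. likelihood n p (coord_mat p E w) Y) \<in> borel_measurable (leb_MG p E)"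
proof -
  have [measurable]: "(\<lambda>w. det (coord_mat p E w)) \<in> borel_measurable (leb_MG p E)"
    by (rule measurable_det[where p=p]) (auto intro: measurable_coord_mat_index)
  have [measurable]: "(\<lambda>w. \<Sum>i<p. \<Sum>j<p. y i * coord_mat p E w $$ (i,j) * y j) \<in> borel_measurable (leb_MG p E)"
    for y :: "nat \<Rightarrow> real"
    by (intro borel_measurable_sum borel_measurable_times borel_measurable_const measurable_coord_mat_index) auto
  show ?thesis unfolding likelihood_def gauss_dens_def by measurable
qed

lemma frob_norm_eq_fnorm:
  assumes "A \<in> carrier_mat p p" "B \<in> carrier_mat p p"
  shows "frob_norm p (A - B) = fnorm p (\<lambda>i j. A $$ (i,j) - B $$ (i,j))"
  unfolding frob_norm_def fnorm_def using assms
  by (intro arg_cong[where f=sqrt] sum.cong refl) auto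

lemma pred_in_PG_coord_mat:
  "Measurable.pred (leb_MG p E) (\<lambda>w. in_PG p E (coord_mat p E w))"
  unfolding in_PG_coord_mat by (intro pred_sym_pd measurable_coord_mat_index)

lemma measurable_frob_norm_coord_mat:
  assumes "\<Omega>0 \<in> carrier_mat p p"
  shows "(\<lambda>w. frob_norm p (coord_mat p E w - \<Omega>0)) \<in> borel_measurable (leb_MG p E)"
proof -
  have "(\<lambda>w. \<Sum>i<p. \<Sum>j<p. (coord_mat p E w $$ (i,j) - \<Omega>0 $$ (i,j))\<^sup>2) \<in> borel_measurable (leb_MG p E)"
    by (intro borel_measurable_sum borel_measurable_power borel_measurable_diff borel_measurable_const
        measurable_coord_mat_index) auto
  then show ?thesis
    unfolding frob_norm_eq_fnorm[OF coord_mat_carrier assms] fnorm_def by measurable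
qed

text \<open>The substitution Omega \<mapsto> 2 * Omega - Omega0 on M_G has Jacobian 2 ^ (p + card E).\<close>

lemma marg_part_ratio:
  fixes Y :: "nat \<Rightarrow> nat \<Rightarrow> real" and n :: nat and \<beta> :: real
  assumes gr: "is_graph p E" and \<Psi>: "\<Psi> \<in> carrier_mat p p" and \<Omega>0: "in_PG p E \<Omega>0"
  defines "F \<equiv> \<lambda>\<Omega>. gwish_kernel p \<beta> \<Psi> \<Omega> * likelihood n p \<Omega> Y"
  assumes step: "\<And>\<Omega>1. in_PG p E \<Omega>1 \<Longrightarrow> R < frob_norm p (\<Omega>1 - \<Omega>0) \<Longrightarrow>
      F \<Omega>1 \<le> exp (- \<kappa>) * F (fn_mat p (\<lambda>i j. (\<Omega>0 $$ (i,j) + \<Omega>1 $$ (i,j)) / 2))"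
  shows "marg_part n p E \<beta> \<Psi> (\<lambda>\<Omega>. R < frob_norm p (\<Omega> - \<Omega>0)) Y
    \<le> ennreal (2 ^ (p + card E) * exp (- \<kappa>)) * marg_part n p E \<beta> \<Psi> (\<lambda>_. True) Y"
proof -
  let ?I = "free_coords p E" and ?L = "leb_MG p E"
  have \<Omega>0c: "\<Omega>0 \<in> carrier_mat p p" and \<Omega>0M: "in_MG p E \<Omega>0" and \<Omega>0s: "sym_pd p (entries \<Omega>0)"
    using \<Omega>0 pos_def_iff_sym_pd[of \<Omega>0 p] unfolding in_PG_def in_MG_def by auto
  note [measurable] = measurable_gwish_kernel[OF \<Psi>] measurable_likelihood pred_in_PG_coord_mat
    measurable_frob_norm_coord_mat[OF \<Omega>0c]
  define J where "J A w = indicator {w. in_PG p E (coord_mat p E w) \<and> A (coord_mat p E w)} w *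
       ennreal (gwish_kernel p \<beta> \<Psi> (coord_mat p E w)) * ennreal (likelihood n p (coord_mat p E w) Y)"
    for A w
  let ?A = "\<lambda>\<Omega>. R < frob_norm p (\<Omega> - \<Omega>0)"
  \<comment> \<open>The map Omega \<mapsto> 2 * Omega - Omega0 in free coordinates; the matrix of w
    is then the midpoint between Omega0 and the matrix of \<open>dbl w\<close>.\<close>
  define dbl where "dbl w = (\<lambda>i\<in>?I. - \<Omega>0 $$ i + 2 * w i)" for w
  have dbl: "coord_mat p E w = fn_mat p (\<lambda>i j. (\<Omega>0 $$ (i,j) + coord_mat p E (dbl w) $$ (i,j)) / 2)" for w
  proof (rule eq_matI)
    fix i j assume "i < dim_row (fn_mat p (\<lambda>i j. (\<Omega>0 $$ (i,j) + coord_mat p E (dbl w) $$ (i,j)) / 2))"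
      "j < dim_col (fn_mat p (\<lambda>i j. (\<Omega>0 $$ (i,j) + coord_mat p E (dbl w) $$ (i,j)) / 2))"
    then have ij: "i < p" "j < p" by (auto simp: fn_mat_def)
    have "\<Omega>0 $$ (i,j) = \<Omega>0 $$ (min i j, max i j)"
      using \<Omega>0s ij unfolding sym_pd_def by (metis max_def min_def)
    moreover have "\<Omega>0 $$ (i,j) = 0" if "(min i j, max i j) \<notin> ?I"
      using \<Omega>0M ij that unfolding in_MG_def free_coords_def adj_def by auto
    ultimately show "coord_mat p E w $$ (i,j) = fn_mat p (\<lambda>i j. (\<Omega>0 $$ (i,j) + coord_mat p E (dbl w) $$ (i,j)) / 2) $$ (i,j)"
      using ij by (auto simp: coord_mat_index dbl_def fn_mat_def)
  qed (auto simp: fn_mat_def coord_mat_def)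
  \<comment> \<open>Outside the cone or the tail the left side is 0. Otherwise the midpoint is
    positive definite by convexity, so w itself counts in the unrestricted integrand and
    \<open>step\<close> applies.\<close>
  have pt: "J ?A (dbl w) \<le> ennreal (exp (- \<kappa>)) * J (\<lambda>_. True) w" for w
  proof (cases "in_PG p E (coord_mat p E (dbl w)) \<and> ?A (coord_mat p E (dbl w))")
    case True
    let ?B = "coord_mat p E (dbl w)"
    have "sym_pd p (\<lambda>i j. (1 - 1/2) * \<Omega>0 $$ (i,j) + 1/2 * ?B $$ (i,j))"
      using True in_PG_coord_mat by (intro sym_pd_convex \<Omega>0s) auto
    also have "?this \<longleftrightarrow> sym_pd p (entries (coord_mat p E w))"
      by (subst (2) dbl, rule sym_pd_cong) (simp add: fn_mat_def)
    finally have pd: "sym_pd p (entries (coord_mat p E w))" .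
    have nn: "0 \<le> F \<Omega>" "ennreal (gwish_kernel p \<beta> \<Psi> \<Omega>) * ennreal (likelihood n p \<Omega> Y) = ennreal (F \<Omega>)"
      if "\<Omega> \<in> carrier_mat p p" "sym_pd p (entries \<Omega>)" for \<Omega>
    proof -
      show "0 \<le> F \<Omega>" unfolding F_def gwish_likelihood_eq_exp[OF \<Psi> that] by simp
      show "ennreal (gwish_kernel p \<beta> \<Psi> \<Omega>) * ennreal (likelihood n p \<Omega> Y) = ennreal (F \<Omega>)"
        unfolding F_def by (rule ennreal_mult'[symmetric]) (simp add: gwish_kernel_def)
    qed
    have "J ?A (dbl w) = ennreal (F ?B)"
      using True nn(2)[of ?B] in_PG_coord_mat by (simp add: J_def)
    also have "\<dots> \<le> ennreal (exp (- \<kappa>) * F (coord_mat p E w))"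
      using step[of ?B] True unfolding dbl[of w, symmetric] by (intro ennreal_leI) blast
    also have "\<dots> = ennreal (exp (- \<kappa>)) * J (\<lambda>_. True) w"
      using nn[OF coord_mat_carrier pd] pd in_PG_coord_mat by (simp add: J_def ennreal_mult)
    finally show ?thesis .
  qed (simp add: J_def)
  have mJ: "J A \<in> borel_measurable ?L" if "Measurable.pred ?L (\<lambda>w. A (coord_mat p E w))" for A
    using that unfolding J_def[abs_def] by measurable
  have "J ?A \<in> borel_measurable ?L" by (rule mJ) measurable
  then have "(\<integral>\<^sup>+ w. J ?A w \<partial>?L) = ennreal (2 ^ card ?I) * (\<integral>\<^sup>+ w. J ?A (dbl w) \<partial>?L)"
    using finite_free_coords(1)[OF gr] unfolding leb_MG_def dbl_def
    by (intro nn_integral_PiM_affine) auto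
  also have "\<dots> \<le> ennreal (2 ^ card ?I) * (\<integral>\<^sup>+ w. ennreal (exp (- \<kappa>)) * J (\<lambda>_. True) w \<partial>?L)"
    by (intro mult_left_mono nn_integral_mono pt) simp
  also have "(\<integral>\<^sup>+ w. ennreal (exp (- \<kappa>)) * J (\<lambda>_. True) w \<partial>?L) = ennreal (exp (- \<kappa>)) * (\<integral>\<^sup>+ w. J (\<lambda>_. True) w \<partial>?L)"
    by (intro nn_integral_cmult mJ) simp
  finally have "(\<integral>\<^sup>+ w. J ?A w \<partial>?L) \<le> ennreal (2 ^ (p + card E) * exp (- \<kappa>)) * (\<integral>\<^sup>+ w. J (\<lambda>_. True) w \<partial>?L)"
    by (simp add: finite_free_coords(2)[OF gr] ennreal_mult mult.assoc)
  \<comment> \<open>Monotonicity of division in \<open>ennreal\<close> holds for every divisor, so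
    nothing about \<open>gwish_const\<close> has to be known.\<close>
  then have "(\<integral>\<^sup>+ w. J ?A w \<partial>?L) / gwish_const p E \<beta> \<Psi>
      \<le> ennreal (2 ^ (p + card E) * exp (- \<kappa>)) * (\<integral>\<^sup>+ w. J (\<lambda>_. True) w \<partial>?L) / gwish_const p E \<beta> \<Psi>"
    by (rule divide_right_mono_ennreal)
  then show ?thesis
    unfolding marg_part_def J_def by (simp add: ennreal_times_divide)
qed

section \<open>Posterior contraction\<close>

lemma finite_decomp_graphs: "finite (decomp_graphs p)"
proof (rule finite_subset)
  show "decomp_graphs p \<subseteq> Pow (graph_pairs p)"
    by (auto simp: decomp_graphs_def decomposable_def is_graph_def)
  have "graph_pairs p \<subseteq> {..<p} \<times> {..<p}" by (auto simp: graph_pairs_def)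
  then have "finite (graph_pairs p)" by (rule finite_subset) simp
  then show "finite (Pow (graph_pairs p))" by simp
qed

lemma marg_part_mono: "marg_part n p E \<beta> \<Psi> A Y \<le> marg_part n p E \<beta> \<Psi> (\<lambda>_. True) Y"
  unfolding marg_part_def
  by (intro divide_right_mono_ennreal nn_integral_mono mult_right_mono) (auto simp: indicator_def)

text \<open>Split the mixture over graphs: the graph G contributes at most r times its posterior
  weight, and all other graphs together at most their total weight 1 -
  \<open>post_graph\<close>.\<close>

lemma post_prec_le:
  assumes G: "G \<in> decomp_graphs p" and r: "0 \<le> r"
    and ratio: "marg_part n p G \<beta> \<Psi> A Y \<le> ennreal r * marg_part n p G \<beta> \<Psi> (\<lambda>_. True) Y"
    and pos: "0 < post_graph n p \<beta> \<Psi> \<pi> Y G"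
  shows "post_prec n p \<beta> \<Psi> \<pi> Y A \<le> r + (1 - post_graph n p \<beta> \<Psi> \<pi> Y G)"
proof -
  define x where "x H = ennreal (\<pi> H) * marg_part n p H \<beta> \<Psi> (\<lambda>_. True) Y" for H
  define y where "y H = ennreal (\<pi> H) * marg_part n p H \<beta> \<Psi> A Y" for H
  let ?D = "decomp_graphs p"
  note fin = finite_decomp_graphs[of p]
  define T where "T = (\<Sum>H\<in>?D. x H)"
  have pg: "post_graph n p \<beta> \<Psi> \<pi> Y G = enn2real (x G / T)"
    by (simp add: post_graph_def x_def T_def)
  have pp: "post_prec n p \<beta> \<Psi> \<pi> Y A = enn2real ((\<Sum>H\<in>?D. y H) / T)"
    by (simp add: post_prec_def x_def y_def T_def)
  have yx: "y H \<le> x H" for H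
    unfolding x_def y_def by (intro mult_left_mono marg_part_mono) simp
  have yG: "y G \<le> ennreal r * x G"
    using mult_left_mono[OF ratio, of "ennreal (\<pi> G)"] by (simp add: x_def y_def mult_ac)
  have xT: "x H \<le> T" if "H \<in> ?D" for H
    unfolding T_def using that fin by (intro member_le_sum) auto
  \<comment> \<open>The default values help here: with total evidence infinite or 0 the quotient
    \<open>x G / T\<close> would convert to 0, so positivity of \<open>post_graph\<close> excludes
    both.\<close>
  have Tfin: "T \<noteq> \<infinity>"
  proof
    assume "T = \<infinity>"
    then show False using pos by (simp add: pg ennreal_divide_top)
  qed
  have T0: "T \<noteq> 0"
  proof
    assume "T = 0"
    then have "x G = 0" using xT[OF G] by simp
    then show False using pos by (simp add: pg)
  qed
  define X where "X H = enn2real (x H)" for H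
  have xX: "x H = ennreal (X H)" if "H \<in> ?D" for H
    using le_less_trans[OF xT[OF that], of \<infinity>] Tfin unfolding X_def
    by (simp add: less_top[symmetric])
  have X0: "0 \<le> X H" for H by (simp add: X_def)
  define S where "S = (\<Sum>H\<in>?D. X H)"
  have TS: "T = ennreal S" unfolding T_def S_def using xX X0 by (simp add: sum_ennreal)
  have S: "0 < S" using T0 unfolding TS by (simp add: ennreal_eq_0_iff)
  have pgX: "post_graph n p \<beta> \<Psi> \<pi> Y G = X G / S"
    unfolding pg TS xX[OF G] using S X0 by (simp add: divide_ennreal)
  have XG: "X G \<le> S" unfolding S_def using G fin X0 by (intro member_le_sum) auto
  have "(\<Sum>H\<in>?D. y H) = y G + (\<Sum>H\<in>?D - {G}. y H)" using G fin by (simp add: sum.remove)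
  also have "\<dots> \<le> ennreal r * x G + (\<Sum>H\<in>?D - {G}. x H)" by (intro add_mono yG sum_mono yx)
  also have "(\<Sum>H\<in>?D - {G}. x H) = ennreal (\<Sum>H\<in>?D - {G}. X H)"
    using xX X0 by (simp add: sum_ennreal)
  also have "(\<Sum>H\<in>?D - {G}. X H) = S - X G" unfolding S_def using G fin by (simp add: sum_diff1)
  also have "ennreal r * x G + ennreal (S - X G) = ennreal (r * X G + (S - X G))"
    unfolding xX[OF G] using r X0 XG by (simp add: ennreal_mult ennreal_plus)
  finally have "(\<Sum>H\<in>?D. y H) / T \<le> ennreal (r * X G + (S - X G)) / T" by (rule divide_right_mono_ennreal)
  also have "\<dots> = ennreal ((r * X G + (S - X G)) / S)"
    unfolding TS using S r X0 XG by (intro divide_ennreal) auto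
  finally have "post_prec n p \<beta> \<Psi> \<pi> Y A \<le> (r * X G + (S - X G)) / S"
    unfolding pp using S r X0 XG by (intro enn2real_leI) auto
  also have "\<dots> = r * (X G / S) + (1 - X G / S)" using S by (simp add: add_divide_distrib diff_divide_distrib)
  also have "r * (X G / S) \<le> r * 1" using r S XG by (intro mult_left_mono) auto
  finally show ?thesis by (simp add: pgX)
qed

lemma outer_prob_nonneg: "0 \<le> outer_prob M A"
  unfolding outer_prob_def by (intro cInf_greatest) (auto intro!: exI[of _ "space M"])

text \<open>Only C has to be measurable. The events defined by posterior quantities enter as A and
  B, so their measurability is never an issue.\<close>

lemma outer_prob_le_add:
  assumes "prob_space M" and sub: "A \<inter> space M \<subseteq> B \<union> C" and C: "C \<in> sets M"
  shows "outer_prob M A \<le> outer_prob M B + measure M C"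
proof -
  interpret prob_space M by fact
  have "outer_prob M A - measure M C \<le> outer_prob M B"
    unfolding outer_prob_def[of M B]
  proof (rule cInf_greatest)
    show "{measure M B' | B'. B' \<in> sets M \<and> B \<inter> space M \<subseteq> B'} \<noteq> {}"
      by (auto intro!: exI[of _ "space M"])
    fix v assume "v \<in> {measure M B' | B'. B' \<in> sets M \<and> B \<inter> space M \<subseteq> B'}"
    then obtain B' where B': "v = measure M B'" "B' \<in> sets M" "B \<inter> space M \<subseteq> B'" by blast
    have "outer_prob M A \<le> measure M (B' \<union> C)"
      unfolding outer_prob_def
      by (rule cInf_lower) (use B' C sub in \<open>auto intro!: bdd_belowI[of _ 0] sets.Un\<close>)
    also have "\<dots> \<le> measure M B' + measure M C" by (rule measure_Un_le[OF B'(2) C])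
    finally show "outer_prob M A - measure M C \<le> v" by (simp add: B'(1))
  qed
  then show ?thesis by simp
qed

section \<open>Entrywise bounds and the tail estimate for a given sample\<close>

definition edge_support :: "nat \<Rightarrow> (nat \<times> nat) set \<Rightarrow> (nat \<times> nat) set" where
  "edge_support p E = {(i,j). i < p \<and> j < p \<and> (i = j \<or> adj E i j)}"

text \<open>The Frobenius norm sees both triangles of the matrix while \<open>free_coords\<close>
  stores one, hence the factor 2.\<close>

lemma card_edge_support:
  assumes "is_graph p E"
  shows "finite (edge_support p E)" "edge_support p E \<subseteq> {..<p} \<times> {..<p}"
    "card (edge_support p E) \<le> 2 * (p + card E)"
proof -
  note F = finite_free_coords[OF assms]
  show sub: "edge_support p E \<subseteq> {..<p} \<times> {..<p}" by (auto simp: edge_support_def)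
  then show "finite (edge_support p E)" by (rule finite_subset) simp
  have "edge_support p E \<subseteq> free_coords p E \<union> prod.swap ` free_coords p E"
  proof
    fix z assume "z \<in> edge_support p E"
    then obtain i j where z: "z = (i,j)" "i < p" "i = j \<or> adj E i j" by (auto simp: edge_support_def)
    then have "(min i j, max i j) \<in> free_coords p E" by (auto simp: free_coords_def adj_def)
    then show "z \<in> free_coords p E \<union> prod.swap ` free_coords p E"
      unfolding z by (cases "i \<le> j") (auto simp: min_def max_def intro!: image_eqI[of _ _ "(j,i)"])
  qed
  then have "card (edge_support p E) \<le> card (free_coords p E \<union> prod.swap ` free_coords p E)"
    using F(1) by (intro card_mono) auto
  also have "\<dots> \<le> card (free_coords p E) + card (prod.swap ` free_coords p E)" by (rule card_Un_le)
  also have "\<dots> \<le> 2 * (p + card E)" using card_image_le[OF F(1), of prod.swap] F(2) by simp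
  finally show "card (edge_support p E) \<le> 2 * (p + card E)" .
qed

text \<open>Test the lower bound on x, the i-th column of the inverse matrix A A^T: the form there
  equals s = x_i, so k s^2 <= k |x|^2 <= s.\<close>

lemma whitening_cov_diag_le:
  assumes W: "whitening p M U A" and k: "0 < k" and low: "\<And>x. k * (\<Sum>i<p. (x i)\<^sup>2) \<le> qform p M x"
    and i: "i < p"
  shows "(\<Sum>m<p. A i m * A i m) \<le> 1 / k"
proof -
  define s where "s = (\<Sum>m<p. A i m * A i m)"
  define x where "x j = (\<Sum>m<p. A j m * A i m)" for j
  have "(\<Sum>j<p. U j m * x j) = A i m" if "m < p" for m
    unfolding x_def using whiteningD(6)[OF W] that by (intro sum_inverse_apply) auto
  then have "qform p M x = s"
    unfolding qform_whitening[OF W] s_def by (simp add: power2_eq_square)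
  moreover have "(x i)\<^sup>2 \<le> (\<Sum>j<p. (x j)\<^sup>2)" by (rule member_le_sum) (use i in auto)
  then have "k * (x i)\<^sup>2 \<le> k * (\<Sum>j<p. (x j)\<^sup>2)" using k by simp
  ultimately have "k * (s * s) \<le> s" using low[of x] by (simp add: x_def s_def power2_eq_square)
  then have *: "s * (k * s) \<le> s * 1" by (simp add: mult_ac)
  have "0 \<le> s" by (simp add: s_def sum_nonneg)
  then have "k * s \<le> 1" using * by (cases "s = 0") auto
  then show ?thesis using k by (simp add: s_def field_simps)
qed

lemma cov_entry_abs_le:
  fixes A :: "nat \<Rightarrow> nat \<Rightarrow> real"
  assumes "(\<Sum>m<p. A i m * A i m) \<le> c" "(\<Sum>m<p. A j m * A j m) \<le> c"
  shows "\<bar>\<Sum>m<p. A i m * A j m\<bar> \<le> c"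
proof -
  have "\<bar>\<Sum>m<p. A i m * A j m\<bar> \<le> (\<Sum>m<p. (A i m * A i m + A j m * A j m) / 2)"
  proof (intro order.trans[OF sum_abs] sum_mono)
    fix m
    show "\<bar>A i m * A j m\<bar> \<le> (A i m * A i m + A j m * A j m) / 2"
      using sum_squares_bound[of "\<bar>A i m\<bar>" "\<bar>A j m\<bar>"] by (simp add: abs_mult power2_eq_square)
  qed
  also have "\<dots> = ((\<Sum>m<p. A i m * A i m) + (\<Sum>m<p. A j m * A j m)) / 2"
    by (simp add: sum.distrib[symmetric] sum_divide_distrib)
  also have "\<dots> \<le> c" using assms by simp
  finally show ?thesis .
qed

text \<open>M is the Gram matrix of the rows of its Cholesky factor, so the diagonal controls every
  entry.\<close>

lemma sym_pd_entry_abs_le: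
  assumes pd: "sym_pd p M" and ij: "i < p" "j < p" and d: "M i i \<le> a" "M j j \<le> a"
  shows "\<bar>M i j\<bar> \<le> a"
proof -
  obtain U A where W: "whitening p M U A" using sym_pd_whitening[OF pd] by blast
  show ?thesis
    using cov_entry_abs_le[of U i p a j] d ij by (simp add: whiteningD(5)[OF W])
qed

lemma log_kernel_entries_fn_mat: "log_kernel p \<alpha> Q (entries (fn_mat p X)) = log_kernel p \<alpha> Q X"
proof -
  have e: "fn_mat p X $$ (i,j) = X i j" if "i < p" "j < p" for i j using that by (simp add: fn_mat_def)
  have "(\<Sum>i<p. \<Sum>j<p. Q i j * fn_mat p X $$ (i,j)) = (\<Sum>i<p. \<Sum>j<p. Q i j * X i j)"
    by (intro sum.cong refl) (simp add: e)
  then show ?thesis by (simp add: log_kernel_def fn_mat_entries)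
qed

text \<open>The deterministic core: once the sample covariance is close to the truth on the support
  (V), the conditional posterior mass of the tail is at most 1 / p. All constants are fixed
  here.\<close>

lemma marg_part_tail_le:
  fixes Y :: "nat \<Rightarrow> nat \<Rightarrow> real" and n :: nat
  assumes gr: "is_graph p E" and \<Omega>0: "in_PG p E \<Omega>0" and \<Psi>: "pos_def p \<Psi>"
    and k: "0 < k" "k \<le> 1"
    and ev: "\<And>x. eigenvalue \<Omega>0 x \<Longrightarrow> k \<le> x \<and> x \<le> 1 / k"
    and ev\<Psi>: "\<And>x. eigenvalue \<Psi> x \<Longrightarrow> x \<le> a" and \<beta>: "0 < \<beta>"
    and W: "whitening p (entries \<Omega>0) U A"
    and n: "1 \<le> n" and lnp: "1 \<le> ln (real p)"
  defines "L \<equiv> real (p + card E) * ln (real p)"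
  defines "B \<equiv> 2 + 2 * (\<beta> / k + \<bar>a\<bar>)"
  defines "M \<equiv> 72 / k\<^sup>2 * (B / 4 + 1)"
  defines "R \<equiv> M * sqrt (L / real n)"
  assumes R: "R \<le> 6 / k"
    and V: "(\<Sum>(i,j)\<in>edge_support p E. (\<Sum>l<n. Y l i * Y l j - (\<Sum>m<p. A i m * A j m))\<^sup>2) < real n * L"
  shows "marg_part n p E \<beta> \<Psi> (\<lambda>\<Omega>. R < frob_norm p (\<Omega> - \<Omega>0)) Y
    \<le> ennreal (1 / real p) * marg_part n p E \<beta> \<Psi> (\<lambda>_. True) Y"
proof -
  let ?I = "edge_support p E"
  note I = card_edge_support[OF gr]
  have \<Omega>0c: "\<Omega>0 \<in> carrier_mat p p" and \<Omega>0M: "in_MG p E \<Omega>0" and \<Omega>0y: "symmetric_mat \<Omega>0"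
    and \<Omega>0s: "sym_pd p (entries \<Omega>0)"
    using \<Omega>0 pos_def_iff_sym_pd[of \<Omega>0 p] unfolding in_PG_def in_MG_def by auto
  have \<Psi>c: "\<Psi> \<in> carrier_mat p p" and \<Psi>y: "symmetric_mat \<Psi>" using \<Psi> by (auto simp: pos_def_def)
  have \<Psi>s: "sym_pd p (entries \<Psi>)" using \<Psi> pos_def_iff_sym_pd[OF \<Psi>c] by simp
  define S where "S i j = (\<Sum>m<p. A i m * A j m)" for i j
  \<comment> \<open>Entrywise bound for the prior's share \<beta> S - Psi of the gradient; S is the
    true covariance, with entries at most 1 / k.\<close>
  define b where "b = \<beta> / k + \<bar>a\<bar>"
  define s where "s = real (p + card E)"
  have p: "1 \<le> p" using lnp by (cases p) auto
  then have s1: "1 \<le> s" by (simp add: s_def)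
  have Ls: "L = s * ln (real p)" by (simp add: L_def s_def)
  have sL: "s \<le> L" unfolding Ls using s1 lnp by simp
  then have L: "1 \<le> L" using s1 by simp
  have b: "0 \<le> b" using \<beta> k by (simp add: b_def)
  have B: "B = 2 + 2 * b" by (simp add: B_def b_def)
  have low: "k * (\<Sum>i<p. (x i)\<^sup>2) \<le> qform p (entries \<Omega>0) x" for x
    using qform_ge_min_eigenvalue[OF \<Omega>0c \<Omega>0y] ev by blast
  have up: "qform p (entries \<Omega>0) x \<le> (1 / k) * (\<Sum>i<p. (x i)\<^sup>2)" for x
    using qform_le_max_eigenvalue[OF \<Omega>0c \<Omega>0y] ev by blast
  have S1: "\<bar>S i j\<bar> \<le> 1 / k" if "i < p" "j < p" for i j
    unfolding S_def using whitening_cov_diag_le[OF W k(1) low] that by (intro cov_entry_abs_le) auto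
  have \<Psi>d: "\<Psi> $$ (i,i) \<le> \<bar>a\<bar>" if "i < p" for i
  proof -
    have "qform p (entries \<Psi>) (\<lambda>m. if m = i then 1 else 0) \<le> a * (\<Sum>m<p. (if m = i then 1 else 0)\<^sup>2)"
      using qform_le_max_eigenvalue[OF \<Psi>c \<Psi>y] ev\<Psi> by blast
    also have "(\<Sum>m<p. (if m = i then 1 else 0)\<^sup>2 :: real) = (\<Sum>m<p. if m = i then 1 else 0)"
      by (intro sum.cong) auto
    finally show ?thesis using that by (simp add: qform_unit)
  qed
  have \<Psi>1: "\<bar>\<Psi> $$ (i,j)\<bar> \<le> \<bar>a\<bar>" if "i < p" "j < p" for i j
    using sym_pd_entry_abs_le[OF \<Psi>s that] \<Psi>d that by simp
  define \<alpha> where "\<alpha> = (\<beta> + real n) / 2"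
  define Q where "Q i j = \<Psi> $$ (i,j) + (\<Sum>l<n. Y l i * Y l j)" for i j
  \<comment> \<open>The squared gradient on the support is at most (2 + 4 b^2) n L: sampling error
    from V, prior share from b and s <= n L. B = 2 + 2 b is chosen so that B^2 exceeds that
    factor.\<close>
  define h where "h = B * sqrt (real n * L)"
  have h0: "0 \<le> h" using b L by (simp add: h_def B)
  define Z where "Z i j = (\<Sum>l<n. Y l i * Y l j - S i j)" for i j
  have "(\<Sum>(i,j)\<in>?I. (2 * \<alpha> * S i j - Q i j)\<^sup>2) \<le> (\<Sum>(i,j)\<in>?I. 2 * (Z i j)\<^sup>2 + 2 * b\<^sup>2)"
  proof (intro sum_mono, clarify)
    fix i j assume "(i,j) \<in> ?I"
    then have ij: "i < p" "j < p" by (auto simp: edge_support_def)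
    define v where "v = \<beta> * S i j - \<Psi> $$ (i,j)"
    have "\<bar>\<beta> * S i j\<bar> \<le> \<beta> * (1 / k)"
      using mult_left_mono[OF S1[OF ij], of \<beta>] \<beta> by (simp add: abs_mult)
    then have "\<bar>v\<bar> \<le> b" using \<Psi>1[OF ij] unfolding v_def b_def by simp
    then have v2: "v\<^sup>2 \<le> b\<^sup>2" using power_mono[of "\<bar>v\<bar>" b 2] by simp
    have "2 * \<alpha> * S i j - Q i j = v - Z i j"
      by (simp add: \<alpha>_def Q_def v_def Z_def sum_subtractf algebra_simps)
    then have "(2 * \<alpha> * S i j - Q i j)\<^sup>2 = (v - Z i j)\<^sup>2" by simp
    also have "\<dots> \<le> 2 * (Z i j)\<^sup>2 + 2 * v\<^sup>2"
      using zero_le_power2[of "v + Z i j"] by (simp add: power2_sum power2_diff)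
    also have "\<dots> \<le> 2 * (Z i j)\<^sup>2 + 2 * b\<^sup>2" using v2 by simp
    finally show "(2 * \<alpha> * S i j - Q i j)\<^sup>2 \<le> 2 * (Z i j)\<^sup>2 + 2 * b\<^sup>2" .
  qed
  also have "\<dots> = 2 * (\<Sum>(i,j)\<in>?I. (Z i j)\<^sup>2) + real (card ?I) * (2 * b\<^sup>2)"
    by (simp add: case_prod_beta sum.distrib sum_distrib_left)
  also have "\<dots> \<le> 2 * (real n * L) + (2 * s) * (2 * b\<^sup>2)"
  proof (intro add_mono mult_right_mono)
    show "2 * (\<Sum>(i,j)\<in>?I. (Z i j)\<^sup>2) \<le> 2 * (real n * L)" using V by (simp add: Z_def S_def)
    show "real (card ?I) \<le> 2 * s" using I(3) by (simp add: s_def)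
  qed simp
  also have "\<dots> \<le> 2 * (real n * L) + (2 * (real n * L)) * (2 * b\<^sup>2)"
  proof -
    have "1 * s \<le> real n * L" using n sL s1 by (intro mult_mono) auto
    then have "(2 * s) * (2 * b\<^sup>2) \<le> (2 * (real n * L)) * (2 * b\<^sup>2)" by (intro mult_right_mono) auto
    then show ?thesis by simp
  qed
  also have "\<dots> = (2 + 4 * b\<^sup>2) * (real n * L)" by (simp add: algebra_simps)
  also have "\<dots> \<le> B\<^sup>2 * (real n * L)"
    using b L by (intro mult_right_mono) (simp_all add: B power2_sum power_mult_distrib)
  also have "\<dots> = h\<^sup>2" using L by (simp add: h_def power_mult_distrib)
  finally have hh: "(\<Sum>(i,j)\<in>?I. (2 * \<alpha> * (\<Sum>m<p. A i m * A j m) - Q i j)\<^sup>2) \<le> h\<^sup>2"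
    by (simp add: S_def)
  define q where "q = sqrt (L / real n)"
  have q: "0 < q" "q\<^sup>2 = L / real n" using L n by (auto simp: q_def)
  \<comment> \<open>Half of R, so that a point beyond R has its midpoint with Omega0 beyond \<rho>;
    the hypothesis R <= 6 / k becomes the cap \<rho> <= 3 K with K = 1 / k.\<close>
  define \<rho> where "\<rho> = R / 2"
  have Rq: "R = M * q" by (simp add: R_def q_def)
  have "1 \<le> 1 / k\<^sup>2" using k by (simp add: power_le_one)
  then have "72 * 1 \<le> M"
    unfolding M_def B using b by (intro mult_mono) auto
  then have M2: "2 \<le> M" by simp
  have \<rho>: "0 < \<rho>" "\<rho> \<le> 3 * (1 / k)" using q M2 R by (auto simp: \<rho>_def Rq)
  have hq: "h * q = B * L"
  proof -
    have "sqrt (real n * L) * q = sqrt (L * L)"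
      unfolding q_def real_sqrt_mult[symmetric] using n by simp
    then show ?thesis using L by (simp add: h_def)
  qed
  have "2 * L \<le> M * L" using M2 L by simp
  \<comment> \<open>The equation that determines M: the quadratic gain is M^2 k^2 L / 72, the linear
    loss M B L / 4, and M makes \<open>M * k\<^sup>2 / 72 - B / 4\<close> equal to 1.\<close>
  also have "M * L = M * (M * k\<^sup>2 / 72 - B / 4) * L"
    using k by (simp add: M_def field_simps)
  also have "\<dots> = real n / 2 * \<rho>\<^sup>2 / (9 * (1 / k)\<^sup>2) - h * \<rho> / 2"
  proof -
    have n1: "real n * \<rho>\<^sup>2 = M\<^sup>2 * L / 4" using n q(2) by (simp add: \<rho>_def Rq power_mult_distrib power_divide)
    have n2: "h * \<rho> = M * (B * L) / 2" using hq by (simp add: \<rho>_def Rq mult_ac)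
    have n3: "real n / 2 * \<rho>\<^sup>2 / (9 * (1 / k)\<^sup>2) = real n * \<rho>\<^sup>2 * k\<^sup>2 / 18"
      using k by (simp add: field_simps)
    have "real n / 2 * \<rho>\<^sup>2 / (9 * (1 / k)\<^sup>2) - h * \<rho> / 2
        = M\<^sup>2 * L / 4 * k\<^sup>2 / 18 - M * (B * L) / 2 / 2"
      by (simp only: n3 n1 n2)
    then show ?thesis by (simp add: field_simps power2_eq_square)
  qed
  also have "\<dots> \<le> \<alpha> * \<rho>\<^sup>2 / (9 * (1 / k)\<^sup>2) - h * \<rho> / 2"
    using \<beta> by (intro diff_right_mono divide_right_mono mult_right_mono) (auto simp: \<alpha>_def)
  finally have \<kappa>: "2 * L \<le> \<alpha> * \<rho>\<^sup>2 / (9 * (1 / k)\<^sup>2) - h * \<rho> / 2" .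
  have "marg_part n p E \<beta> \<Psi> (\<lambda>\<Omega>. R < frob_norm p (\<Omega> - \<Omega>0)) Y
    \<le> ennreal (2 ^ (p + card E) * exp (- (2 * L))) * marg_part n p E \<beta> \<Psi> (\<lambda>_. True) Y"
  proof (rule marg_part_ratio[OF gr \<Psi>c \<Omega>0])
    fix \<Omega>1 assume \<Omega>1: "in_PG p E \<Omega>1" and far: "R < frob_norm p (\<Omega>1 - \<Omega>0)"
    have \<Omega>1c: "\<Omega>1 \<in> carrier_mat p p" and \<Omega>1M: "in_MG p E \<Omega>1" and \<Omega>1s: "sym_pd p (entries \<Omega>1)"
      using \<Omega>1 pos_def_iff_sym_pd[of \<Omega>1 p] unfolding in_PG_def in_MG_def by auto
    define Mid where "Mid = (\<lambda>i j. (\<Omega>0 $$ (i,j) + \<Omega>1 $$ (i,j)) / 2)"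
    have "sym_pd p (\<lambda>i j. (1 - 1/2) * \<Omega>0 $$ (i,j) + 1/2 * \<Omega>1 $$ (i,j))"
      by (intro sym_pd_convex \<Omega>0s \<Omega>1s) auto
    also have "?this \<longleftrightarrow> sym_pd p (entries (fn_mat p Mid))"
      by (rule sym_pd_cong) (simp add: fn_mat_def Mid_def)
    finally have Mids: "sym_pd p (entries (fn_mat p Mid))" .
    have supp: "\<Omega>1 $$ (i,j) = \<Omega>0 $$ (i,j)" if "i < p" "j < p" "(i,j) \<notin> ?I" for i j
      using \<Omega>0M \<Omega>1M that by (auto simp: in_MG_def edge_support_def)
    have "log_kernel p \<alpha> Q (entries \<Omega>1) \<le> log_kernel p \<alpha> Q Mid - 2 * L"
      unfolding Mid_def
    proof (rule log_kernel_midpoint_drop[OF \<Omega>1s \<Omega>0s W _ up \<rho>(1) _ \<rho>(2) _ I(2) supp h0 hh _ \<kappa>])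
      show "2 * \<rho> < fnorm p (\<lambda>i j. \<Omega>1 $$ (i,j) - \<Omega>0 $$ (i,j))"
        using far by (simp add: \<rho>_def frob_norm_eq_fnorm[OF \<Omega>1c \<Omega>0c])
    qed (use k \<beta> L in \<open>auto simp: \<alpha>_def\<close>)
    then show "gwish_kernel p \<beta> \<Psi> \<Omega>1 * likelihood n p \<Omega>1 Y
      \<le> exp (- (2 * L)) * (gwish_kernel p \<beta> \<Psi> (fn_mat p (\<lambda>i j. (\<Omega>0 $$ (i,j) + \<Omega>1 $$ (i,j)) / 2)) *
         likelihood n p (fn_mat p (\<lambda>i j. (\<Omega>0 $$ (i,j) + \<Omega>1 $$ (i,j)) / 2)) Y)"
      unfolding Mid_def[symmetric] gwish_likelihood_eq_exp[OF \<Psi>c \<Omega>1c \<Omega>1s]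
        gwish_likelihood_eq_exp[OF \<Psi>c fn_mat_carrier Mids] log_kernel_entries_fn_mat
        mult_exp_exp exp_le_cancel_iff \<alpha>_def Q_def[abs_def]
      by simp
  qed
  also have "\<dots> \<le> ennreal (1 / real p) * marg_part n p E \<beta> \<Psi> (\<lambda>_. True) Y"
  proof (intro mult_right_mono ennreal_leI)
    \<comment> \<open>The Jacobian is at most exp s <= exp L, so one of the two factors exp (- L)
      pays for it and the other is at most 1 / p.\<close>
    have "(2::real) ^ (p + card E) \<le> exp 1 ^ (p + card E)"
      using exp_ge_add_one_self[of 1] by (intro power_mono) auto
    also have "\<dots> = exp s" by (simp add: s_def exp_of_nat_mult[symmetric])
    finally have "2 ^ (p + card E) * exp (- (2 * L)) \<le> exp s * exp (- (2 * L))" by simp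
    also have "\<dots> \<le> exp (- ln (real p))"
    proof -
      have "1 * ln (real p) \<le> L" unfolding Ls using s1 lnp by (intro mult_right_mono) auto
      then show ?thesis using sL by (simp add: mult_exp_exp)
    qed
    also have "\<dots> = 1 / real p" using p by (simp add: exp_minus inverse_eq_divide)
    finally show "2 ^ (p + card E) * exp (- (2 * L)) \<le> 1 / real p" .
  qed simp
  finally show ?thesis .
qed

text \<open>Off the covariance event and the graph event the tail has mass at most 1 / p +
  \<epsilon> / 2 <= \<epsilon>. The minimum with 1/2 keeps the posterior of the true graph positive,
  as \<open>post_prec_le\<close> requires.\<close>

lemma posterior_tail_outer_prob_le:
  fixes n :: nat
  assumes dec: "decomposable p E" and \<Omega>0: "in_PG p E \<Omega>0" and \<Psi>: "pos_def p \<Psi>"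
    and k: "0 < k" "k \<le> 1"
    and ev: "\<And>x. eigenvalue \<Omega>0 x \<Longrightarrow> k \<le> x \<and> x \<le> 1 / k"
    and ev\<Psi>: "\<And>x. eigenvalue \<Psi> x \<Longrightarrow> x \<le> a" and \<beta>: "0 < \<beta>"
    and n: "1 \<le> n" and lnp: "1 \<le> ln (real p)"
  defines "L \<equiv> real (p + card E) * ln (real p)"
  defines "M \<equiv> 72 / k\<^sup>2 * ((2 + 2 * (\<beta> / k + \<bar>a\<bar>)) / 4 + 1)"
  assumes R: "M * sqrt (L / real n) \<le> 6 / k"
    and \<epsilon>: "0 < \<epsilon>" "1 / real p \<le> \<epsilon> / 2"
  shows "outer_prob (sample_law n p \<Omega>0)
      {Y. \<epsilon> < post_prec n p \<beta> \<Psi> \<pi> Y (\<lambda>\<Omega>. M * sqrt (L / real n) < frob_norm p (\<Omega> - \<Omega>0))}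
    \<le> outer_prob (sample_law n p \<Omega>0) {Y. min (\<epsilon> / 2) (1/2) < \<bar>post_graph n p \<beta> \<Psi> \<pi> Y E - 1\<bar>}
      + 6 / k\<^sup>2 / ln (real p)"
proof -
  have gr: "is_graph p E" using dec by (simp add: decomposable_def)
  note I = card_edge_support[OF gr]
  have \<Omega>0c: "\<Omega>0 \<in> carrier_mat p p" and \<Omega>0y: "symmetric_mat \<Omega>0" and pd: "pos_def p \<Omega>0"
    and \<Omega>0s: "sym_pd p (entries \<Omega>0)"
    using \<Omega>0 pos_def_iff_sym_pd[of \<Omega>0 p] unfolding in_PG_def in_MG_def by auto
  obtain U A where W: "whitening p (entries \<Omega>0) U A" using sym_pd_whitening[OF \<Omega>0s] by blast
  have low: "k * (\<Sum>i<p. (x i)\<^sup>2) \<le> qform p (entries \<Omega>0) x" for x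
    using qform_ge_min_eigenvalue[OF \<Omega>0c \<Omega>0y] ev by blast
  have p: "1 \<le> p" using lnp by (cases p) auto
  have "0 < ln (real p)" using lnp by linarith
  then have L: "0 < L" unfolding L_def using p by simp
  define V where "V Y = (\<Sum>(i,j)\<in>edge_support p E. (\<Sum>l<n. Y l i * Y l j - (\<Sum>m<p. A i m * A j m))\<^sup>2)" for Y
  let ?S = "sample_law n p \<Omega>0"
  let ?C = "{Y \<in> space ?S. real n * L \<le> V Y}"
  have t: "0 < real n * L" using n L by simp
  note conc = sample_covariance_concentration[OF pd W I(1,2) t whitening_cov_diag_le[OF W k(1) low], where n=n,
      folded V_def]
  \<comment> \<open>The support has at most 2 s entries, each with error variance at most 3 n / k^2;
    the factor ln p of the threshold n L is all that survives in the denominator.\<close>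
  have mC: "measure ?S ?C \<le> 6 / k\<^sup>2 / ln (real p)"
  proof -
    have "measure ?S ?C \<le> real (card (edge_support p E)) * real n * (3 * (1 / k)\<^sup>2) / (real n * L)"
      by (rule conc(2))
    also have "\<dots> \<le> (2 * real (p + card E)) * real n * (3 * (1 / k)\<^sup>2) / (real n * L)"
      using I(3) t by (intro divide_right_mono mult_right_mono) auto
    also have "\<dots> = 6 / k\<^sup>2 / ln (real p)"
    proof -
      define s where "s = real (p + card E)"
      have "0 < s" using p by (simp add: s_def)
      then show ?thesis
        unfolding L_def s_def[symmetric] using n lnp k by (simp add: field_simps)
    qed
    finally show ?thesis .
  qed
  have ps: "prob_space ?S"
    unfolding sample_law_def by (intro prob_space_PiM prob_space_gaussian pd)
  have "outer_prob ?S
      {Y. \<epsilon> < post_prec n p \<beta> \<Psi> \<pi> Y (\<lambda>\<Omega>. M * sqrt (L / real n) < frob_norm p (\<Omega> - \<Omega>0))}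
    \<le> outer_prob ?S {Y. min (\<epsilon> / 2) (1/2) < \<bar>post_graph n p \<beta> \<Psi> \<pi> Y E - 1\<bar>} + measure ?S ?C"
  proof (rule outer_prob_le_add[OF ps _ conc(1)], rule subsetI, rule ccontr)
    fix Y assume Y: "Y \<in> {Y. \<epsilon> < post_prec n p \<beta> \<Psi> \<pi> Y (\<lambda>\<Omega>. M * sqrt (L / real n) < frob_norm p (\<Omega> - \<Omega>0))} \<inter> space ?S"
      and "Y \<notin> {Y. min (\<epsilon> / 2) (1/2) < \<bar>post_graph n p \<beta> \<Psi> \<pi> Y E - 1\<bar>} \<union> ?C"
    then have "\<bar>post_graph n p \<beta> \<Psi> \<pi> Y E - 1\<bar> \<le> min (\<epsilon> / 2) (1/2)" and V: "V Y < real n * L"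
      by (simp_all only: Un_iff mem_Collect_eq Int_iff not_less de_Morgan_disj de_Morgan_conj) auto
    then have g: "\<bar>post_graph n p \<beta> \<Psi> \<pi> Y E - 1\<bar> \<le> \<epsilon> / 2" "\<bar>post_graph n p \<beta> \<Psi> \<pi> Y E - 1\<bar> \<le> 1/2"
      by (auto intro: order.trans[OF _ min.cobounded1] order.trans[OF _ min.cobounded2])
    have "marg_part n p E \<beta> \<Psi> (\<lambda>\<Omega>. M * sqrt (L / real n) < frob_norm p (\<Omega> - \<Omega>0)) Y
        \<le> ennreal (1 / real p) * marg_part n p E \<beta> \<Psi> (\<lambda>_. True) Y"
      by (rule marg_part_tail_le[where a=a, OF gr \<Omega>0 \<Psi> k _ _ \<beta> W n lnp, folded L_def M_def, OF _ _ R V[unfolded V_def]])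
         (use ev ev\<Psi> in blast)+
    moreover have d: "1 - post_graph n p \<beta> \<Psi> \<pi> Y E \<le> \<bar>post_graph n p \<beta> \<Psi> \<pi> Y E - 1\<bar>" by simp
    with g(2) have "1 - post_graph n p \<beta> \<Psi> \<pi> Y E \<le> 1/2" by (rule order.trans[rotated])
    then have "0 < post_graph n p \<beta> \<Psi> \<pi> Y E" by simp
    moreover have "E \<in> decomp_graphs p" using dec by (simp add: decomp_graphs_def)
    ultimately have "post_prec n p \<beta> \<Psi> \<pi> Y (\<lambda>\<Omega>. M * sqrt (L / real n) < frob_norm p (\<Omega> - \<Omega>0))
        \<le> 1 / real p + (1 - post_graph n p \<beta> \<Psi> \<pi> Y E)"
      by (intro post_prec_le) simp_all
    also have "\<dots> \<le> \<epsilon> / 2 + \<epsilon> / 2" by (rule add_mono[OF \<epsilon>(2) order.trans[OF d g(1)]])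
    finally show False using Y by simp
  qed
  then show ?thesis using mC by linarith
qed

theorem theorem7:
  fixes p :: "nat \<Rightarrow> nat"
    and E0 :: "nat \<Rightarrow> (nat \<times> nat) set"
    and \<Omega>0 :: "nat \<Rightarrow> real mat"
    and k\<sigma> :: real
    and \<beta> :: real
    and \<Psi> :: "nat \<Rightarrow> real mat"
    and a :: real
    and \<pi> :: "nat \<Rightarrow> (nat \<times> nat) set \<Rightarrow> real"
  assumes p_inf: "filterlim p at_top at_top"
    and G0_decomp: "\<And>n. decomposable (p n) (E0 n)"
    and G0_peo: "\<And>n. perfect_elim_order (p n) (E0 n)"
    and Omega0_PG: "\<And>n. in_PG (p n) (E0 n) (\<Omega>0 n)"
    and assmD_k: "0 < k\<sigma>" "k\<sigma> \<le> 1"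
    and assmD: "\<And>n x. eigenvalue (\<Omega>0 n) x \<Longrightarrow> k\<sigma> \<le> x \<and> x \<le> 1 / k\<sigma>"
    and assmF: "(\<lambda>n. real (p n + card (E0 n)) * ln (real (p n))) \<in> o(\<lambda>n. real n)"
    and beta_pos: "0 < \<beta>"
    and Psi_pd: "\<And>n. pos_def (p n) (\<Psi> n)"
    and Psi_bound: "\<And>n x. eigenvalue (\<Psi> n) x \<Longrightarrow> x \<le> a"
    and prior_nonneg: "\<And>n G. G \<in> decomp_graphs (p n) \<Longrightarrow> 0 \<le> \<pi> n G"
    and prior_sum: "\<And>n. (\<Sum>G \<in> decomp_graphs (p n). \<pi> n G) = 1"
    and assmJ: "\<And>\<epsilon>. \<epsilon> > 0 \<Longrightarrow>
       (\<lambda>n. outer_prob (sample_law n (p n) (\<Omega>0 n))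
          {Y. \<bar>post_graph n (p n) \<beta> (\<Psi> n) (\<pi> n) Y (E0 n) - 1\<bar> > \<epsilon>}) \<longlonglongrightarrow> 0"
  shows "\<exists>M. \<forall>\<epsilon> > 0.
       (\<lambda>n. outer_prob (sample_law n (p n) (\<Omega>0 n))
          {Y. post_prec n (p n) \<beta> (\<Psi> n) (\<pi> n) Y
                (\<lambda>\<Omega>. frob_norm (p n) (\<Omega> - \<Omega>0 n) >
                      M * sqrt (real (p n + card (E0 n)) * ln (real (p n)) / real n)) > \<epsilon>})
       \<longlonglongrightarrow> 0"
proof (intro exI allI impI)
  \<comment> \<open>Depends only on k\<sigma>, \<beta> and \<open>a\<close>, hence serves all n and
    \<epsilon>.\<close>
  define M where "M = 72 / k\<sigma>\<^sup>2 * ((2 + 2 * (\<beta> / k\<sigma> + \<bar>a\<bar>)) / 4 + 1)"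
  define L where "L n = real (p n + card (E0 n)) * ln (real (p n))" for n
  fix \<epsilon> :: real assume \<epsilon>: "0 < \<epsilon>"
  have p_real: "filterlim (\<lambda>n. real (p n)) at_top sequentially"
    using p_inf filterlim_real_sequentially by (rule filterlim_compose[rotated])
  then have ln_inf: "filterlim (\<lambda>n. ln (real (p n))) at_top sequentially"
    by (rule filterlim_compose[OF ln_at_top])
  have "(\<lambda>n. L n / real n) \<longlonglongrightarrow> 0"
    using smalloD_tendsto[OF assmF] by (simp add: L_def)
  then have "(\<lambda>n. M * sqrt (L n / real n)) \<longlonglongrightarrow> M * sqrt 0"
    by (intro tendsto_intros)
  \<comment> \<open>The radius tends to 0, so it eventually falls inside the range where ln det has
    its quadratic bound.\<close>
  then have ev_R: "eventually (\<lambda>n. M * sqrt (L n / real n) < 6 / k\<sigma>) sequentially"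
    using assmD_k by (intro order_tendstoD(2)) auto
  have "(\<lambda>n. 1 / real (p n)) \<longlonglongrightarrow> 0"
    using tendsto_inverse_0_at_top[OF p_real] by (simp add: inverse_eq_divide)
  then have ev_p: "eventually (\<lambda>n. 1 / real (p n) < \<epsilon> / 2) sequentially"
    using \<epsilon> by (intro order_tendstoD(2)) auto
  have ev_ln: "eventually (\<lambda>n. 1 \<le> ln (real (p n))) sequentially"
    using ln_inf by (simp add: filterlim_at_top)
  let ?bad = "\<lambda>n. outer_prob (sample_law n (p n) (\<Omega>0 n))
      {Y. \<epsilon> < post_prec n (p n) \<beta> (\<Psi> n) (\<pi> n) Y
        (\<lambda>\<Omega>. M * sqrt (L n / real n) < frob_norm (p n) (\<Omega> - \<Omega>0 n))}"
  let ?J = "\<lambda>n. outer_prob (sample_law n (p n) (\<Omega>0 n))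
      {Y. min (\<epsilon> / 2) (1/2) < \<bar>post_graph n (p n) \<beta> (\<Psi> n) (\<pi> n) Y (E0 n) - 1\<bar>}"
  have "eventually (\<lambda>n. ?bad n \<le> ?J n + 6 / k\<sigma>\<^sup>2 / ln (real (p n))) sequentially"
    using ev_R ev_p ev_ln eventually_ge_at_top[of 1]
  proof eventually_elim
    case (elim n)
    show ?case
      unfolding L_def M_def
    proof (rule posterior_tail_outer_prob_le[OF G0_decomp Omega0_PG Psi_pd assmD_k _ _ beta_pos])
      show "eigenvalue (\<Omega>0 n) x \<Longrightarrow> k\<sigma> \<le> x \<and> x \<le> 1 / k\<sigma>" for x by (rule assmD)
      show "eigenvalue (\<Psi> n) x \<Longrightarrow> x \<le> a" for x by (rule Psi_bound)
    qed (use elim \<epsilon> in \<open>simp_all add: L_def M_def\<close>)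
  qed
  moreover have "(\<lambda>n. ?J n + 6 / k\<sigma>\<^sup>2 / ln (real (p n))) \<longlonglongrightarrow> 0 + 0"
  proof (intro tendsto_add assmJ)
    show "(\<lambda>n. 6 / k\<sigma>\<^sup>2 / ln (real (p n))) \<longlonglongrightarrow> 0"
      by (rule tendsto_divide_0[OF tendsto_const filterlim_at_top_imp_at_infinity[OF ln_inf]])
  qed (use \<epsilon> in simp)
  ultimately have "?bad \<longlonglongrightarrow> 0"
    by (intro tendsto_sandwich[of "\<lambda>_. 0" ?bad sequentially]) (auto simp: outer_prob_nonneg)
  then show "(\<lambda>n. outer_prob (sample_law n (p n) (\<Omega>0 n))
          {Y. post_prec n (p n) \<beta> (\<Psi> n) (\<pi> n) Y
                (\<lambda>\<Omega>. frob_norm (p n) (\<Omega> - \<Omega>0 n) >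
                      M * sqrt (real (p n + card (E0 n)) * ln (real (p n)) / real n)) > \<epsilon>})
       \<longlonglongrightarrow> 0"
    unfolding L_def .
qed

end
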